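(* QPTL and behavioral GFG-QPTL are equi-expressive: for every QPTL formula $\varphi$ there is a behavioral GFG-QPTL formula $\varphi'$ with $\mathrm{free}(\varphi')=\mathrm{free}(\varphi)$ such that for every assignment $\chi\in\mathrm{Asg}(\mathrm{free}(\varphi))$, $\chi\models\varphi$ (Tarski semantics) iff $\{\{\chi\}\}\models^{\exists\forall}\varphi'$; and conversely, for every behavioral GFG-QPTL formula $\varphi'$ there is a QPTL formula $\varphi$ with the same free propositions satisfying the same equivalence for all $\chi\in\mathrm{Asg}(\mathrm{free}(\varphi'))$.
   Context: Let $AP$ be a set of atomic propositions and $\mathbb B=\{\top,\bot\}$. A temporal valuation is a function $f:\mathbb N\to\mathbb B$. An assignment is a partial function $\chi:AP\rightharpoonup(\mathbb N\to\mathbb B)$; $\mathrm{Asg}$ is the set of all assignments, $\mathrm{Asg}(P)$ the set of assignments with domain exactly $P\subseteq AP$. For an assignment $\chi$, $p\in AP$ and a temporal valuation $f$, $\chi[p\mapsto f]$ is the assignment that agrees with $\chi$ except that it maps $p$ to $f$. QPTL formulas are generated by $\varphi::=\psi\mid\neg\varphi\mid\varphi\wedge\varphi\mid\varphi\vee\varphi\mid\exists p.\varphi\mid\forall p.\varphi$, where $\psi$ ranges over LTL formulas over $AP$ and $p\in AP$; $\mathrm{free}(\varphi)$ is the set of free propositions. Tarski semantics, for $\chi\in\mathrm{Asg}_\supseteq(\mathrm{free}(\varphi))$: $\chi\models\psi$ for LTL $\psi$ iff the infinite word whose $t$-th letter is the valuation $q\mapsto\chi(q)(t)$ satisfies $\psi$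 in the standard LTL sense (written $\chi\models_{LTL}\psi$); Boolean connectives as usual; $\chi\models\exists p.\phi$ iff $\chi[p\mapsto f]\models\phi$ for some temporal valuation $f$; $\chi\models\forall p.\phi$ iff for all $f$. A hyperassignment is a set $\mathcal X$ with $\emptyset\neq\mathcal X\subseteq 2^{\mathrm{Asg}(P)}$ and $\emptyset\notin\mathcal X$, for some $P\subseteq AP$; this $P$ is denoted $\mathrm{ap}(\mathcal X)$. A choice function for $\mathcal X$ is a map $c:\mathcal X\to\mathrm{Asg}$ with $c(X)\in X$; the dual of $\mathcal X$ is $\overline{\mathcal X}=\{\mathrm{img}(c): c\text{ a choice function for }\mathcal X\}$. A functor over $P$ is a function $F:\mathrm{Asg}(P)\to(\mathbb N\to\mathbb B)$; $\mathrm{ext}(X,F,p)=\{\chi[p\mapsto F(\chi)]:\chi\in X\}$. For $\chi_1,\chi_2\in\mathrm{Asg}(P)$, $p\in P$, $k\in\mathbb N$: $\chi_1\approx^{>k}_p\chi_2$ iff $\chi_1(q)=\chi_2(q)$ for all $q\in P\setminus\{p\}$ and $\chi_1(p)(t)=\chi_2(p)(t)$ for all $t\le k$. $F$ is behavioral w.r.t. $p$ if $F(\chi_1)(k)=F(\chi_2)(k)$ whenever $\chi_1\approx^{>k}_p\chi_2$. Let $\mathrm{Fnc}_{\mathsf B}(P)$ be the set of functors over $P$ behavioral w.r.t. every $p\in P$, and $\mathrm{ext}_{\mathsf B}(\mathcal X,p)=\{\mathrm{ext}(X,F,p):X\in\mathcal X,F\in\mathrm{Fnc}_{\mathsf B}(\mathrm{ap}(\mathcal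 X))\}$. A behavioral GFG-QPTL formula is $\varphi'=Q_1^{\mathsf B}p_1.\cdots Q_n^{\mathsf B}p_n.\psi$ with $Q_i\in\{\exists,\forall\}$, pairwise distinct $p_i\in AP$ and $\psi$ LTL; $\mathrm{free}(\varphi')$ are the propositions of $\psi$ other than the $p_i$. For a hyperassignment $\mathcal X$ with $\mathrm{ap}(\mathcal X)\supseteq\mathrm{free}(\varphi')$ and $p_i\notin\mathrm{ap}(\mathcal X)$, and flags $\exists\forall,\forall\exists$: (1) $\mathcal X\models^{\exists\forall}\psi$ iff some $X\in\mathcal X$ has all $\chi\in X$ with $\chi\models_{LTL}\psi$; $\mathcal X\models^{\forall\exists}\psi$ iff every $X\in\mathcal X$ has some $\chi\in X$ with $\chi\models_{LTL}\psi$; (2) $\mathcal X\models^{\exists\forall}\exists^{\mathsf B}p.\phi$ iff $\mathrm{ext}_{\mathsf B}(\mathcal X,p)\models^{\exists\forall}\phi$, and $\mathcal X\models^{\forall\exists}\exists^{\mathsf B}p.\phi$ iff $\overline{\mathcal X}\models^{\exists\forall}\exists^{\mathsf B}p.\phi$; (3) $\mathcal X\models^{\forall\exists}\forall^{\mathsf B}p.\phi$ iff $\mathrm{ext}_{\mathsf B}(\mathcal X,p)\models^{\forall\exists}\phi$, and $\mathcal X\models^{\exists\forall}\forall^{\mathsf B}p.\phi$ iff $\overline{\mathcal X}\models^{\forall\exists}\forall^{\mathsf B}p.\phi$. (For singleton hyperassignments $\{\{\chi\}\}$ the two flags give the same verdict.)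
   Formalization: The set AP is assumed infinite; for finite AP with at least two propositions the claim fails, since a QPTL formula may have all of AP free and say "p holds at all even positions", while a GFG-QPTL formula with these free propositions is plain LTL. *)

theory Defs
  imports Main
begin

datatype 'ap ltl =
    LTrue
  | LProp 'ap
  | LNot "'ap ltl"
  | LAnd "'ap ltl" "'ap ltl"
  | LOr "'ap ltl" "'ap ltl"
  | LNext "'ap ltl"
  | LUntil "'ap ltl" "'ap ltl"

fun ltl_props :: "'ap ltl \<Rightarrow> 'ap set" where
  "ltl_props LTrue = {}"
| "ltl_props (LProp p) = {p}"
| "ltl_props (LNot a) = ltl_props a"
| "ltl_props (LAnd a b) = ltl_props a \<union> ltl_props b"
| "ltl_props (LOr a b) = ltl_props a \<union> ltl_props b"
| "ltl_props (LNext a) = ltl_props a"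
| "ltl_props (LUntil a b) = ltl_props a \<union> ltl_props b"

fun ltl_sem :: "(nat \<Rightarrow> 'ap set) \<Rightarrow> 'ap ltl \<Rightarrow> bool" where
  "ltl_sem w LTrue = True"
| "ltl_sem w (LProp p) = (p \<in> w 0)"
| "ltl_sem w (LNot a) = (\<not> ltl_sem w a)"
| "ltl_sem w (LAnd a b) = (ltl_sem w a \<and> ltl_sem w b)"
| "ltl_sem w (LOr a b) = (ltl_sem w a \<or> ltl_sem w b)"
| "ltl_sem w (LNext a) = ltl_sem (\<lambda>t. w (Suc t)) a"
| "ltl_sem w (LUntil a b) =
     (\<exists>j. ltl_sem (\<lambda>t. w (t + j)) b \<and> (\<forall>i<j. ltl_sem (\<lambda>t. w (t + i)) a))"

type_synonym tval = "nat \<Rightarrow> bool"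
type_synonym 'ap asg = "'ap \<Rightarrow> tval option"

definition Asg :: "'ap set \<Rightarrow> 'ap asg set" where
  "Asg P = {\<chi>. dom \<chi> = P}"

definition asg_word :: "'ap asg \<Rightarrow> nat \<Rightarrow> 'ap set" where
  "asg_word \<chi> t = {q. \<exists>f. \<chi> q = Some f \<and> f t}"

definition ltl_models :: "'ap asg \<Rightarrow> 'ap ltl \<Rightarrow> bool" where
  "ltl_models \<chi> \<psi> = ltl_sem (asg_word \<chi>) \<psi>"

datatype 'ap qptl =
    QLtl "'ap ltl"
  | QNot "'ap qptl"
  | QAnd "'ap qptl" "'ap qptl"
  | QOr "'ap qptl" "'ap qptl"
  | QEx 'ap "'ap qptl"
  | QAll 'ap "'ap qptl"

fun qfree :: "'ap qptl \<Rightarrow> 'ap set" where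
  "qfree (QLtl \<psi>) = ltl_props \<psi>"
| "qfree (QNot a) = qfree a"
| "qfree (QAnd a b) = qfree a \<union> qfree b"
| "qfree (QOr a b) = qfree a \<union> qfree b"
| "qfree (QEx p a) = qfree a - {p}"
| "qfree (QAll p a) = qfree a - {p}"

fun qsat :: "'ap asg \<Rightarrow> 'ap qptl \<Rightarrow> bool" where
  "qsat \<chi> (QLtl \<psi>) = ltl_models \<chi> \<psi>"
| "qsat \<chi> (QNot a) = (\<not> qsat \<chi> a)"
| "qsat \<chi> (QAnd a b) = (qsat \<chi> a \<and> qsat \<chi> b)"
| "qsat \<chi> (QOr a b) = (qsat \<chi> a \<or> qsat \<chi> b)"
| "qsat \<chi> (QEx p a) = (\<exists>f. qsat (\<chi>(p \<mapsto> f)) a)"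
| "qsat \<chi> (QAll p a) = (\<forall>f. qsat (\<chi>(p \<mapsto> f)) a)"

type_synonym 'ap hyperasg = "'ap asg set set"

definition is_hyperasg :: "'ap hyperasg \<Rightarrow> bool" where
  "is_hyperasg \<X> \<longleftrightarrow> \<X> \<noteq> {} \<and> {} \<notin> \<X> \<and> (\<exists>P. \<X> \<subseteq> Pow (Asg P))"

text \<open>ap(X): the common domain of the assignments of a hyperassignment
  (well-defined for hyperassignments, which are nonempty with nonempty members).\<close>
definition hyp_ap :: "'ap hyperasg \<Rightarrow> 'ap set" where
  "hyp_ap \<X> = dom (SOME \<chi>. \<exists>X\<in>\<X>. \<chi> \<in> X)"

definition is_choice :: "'ap hyperasg \<Rightarrow> ('ap asg set \<Rightarrow> 'ap asg) \<Rightarrow> bool" where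
  "is_choice \<X> c \<longleftrightarrow> (\<forall>X\<in>\<X>. c X \<in> X)"

definition dual :: "'ap hyperasg \<Rightarrow> 'ap hyperasg" where
  "dual \<X> = {c ` \<X> | c. is_choice \<X> c}"

type_synonym 'ap fnctr = "'ap asg \<Rightarrow> tval"

definition ext :: "'ap asg set \<Rightarrow> 'ap fnctr \<Rightarrow> 'ap \<Rightarrow> 'ap asg set" where
  "ext X F p = {\<chi>(p \<mapsto> F \<chi>) | \<chi>. \<chi> \<in> X}"

definition agree_upto :: "'ap set \<Rightarrow> 'ap \<Rightarrow> nat \<Rightarrow> 'ap asg \<Rightarrow> 'ap asg \<Rightarrow> bool" where
  "agree_upto P p k \<chi>1 \<chi>2 \<longleftrightarrow>
     (\<forall>q\<in>P - {p}. \<chi>1 q = \<chi>2 q) \<and> (\<forall>t\<le>k. the (\<chi>1 p) t = the (\<chi>2 p) t)"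

text \<open>A functor over P is only relevant on Asg(P); behavioral w.r.t. p.\<close>
definition behavioral :: "'ap set \<Rightarrow> 'ap fnctr \<Rightarrow> 'ap \<Rightarrow> bool" where
  "behavioral P F p \<longleftrightarrow>
     (\<forall>\<chi>1\<in>Asg P. \<forall>\<chi>2\<in>Asg P. \<forall>k. agree_upto P p k \<chi>1 \<chi>2 \<longrightarrow> F \<chi>1 k = F \<chi>2 k)"

definition FncB :: "'ap set \<Rightarrow> 'ap fnctr set" where
  "FncB P = {F. \<forall>p\<in>P. behavioral P F p}"

definition extB :: "'ap hyperasg \<Rightarrow> 'ap \<Rightarrow> 'ap hyperasg" where
  "extB \<X> p = {ext X F p | X F. X \<in> \<X> \<and> F \<in> FncB (hyp_ap \<X>)}"

datatype quant = QE | QA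
datatype flag = EA | AE

type_synonym 'ap gfg = "(quant \<times> 'ap) list \<times> 'ap ltl"

definition gfg_wf :: "'ap gfg \<Rightarrow> bool" where
  "gfg_wf \<phi> \<longleftrightarrow> distinct (map snd (fst \<phi>))"

definition gfg_free :: "'ap gfg \<Rightarrow> 'ap set" where
  "gfg_free \<phi> = ltl_props (snd \<phi>) - set (map snd (fst \<phi>))"

fun gfg_sem :: "flag \<Rightarrow> 'ap hyperasg \<Rightarrow> (quant \<times> 'ap) list \<Rightarrow> 'ap ltl \<Rightarrow> bool" where
  "gfg_sem EA \<X> [] \<psi> = (\<exists>X\<in>\<X>. \<forall>\<chi>\<in>X. ltl_models \<chi> \<psi>)"
| "gfg_sem AE \<X> [] \<psi> = (\<forall>X\<in>\<X>. \<exists>\<chi>\<in>X. ltl_models \<chi> \<psi>)"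
| "gfg_sem EA \<X> ((QE, p) # qs) \<psi> = gfg_sem EA (extB \<X> p) qs \<psi>"
| "gfg_sem AE \<X> ((QE, p) # qs) \<psi> = gfg_sem EA (extB (dual \<X>) p) qs \<psi>"
| "gfg_sem AE \<X> ((QA, p) # qs) \<psi> = gfg_sem AE (extB \<X> p) qs \<psi>"
| "gfg_sem EA \<X> ((QA, p) # qs) \<psi> = gfg_sem AE (extB (dual \<X>) p) qs \<psi>"

definition gfg_models :: "flag \<Rightarrow> 'ap hyperasg \<Rightarrow> 'ap gfg \<Rightarrow> bool" where
  "gfg_models fl \<X> \<phi> = gfg_sem fl \<X> (fst \<phi>) (snd \<phi>)"

end

theory Submission
  imports Defs "HOL-Library.Infinite_Set" "HOL-Library.Nat_Bijection"
begin

text \<open>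
  Call a language of infinite words recognizable if a finite-index congruence on finite words
  saturates it: exchanging the factors of a factorization for equivalent ones preserves
  membership. Such languages are closed under complement, product and projection, so they contain
  all QPTL-definable ones. Conversely, every infinite word factorizes into segments of types
  \<open>m, e, e, \<dots>\<close>, so guessing such a factorization defines a recognizable language by
  existentially quantified propositions and one LTL formula; on a singleton hyperassignment the
  behavioral existential quantifier is the classical one.

  For the other direction, the behavioral semantics unfolds from the last quantifier to the first
  into an alternating quantification over functors. It holds if the existential player has a
  winning strategy in the game in which each round fixes the next value of each quantified
  proposition in turn, and fails if his opponent has one. These games are determined, because a
  recognizable condition is a Muller condition on prefixes. Finally, the set of words on which the
  existential player wins is recognizable: the type of a segment is the family of sets of types
  that he can force on it.
\<close>

section \<open>Recognizable languages of infinite words\<close>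

text \<open>Merging of positions takes the place of Ramsey's theorem because one analysis then
  yields two things: the factorization used to guess membership, and colours that read prefixes
  only. The latter replace the determinization of automata and are what determinacy rests on. The
  obstacle in the second direction is a mismatch of information. A functor reads only propositions
  quantified before its own, up to the present; a strategy also reads the past of those quantified
  later. A winning strategy is turned into functors by eliminating the last quantifier: once its
  functor is fixed, the past of its proposition can be recomputed from the others. The reverse
  passage is never constructed. Negation exchanges quantifiers and flags, so a winning strategy of
  the opponent refutes the formula, and determinacy leaves no third case. Games are played on
  histories instead of a finite arena, and a whole round is one effectivity function; a strategy
  maps histories to sets of letters that it forces.\<close>

definition sub :: "(nat \<Rightarrow> 'l) \<Rightarrow> nat \<Rightarrow> nat \<Rightarrow> 'l list" where
  "sub w i j = map w [i..<j]"

lemma length_sub [simp]: "length (sub w i j) = j - i"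
  by (simp add: sub_def)

lemma nth_sub [simp]: "n < j - i \<Longrightarrow> sub w i j ! n = w (i + n)"
  by (simp add: sub_def)

lemma sub_append: "i \<le> j \<Longrightarrow> j \<le> k \<Longrightarrow> sub w i j @ sub w j k = sub w i k"
  unfolding sub_def by (metis map_append upt_add_eq_append le_add_diff_inverse)

lemma sub_eq_Nil [simp]: "sub w i j = [] \<longleftrightarrow> j \<le> i"
  by (auto simp: sub_def)

lemma sub_Suc: "i \<le> j \<Longrightarrow> sub w i (Suc j) = sub w i j @ [w j]"
  by (simp add: sub_def)

lemma sub_Cons: "i < j \<Longrightarrow> sub w i j = w i # sub w (Suc i) j"
  by (simp add: sub_def upt_conv_Cons)

lemma sub_self [simp]: "sub w i i = []"
  by simp

lemma sub_cong: "(\<And>t. i \<le> t \<Longrightarrow> t < j \<Longrightarrow> w t = w' t) \<Longrightarrow> sub w i j = sub w' i j"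
  by (simp add: sub_def)

lemma drop_sub: "drop n (sub w i j) = sub w (i + n) j"
  by (simp add: sub_def drop_map)

lemma take_sub: "n \<le> j - i \<Longrightarrow> take n (sub w i j) = sub w i (i + n)"
  by (auto intro!: nth_equalityI simp: min_absorb2)

lemma sub_shift: "sub (\<lambda>t. w (t + n)) i j = sub w (i + n) (j + n)"
  by (auto intro!: nth_equalityI simp: ac_simps)

lemma sub_nth_sub: "k \<le> n \<Longrightarrow> sub ((!) (sub w 0 n)) i k = sub w i k"
  by (auto intro!: nth_equalityI)

text \<open>Strictness makes every segment nonempty, so infinitely many finite pieces exhaust the
  word.\<close>

definition factoring :: "(nat \<Rightarrow> nat) \<Rightarrow> bool" where
  "factoring f \<longleftrightarrow> strict_mono f \<and> f 0 = 0"

abbreviation seg :: "(nat \<Rightarrow> 'l) \<Rightarrow> (nat \<Rightarrow> nat) \<Rightarrow> nat \<Rightarrow> 'l list" where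
  "seg w f i \<equiv> sub w (f i) (f (Suc i))"

text \<open>Only the kernel of \<open>\<tau>\<close> matters, a congruence of finite index. The
  product on types stays implicit and is recovered by choosing representatives with
  \<open>SOME\<close>.\<close>

definition congr_type :: "('l list \<Rightarrow> 'c) \<Rightarrow> bool" where
  "congr_type \<tau> \<longleftrightarrow> finite (range \<tau>) \<and>
     (\<forall>u u' v v'. \<tau> u = \<tau> u' \<longrightarrow> \<tau> v = \<tau> v' \<longrightarrow> \<tau> (u @ v) = \<tau> (u' @ v'))"

text \<open>The two factorizations are independent, so corresponding segments may differ in length.
  One implication suffices because the condition is symmetric in the two words.\<close>

definition saturates :: "('l list \<Rightarrow> 'c) \<Rightarrow> (nat \<Rightarrow> 'l) set \<Rightarrow> bool" where
  "saturates \<tau> L \<longleftrightarrow> (\<forall>w w' f f'. factoring f \<longrightarrow> factoring f' \<longrightarrow>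
     (\<forall>i. \<tau> (seg w f i) = \<tau> (seg w' f' i)) \<longrightarrow> w \<in> L \<longrightarrow> w' \<in> L)"

text \<open>Types are natural numbers because an existential statement cannot range over HOL types;
  \<open>recognizableI\<close> encodes any finite range this way.\<close>

definition recognizable :: "(nat \<Rightarrow> 'l) set \<Rightarrow> bool" where
  "recognizable L \<longleftrightarrow> (\<exists>\<tau> :: 'l list \<Rightarrow> nat. congr_type \<tau> \<and> saturates \<tau> L)"

lemma factoring_less: "factoring f \<Longrightarrow> f i < f (Suc i)"
  by (simp add: factoring_def strict_mono_def)

lemma factoring_le: "factoring f \<Longrightarrow> i \<le> j \<Longrightarrow> f i \<le> f j"
  by (simp add: factoring_def strict_mono_less_eq)

lemma factoring_ge: "factoring f \<Longrightarrow> i \<le> f i"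
  by (simp add: factoring_def strict_mono_imp_increasing)

lemma factoring_locate:
  assumes "factoring f" obtains k where "f k \<le> j" "j < f (Suc k)"
proof -
  have ex: "\<exists>k. j < f (Suc k)"
    using factoring_ge[OF assms, of "Suc j"] by (intro exI[of _ j]) simp
  define k where "k = (LEAST k. j < f (Suc k))"
  have 1: "j < f (Suc k)" unfolding k_def by (rule LeastI_ex[OF ex])
  have 2: "f k \<le> j"
  proof (cases k)
    case 0 then show ?thesis using assms by (simp add: factoring_def)
  next
    case (Suc k')
    then have "k' < (LEAST k. j < f (Suc k))" by (simp add: k_def)
    from not_less_Least[OF this] Suc show ?thesis by simp
  qed
  show ?thesis by (rule that[OF 2 1])
qed

lemma factoring_unique:
  assumes "factoring f" "f k \<le> j" "j < f (Suc k)" "f k' \<le> j" "j < f (Suc k')"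
  shows "k = k'"
proof (rule ccontr)
  assume "k \<noteq> k'"
  then have "Suc k \<le> k' \<or> Suc k' \<le> k" by linarith
  then show False using factoring_le[OF assms(1), of "Suc k" k'] factoring_le[OF assms(1), of "Suc k'" k] assms
    by auto
qed

lemma congr_typeD:
  "congr_type \<tau> \<Longrightarrow> \<tau> u = \<tau> u' \<Longrightarrow> \<tau> v = \<tau> v' \<Longrightarrow> \<tau> (u @ v) = \<tau> (u' @ v')"
  unfolding congr_type_def by blast

lemma saturatesD:
  "saturates \<tau> L \<Longrightarrow> factoring f \<Longrightarrow> factoring f' \<Longrightarrow>
    (\<And>i. \<tau> (seg w f i) = \<tau> (seg w' f' i)) \<Longrightarrow> w \<in> L \<longleftrightarrow> w' \<in> L"
  unfolding saturates_def by metis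

lemma saturates_refine:
  assumes "saturates \<tau> L" "\<And>u v. \<tau>' u = \<tau>' v \<Longrightarrow> \<tau> u = \<tau> v"
  shows "saturates \<tau>' L"
  using assms unfolding saturates_def by meson

lemma recognizableI:
  fixes \<tau> :: "'l list \<Rightarrow> 'c"
  assumes "congr_type \<tau>" "saturates \<tau> L"
  shows "recognizable L"
proof -
  have "finite (range \<tau>)" using assms(1) by (simp add: congr_type_def)
  then obtain g :: "'c \<Rightarrow> nat" where g: "inj_on g (range \<tau>)"
    using finite_imp_inj_to_nat_seg by metis
  then have eq: "g (\<tau> u) = g (\<tau> v) \<longleftrightarrow> \<tau> u = \<tau> v"
    for u v by (simp add: inj_on_eq_iff)
  have "finite (range (\<lambda>u. g (\<tau> u)))"
    using \<open>finite (range \<tau>)\<close> by (metis finite_imageI image_image)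
  then have "congr_type (\<lambda>u. g (\<tau> u))"
    using assms(1) unfolding congr_type_def eq by blast
  moreover have "saturates (\<lambda>u. g (\<tau> u)) L"
    by (rule saturates_refine[OF assms(2)]) (simp add: eq)
  ultimately show ?thesis unfolding recognizable_def by blast
qed

lemma congr_type_Pair:
  assumes "congr_type \<tau>1" "congr_type \<tau>2"
  shows "congr_type (\<lambda>u. (\<tau>1 u, \<tau>2 u))"
proof -
  have "range (\<lambda>u. (\<tau>1 u, \<tau>2 u)) \<subseteq> range \<tau>1 \<times> range \<tau>2" by auto
  moreover have "finite (range \<tau>1 \<times> range \<tau>2)" using assms by (simp add: congr_type_def)
  ultimately have "finite (range (\<lambda>u. (\<tau>1 u, \<tau>2 u)))" by (rule finite_subset)
  then show ?thesis using assms unfolding congr_type_def prod.inject by blast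
qed

lemma recognizable_common:
  assumes "recognizable L1" "recognizable L2"
  obtains \<tau> :: "'l list \<Rightarrow> nat \<times> nat" where "congr_type \<tau>" "saturates \<tau> L1" "saturates \<tau> L2"
proof -
  obtain \<tau>1 \<tau>2 :: "'l list \<Rightarrow> nat" where *: "congr_type \<tau>1" "congr_type \<tau>2"
    "saturates \<tau>1 L1" "saturates \<tau>2 L2"
    using assms unfolding recognizable_def by blast
  show ?thesis
    by (rule that[OF congr_type_Pair[OF *(1,2)]])
       (rule saturates_refine[OF *(3)] saturates_refine[OF *(4)]; simp)+
qed

section \<open>Closure under Boolean operations and projection\<close>

lemma recognizable_Compl: "recognizable L \<Longrightarrow> recognizable (- L)"
  unfolding recognizable_def saturates_def by (metis ComplD ComplI)

lemma recognizable_Int: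
  assumes "recognizable L1" "recognizable L2" shows "recognizable (L1 \<inter> L2)"
proof -
  obtain \<tau> :: "'a list \<Rightarrow> nat \<times> nat" where \<tau>: "congr_type \<tau>" "saturates \<tau> L1" "saturates \<tau> L2"
    using recognizable_common[OF assms] .
  have "saturates \<tau> (L1 \<inter> L2)" using \<tau>(2,3) unfolding saturates_def by blast
  then show ?thesis using recognizableI \<tau>(1) by blast
qed

lemma recognizable_Un:
  assumes "recognizable L1" "recognizable L2" shows "recognizable (L1 \<union> L2)"
  using recognizable_Compl[OF recognizable_Int[OF recognizable_Compl recognizable_Compl]] assms
  by simp

lemma word_of_segments:
  assumes f: "factoring f" and len: "\<And>i. length (v i) = f (Suc i) - f i"
  obtains w where "\<And>i. seg w f i = v i"
proof -
  define idx where "idx j = (THE k. f k \<le> j \<and> j < f (Suc k))" for j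
  have idx: "idx j = k" if "f k \<le> j" "j < f (Suc k)" for j k
    unfolding idx_def using that factoring_unique[OF f] by (intro the_equality) blast+
  define w where "w j = v (idx j) ! (j - f (idx j))" for j
  have "seg w f i = v i" for i
  proof (rule nth_equalityI)
    fix n assume "n < length (seg w f i)"
    then have n: "n < f (Suc i) - f i" by simp
    then have "idx (f i + n) = i" by (intro idx) auto
    then show "seg w f i ! n = v i ! n" using n by (simp add: w_def)
  qed (simp add: len)
  then show ?thesis by (rule that)
qed

text \<open>The type of \<open>u\<close> is the set of types of all words letterwise related to
  \<open>u\<close>. Equal types allow each segment of the witness to be replaced separately, and the
  replacements are glued into one word.\<close>

lemma recognizable_proj:
  assumes "recognizable L"
  shows "recognizable {w. \<exists>w'. (\<forall>t. R (w t) (w' t)) \<and> w' \<in> L}"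
proof -
  obtain \<tau> :: "'a list \<Rightarrow> nat" where \<tau>: "congr_type \<tau>" "saturates \<tau> L"
    using assms unfolding recognizable_def by blast
  define \<tau>' where "\<tau>' u = \<tau> ` {v. list_all2 R u v}" for u
  have sub: "\<tau>' (u @ v) \<subseteq> \<tau>' (u' @ v')" if "\<tau>' u = \<tau>' u'" "\<tau>' v = \<tau>' v'" for u u' v v'
  proof
    fix s assume "s \<in> \<tau>' (u @ v)"
    then obtain x y where xy: "list_all2 R u x" "list_all2 R v y" "s = \<tau> (x @ y)"
      unfolding \<tau>'_def by (auto simp: list_all2_append1)
    have "\<tau> x \<in> \<tau>' u'" "\<tau> y \<in> \<tau>' v'" using xy that unfolding \<tau>'_def by blast+
    then obtain x' y' where "list_all2 R u' x'" "list_all2 R v' y'" "\<tau> x = \<tau> x'" "\<tau> y = \<tau> y'"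
      unfolding \<tau>'_def by auto
    then show "s \<in> \<tau>' (u' @ v')"
      unfolding \<tau>'_def xy(3) using congr_typeD[OF \<tau>(1), of x x' y y']
      by (auto intro!: image_eqI[of _ _ "x' @ y'"] list_all2_appendI)
  qed
  have "range \<tau>' \<subseteq> Pow (range \<tau>)" unfolding \<tau>'_def by auto
  then have "finite (range \<tau>')" using \<tau>(1) unfolding congr_type_def by (meson finite_Pow_iff finite_subset)
  then have "congr_type \<tau>'" unfolding congr_type_def using sub by (metis equalityI)
  moreover have "saturates \<tau>' {w. \<exists>w'. (\<forall>t. R (w t) (w' t)) \<and> w' \<in> L}"
    unfolding saturates_def
  proof (intro allI impI)
    fix w w' f f'
    assume f: "factoring f" "factoring f'" and eq: "\<forall>i. \<tau>' (seg w f i) = \<tau>' (seg w' f' i)"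
      and "w \<in> {w. \<exists>w'. (\<forall>t. R (w t) (w' t)) \<and> w' \<in> L}"
    then obtain y where y: "\<forall>t. R (w t) (y t)" "y \<in> L" by auto
    have "\<tau> (seg y f i) \<in> \<tau>' (seg w f i)" for i
      unfolding \<tau>'_def using y(1) by (auto intro!: imageI simp: list_all2_conv_all_nth)
    then have "\<exists>v. list_all2 R (seg w' f' i) v \<and> \<tau> v = \<tau> (seg y f i)" for i
      unfolding eq[rule_format] unfolding \<tau>'_def by fastforce
    then obtain v where v: "\<And>i. list_all2 R (seg w' f' i) (v i)" "\<And>i. \<tau> (v i) = \<tau> (seg y f i)"
      by metis
    obtain y' where y': "\<And>i. seg y' f' i = v i"
      using word_of_segments[OF f(2), of v] v(1) by (metis length_sub list_all2_lengthD)
    have "R (w' t) (y' t)" for t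
    proof -
      obtain k where k: "f' k \<le> t" "t < f' (Suc k)" using factoring_locate[OF f(2)] .
      then have "t - f' k < length (seg w' f' k)" by simp
      from list_all2_nthD[OF v(1)[of k] this] show ?thesis using k by (simp add: y'[symmetric])
    qed
    moreover have "y' \<in> L"
      using saturatesD[OF \<tau>(2) f, of y y'] y(2) y' v(2) by simp
    ultimately show "w' \<in> {w. \<exists>w'. (\<forall>t. R (w t) (w' t)) \<and> w' \<in> L}" by auto
  qed
  ultimately show ?thesis by (rule recognizableI)
qed

section \<open>Closure under the temporal operators\<close>

lemma saturates_suffix:
  assumes sat: "saturates \<tau> L" and f: "factoring f" "factoring f'"
    and j: "j < f (Suc k)" "j' < f' (Suc k)"
    and eq: "\<tau> (sub w j (f (Suc k))) = \<tau> (sub w' j' (f' (Suc k)))"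
    and eqs: "\<And>i. k < i \<Longrightarrow> \<tau> (seg w f i) = \<tau> (seg w' f' i)"
  shows "(\<lambda>t. w (t + j)) \<in> L \<longleftrightarrow> (\<lambda>t. w' (t + j')) \<in> L"
proof -
  \<comment> \<open>What lies between \<open>J\<close> and \<open>F (Suc k)\<close> becomes the
    first factor of the suffix; the later cut points of \<open>F\<close> move back by
    \<open>J\<close>.\<close>
  define g where "g F J i = (if i = 0 then 0 else F (k + i) - J)" for F :: "nat \<Rightarrow> nat" and J i
  have fac: "factoring (g F J)" if "factoring F" "J < F (Suc k)" for F J
  proof -
    have "g F J i < g F J (Suc i)" for i
    proof (cases i)
      case 0 then show ?thesis using that by (simp add: g_def)
    next
      case (Suc i')
      then show ?thesis using factoring_less[OF that(1), of "k + i"] that(2)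
          factoring_le[OF that(1), of "Suc k" "k + i"]
        by (simp add: g_def)
    qed
    then show ?thesis unfolding factoring_def by (simp add: strict_mono_Suc_iff g_def)
  qed
  have seg0: "seg (\<lambda>t. x (t + J)) (g F J) 0 = sub x J (F (Suc k))"
    if "J < F (Suc k)" for F J and x :: "nat \<Rightarrow> 'a"
    using that by (simp add: g_def sub_shift)
  have segS: "seg (\<lambda>t. x (t + J)) (g F J) (Suc i) = seg x F (k + Suc i)"
    if "factoring F" "J < F (Suc k)" for F J i and x :: "nat \<Rightarrow> 'a"
    using that factoring_le[OF that(1), of "Suc k" "Suc (k + i)"]
      factoring_le[OF that(1), of "Suc k" "Suc (Suc (k + i))"]
    by (simp add: g_def sub_shift)
  show ?thesis
  proof (rule saturatesD[OF sat fac[OF f(1) j(1)] fac[OF f(2) j(2)]])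
    fix i
    show "\<tau> (seg (\<lambda>t. w (t + j)) (g f j) i) = \<tau> (seg (\<lambda>t. w' (t + j')) (g f' j') i)"
    proof (cases i)
      case 0 then show ?thesis using eq j by (simp only: seg0)
    next
      case (Suc i') then show ?thesis using eqs[of "k + Suc i'"] segS f j by simp
    qed
  qed
qed

lemma recognizable_next:
  assumes "recognizable L" shows "recognizable {w. (\<lambda>t. w (Suc t)) \<in> L}"
proof -
  obtain \<tau> :: "'a list \<Rightarrow> nat" where \<tau>: "congr_type \<tau>" "saturates \<tau> L"
    using assms unfolding recognizable_def by blast
  \<comment> \<open>\<open>tl (u @ v)\<close> equals \<open>tl u @ v\<close> only for nonempty
    \<open>u\<close>, so emptiness is part of the type.\<close>
  define \<tau>' where "\<tau>' u = (u = [], \<tau> u, \<tau> (tl u))" for u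
  have "range \<tau>' \<subseteq> UNIV \<times> range \<tau> \<times> range \<tau>" unfolding \<tau>'_def by auto
  then have "finite (range \<tau>')"
    using \<tau>(1) unfolding congr_type_def by (meson finite_SigmaI finite_UNIV finite_subset)
  moreover have "\<tau>' (u @ v) = \<tau>' (u' @ v')" if "\<tau>' u = \<tau>' u'" "\<tau>' v = \<tau>' v'" for u u' v v'
  proof -
    have "\<tau> (u @ v) = \<tau> (u' @ v')" "\<tau> (tl u @ v) = \<tau> (tl u' @ v')"
      using that unfolding \<tau>'_def by (auto intro: congr_typeD[OF \<tau>(1)])
    then show ?thesis using that unfolding \<tau>'_def by (cases "u = []"; cases "u' = []"; simp)
  qed
  ultimately have "congr_type \<tau>'" unfolding congr_type_def by blast
  moreover have "saturates \<tau>' {w. (\<lambda>t. w (Suc t)) \<in> L}" unfolding saturates_def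
  proof (intro allI impI)
    fix w w' f f'
    assume f: "factoring f" "factoring f'" and eq: "\<forall>i. \<tau>' (seg w f i) = \<tau>' (seg w' f' i)"
      and w: "w \<in> {w. (\<lambda>t. w (Suc t)) \<in> L}"
    have eq2: "\<tau> (seg w f i) = \<tau> (seg w' f' i)" for i using eq unfolding \<tau>'_def by simp
    have pos: "1 \<le> F (Suc 0)" "F (Suc 0) \<le> F (Suc 1)" "F 0 = 0" if "factoring F" for F
      using factoring_less[OF that, of 0] factoring_less[OF that, of 1] that by (auto simp: factoring_def)
    \<comment> \<open>The first segment may be a single letter, of which nothing remains after the
      shift; it is therefore joined with the second one before the suffix lemma is applied with
      \<open>k = 1\<close>.\<close>
    have tl: "sub x 1 (F (Suc 1)) = tl (seg x F 0) @ seg x F 1" if "factoring F"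
      for F and x :: "nat \<Rightarrow> 'a"
      using pos[OF that] drop_sub[of 1 x 0 "F (Suc 0)"]
      by (simp add: drop_Suc sub_append)
    have "\<tau> (sub w 1 (f (Suc 1))) = \<tau> (sub w' 1 (f' (Suc 1)))"
      unfolding tl[OF f(1)] tl[OF f(2)]
      using eq eq2 by (intro congr_typeD[OF \<tau>(1)]) (auto simp: \<tau>'_def)
    moreover have "1 < F (Suc 1)" if "factoring F" for F
      using factoring_less[OF that, of 0] factoring_less[OF that, of 1] that by auto
    ultimately have "(\<lambda>t. w (t + 1)) \<in> L \<longleftrightarrow> (\<lambda>t. w' (t + 1)) \<in> L"
      using f eq2 by (intro saturates_suffix[OF \<tau>(2) f]) auto
    then show "w' \<in> {w. (\<lambda>t. w (Suc t)) \<in> L}" using w by simp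
  qed
  ultimately show ?thesis by (rule recognizableI)
qed

lemma lessThan_add_Un: "{..<m + n} = {..<m} \<union> (\<lambda>i. m + i) ` {..<n :: nat}"
proof (rule set_eqI)
  fix x show "x \<in> {..<m + n} \<longleftrightarrow> x \<in> {..<m} \<union> (\<lambda>i. m + i) ` {..<n}"
    unfolding Un_iff lessThan_iff image_iff bex_simps Bex_def by presburger
qed

text \<open>A segment records, for each of its positions, the type of the remainder from there
  together with the set of types of remainders from earlier positions. This suffices to move the
  witness of the until into the other word and to match each position before it with one before the
  original witness.\<close>

lemma recognizable_until:
  assumes "recognizable A" "recognizable B"
  shows "recognizable {w. \<exists>j. (\<lambda>t. w (t + j)) \<in> B \<and> (\<forall>i<j. (\<lambda>t. w (t + i)) \<in> A)}"
    (is "recognizable ?U")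
proof -
  obtain \<tau> :: "'a list \<Rightarrow> nat \<times> nat" where \<tau>: "congr_type \<tau>" "saturates \<tau> A" "saturates \<tau> B"
    using recognizable_common[OF assms] .
  define D where "D u n = (\<lambda>i. \<tau> (drop i u)) ` {..<n}" for u n
  define \<sigma> where "\<sigma> u = (\<lambda>n. (\<tau> (drop n u), D u n)) ` {..<length u}" for u
  define \<tau>' where "\<tau>' u = (\<tau> u, \<sigma> u)" for u
  have D_all: "D u (length u) = fst ` \<sigma> u" for u
    unfolding D_def \<sigma>_def by (auto simp: image_image)
  have \<sigma>_app: "\<sigma> (u @ v) \<subseteq> \<sigma> (u' @ v')"
    if eq: "\<tau>' u = \<tau>' u'" "\<tau>' v = \<tau>' v'" for u u' v v'
  proof -
    have c: "\<tau> (x @ v) = \<tau> (y @ v')" if "\<tau> x = \<tau> y" for x y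
      using congr_typeD[OF \<tau>(1) that] eq(2) unfolding \<tau>'_def by blast
    \<comment> \<open>Right multiplication by the type of \<open>v\<close>, as a map on types;
      \<open>v'\<close> induces the same map.\<close>
    define h where "h s = \<tau> ((SOME x. \<tau> x = s) @ v)" for s
    have h: "\<tau> (x @ v) = h (\<tau> x)" "\<tau> (x @ v') = h (\<tau> x)" for x
      unfolding h_def using c someI[of "\<lambda>y. \<tau> y = \<tau> x" x] congr_typeD[OF \<tau>(1)] by metis+
    have D1: "D (x @ y) n = h ` D x n" if "n \<le> length x" "y = v \<or> y = v'" for x y n
      using that unfolding D_def image_image by (intro image_cong) (auto simp: h)
    have D2: "D (x @ y) (length x + n) = h ` D x (length x) \<union> D y n" if "y = v \<or> y = v'" for x y n
    proof -
      have "{..<length x + n} = {..<length x} \<union> (\<lambda>i. length x + i) ` {..<n}"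
        by (rule lessThan_add_Un)
      then have "D (x @ y) (length x + n) = D (x @ y) (length x) \<union> D y n"
        unfolding D_def by (simp add: image_Un image_image)
      then show ?thesis using D1 that by simp
    qed
    have \<sigma>: "\<sigma> (x @ y) = (\<lambda>(s, d). (h s, h ` d)) ` \<sigma> x \<union> (\<lambda>(s, d). (s, h ` fst ` \<sigma> x \<union> d)) ` \<sigma> y"
      if "y = v \<or> y = v'" for x y
    proof -
      have "{..<length (x @ y)} = {..<length x} \<union> (\<lambda>i. length x + i) ` {..<length y}"
        by (simp add: lessThan_add_Un)
      then have "\<sigma> (x @ y) = (\<lambda>n. (\<tau> (drop n (x @ y)), D (x @ y) n)) ` {..<length x}
         \<union> (\<lambda>n. (\<tau> (drop n y), D (x @ y) (length x + n))) ` {..<length y}"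
        unfolding \<sigma>_def by (simp add: image_Un image_image)
      also have "(\<lambda>n. (\<tau> (drop n (x @ y)), D (x @ y) n)) ` {..<length x}
         = (\<lambda>n. (h (\<tau> (drop n x)), h ` D x n)) ` {..<length x}"
        using that by (intro image_cong) (auto simp: D1 h)
      finally show ?thesis unfolding D2[OF that] D_all \<sigma>_def[of x] \<sigma>_def[of y] by (simp add: image_image)
    qed
    show ?thesis using eq unfolding \<tau>'_def by (simp add: \<sigma>)
  qed
  have "range \<tau>' \<subseteq> range \<tau> \<times> Pow (range \<tau> \<times> Pow (range \<tau>))"
    unfolding \<tau>'_def \<sigma>_def D_def by auto
  then have "finite (range \<tau>')"
    using \<tau>(1) unfolding congr_type_def by (meson finite_Pow_iff finite_SigmaI finite_subset)
  moreover have "\<tau>' (u @ v) = \<tau>' (u' @ v')" if "\<tau>' u = \<tau>' u'" "\<tau>' v = \<tau>' v'" for u u' v v'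
    using that \<sigma>_app[OF that] \<sigma>_app[OF that[symmetric]] congr_typeD[OF \<tau>(1), of u u' v v']
    unfolding \<tau>'_def by auto
  ultimately have "congr_type \<tau>'" unfolding congr_type_def by blast
  moreover have "saturates \<tau>' ?U" unfolding saturates_def
  proof (intro allI impI)
    fix w w' f f'
    assume f: "factoring f" "factoring f'" and eq: "\<forall>i. \<tau>' (seg w f i) = \<tau>' (seg w' f' i)"
      and "w \<in> ?U"
    then obtain j where j: "(\<lambda>t. w (t + j)) \<in> B" "\<And>i. i < j \<Longrightarrow> (\<lambda>t. w (t + i)) \<in> A" by blast
    have eq1: "\<tau> (seg w f i) = \<tau> (seg w' f' i)" and eq2: "\<sigma> (seg w f i) = \<sigma> (seg w' f' i)" for i
      using eq unfolding \<tau>'_def by auto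
    have suf: "(\<lambda>t. w (t + (f k + n))) \<in> L \<longleftrightarrow> (\<lambda>t. w' (t + (f' k + n'))) \<in> L"
      if "saturates \<tau> L" "n < length (seg w f k)" "n' < length (seg w' f' k)"
        "\<tau> (drop n (seg w f k)) = \<tau> (drop n' (seg w' f' k))" for L k n n'
      by (rule saturates_suffix[OF that(1) f]) (use that(2-4) eq1 in \<open>auto simp: drop_sub\<close>)
    obtain k where k: "f k \<le> j" "j < f (Suc k)" using factoring_locate[OF f(1)] .
    define n where "n = j - f k"
    have n: "n < length (seg w f k)" "j = f k + n" using k by (auto simp: n_def)
    then have "(\<tau> (drop n (seg w f k)), D (seg w f k) n) \<in> \<sigma> (seg w' f' k)"
      unfolding eq2[symmetric] unfolding \<sigma>_def by auto
    then obtain n' where n': "n' < length (seg w' f' k)"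
      "\<tau> (drop n (seg w f k)) = \<tau> (drop n' (seg w' f' k))"
      "D (seg w f k) n = D (seg w' f' k) n'"
      unfolding \<sigma>_def by auto
    have "(\<lambda>t. w' (t + (f' k + n'))) \<in> B" using suf[OF \<tau>(3) n(1) n'(1,2)] j(1) n(2) by simp
    moreover have "(\<lambda>t. w' (t + i')) \<in> A" if i': "i' < f' k + n'" for i'
    proof -
      obtain l where l: "f' l \<le> i'" "i' < f' (Suc l)" using factoring_locate[OF f(2)] .
      define a' where "a' = i' - f' l"
      have a': "a' < length (seg w' f' l)" "i' = f' l + a'" using l by (auto simp: a'_def)
      have "l \<le> k"
      proof (rule ccontr)
        assume "\<not> l \<le> k"
        then have "f' (Suc k) \<le> f' l" by (intro factoring_le[OF f(2)]) simp
        then show False using l n'(1) i' by simp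
      qed
      have "\<exists>a < length (seg w f l). f l + a < j \<and> \<tau> (drop a' (seg w' f' l)) = \<tau> (drop a (seg w f l))"
      proof (cases "l = k")
        case True
        then have "\<tau> (drop a' (seg w' f' l)) \<in> D (seg w f l) n"
          using n'(3) a' i' unfolding D_def by auto
        then obtain a where "a < n" "\<tau> (drop a' (seg w' f' l)) = \<tau> (drop a (seg w f l))"
          unfolding D_def by auto
        then show ?thesis using True n by (intro exI[of _ a]) auto
      next
        case False
        have "\<tau> (drop a' (seg w' f' l)) \<in> fst ` \<sigma> (seg w f l)"
          unfolding eq2 D_all[symmetric] using a' unfolding D_def by auto
        then have "\<tau> (drop a' (seg w' f' l)) \<in> D (seg w f l) (length (seg w f l))"
          unfolding D_all .
        then obtain a where a: "a < length (seg w f l)" "\<tau> (drop a' (seg w' f' l)) = \<tau> (drop a (seg w f l))"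
          unfolding D_def by auto
        have "f (Suc l) \<le> f k" using False \<open>l \<le> k\<close> by (intro factoring_le[OF f(1)]) simp
        then show ?thesis using a k by (intro exI[of _ a]) auto
      qed
      then obtain a where "a < length (seg w f l)" "f l + a < j"
        "\<tau> (drop a' (seg w' f' l)) = \<tau> (drop a (seg w f l))" by blast
      then show ?thesis using suf[OF \<tau>(2) _ a'(1), of a] j(2) a'(2) by simp
    qed
    ultimately show "w' \<in> ?U" by blast
  qed
  ultimately show ?thesis by (rule recognizableI)
qed

lemma recognizable_ltl: "recognizable {w. ltl_sem w \<psi>}"
proof (induction \<psi>)
  case LTrue
  have "congr_type (\<lambda>_ :: 'a set list. ())" by (simp add: congr_type_def)
  moreover have "saturates (\<lambda>_ :: 'a set list. ()) {w. ltl_sem w LTrue}" by (simp add: saturates_def)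
  ultimately show ?case by (rule recognizableI)
next
  case (LProp p)
  define \<tau> where "\<tau> u = (if u = [] then None else Some (p \<in> hd u))" for u :: "'a set list"
  have "congr_type \<tau>" unfolding congr_type_def \<tau>_def
    by (auto split: if_splits simp: hd_append)
  moreover have "saturates \<tau> {w. ltl_sem w (LProp p)}" unfolding saturates_def
  proof (intro allI impI)
    fix w w' :: "nat \<Rightarrow> 'a set" and f f'
    assume f: "factoring f" "factoring f'" and eq: "\<forall>i. \<tau> (seg w f i) = \<tau> (seg w' f' i)"
      and w: "w \<in> {w. ltl_sem w (LProp p)}"
    have s: "seg x F 0 = x 0 # sub x (Suc 0) (F (Suc 0))" if "factoring F" for F and x :: "nat \<Rightarrow> 'a set"
      using factoring_less[OF that, of 0] that by (simp add: factoring_def sub_Cons)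
    show "w' \<in> {w. ltl_sem w (LProp p)}"
      using w eq[rule_format, of 0] unfolding s[OF f(1)] s[OF f(2)] by (simp add: \<tau>_def)
  qed
  ultimately show ?case by (rule recognizableI)
next
  case (LNot \<psi>)
  then show ?case using recognizable_Compl by (simp add: Collect_neg_eq)
next
  case (LAnd a b)
  then show ?case using recognizable_Int by (simp add: Collect_conj_eq)
next
  case (LOr a b)
  then show ?case using recognizable_Un by (simp add: Collect_disj_eq)
next
  case (LNext a)
  then show ?case using recognizable_next[of "{w. ltl_sem w a}"] by simp
next
  case (LUntil a b)
  then show ?case using recognizable_until[of "{w. ltl_sem w a}" "{w. ltl_sem w b}"] by simp
qed

section \<open>Merging positions and Muller conditions\<close>

text \<open>The relation behind additive Ramsey arguments: a common continuation preserves equality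
  of types, so merged positions stay merged, and since types are finite in number there are only
  finitely many positions up to merging.\<close>

definition mergeable :: "('l list \<Rightarrow> 'c) \<Rightarrow> (nat \<Rightarrow> 'l) \<Rightarrow> nat \<Rightarrow> nat \<Rightarrow> nat \<Rightarrow> bool" where
  "mergeable \<tau> w k i j \<longleftrightarrow> i < k \<and> j < k \<and> \<tau> (sub w i k) = \<tau> (sub w j k)"

lemma mergeable_mono:
  assumes "congr_type \<tau>" "mergeable \<tau> w k i j" "k \<le> l"
  shows "mergeable \<tau> w l i j"
proof -
  have "\<tau> (sub w i k @ sub w k l) = \<tau> (sub w j k @ sub w k l)"
    using assms by (intro congr_typeD[OF assms(1)]) (auto simp: mergeable_def)
  then show ?thesis using assms by (simp add: mergeable_def sub_append)
qed

lemma mergeable_sym: "mergeable \<tau> w k i j \<longleftrightarrow> mergeable \<tau> w k j i"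
  by (auto simp: mergeable_def)

text \<open>A largest set of positions that never merge represents every position up to merging. Its
  least code not yet refuted by a prefix eventually stabilises, which makes it available to colours.\<close>

definition separated :: "('l list \<Rightarrow> 'c) \<Rightarrow> (nat \<Rightarrow> 'l) \<Rightarrow> nat \<Rightarrow> nat set \<Rightarrow> bool" where
  "separated \<tau> w k x \<longleftrightarrow> (\<forall>i\<in>x. \<forall>j\<in>x. i \<noteq> j \<longrightarrow> \<not> mergeable \<tau> w k i j)"

text \<open>At a time beyond all of \<open>x\<close>, positions that have not merged start factors
  of different types.\<close>

lemma separated_card:
  assumes \<tau>: "congr_type \<tau>" and "finite x" "\<And>k. separated \<tau> w k x"
  shows "card x \<le> card (range \<tau>)"
proof -
  obtain k where k: "\<forall>i\<in>x. i < k" using \<open>finite x\<close> finite_nat_set_iff_bounded by blast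
  have "inj_on (\<lambda>i. \<tau> (sub w i k)) x"
    using assms(3)[of k] k unfolding inj_on_def separated_def mergeable_def by blast
  then show ?thesis
    by (intro card_inj_on_le) (use \<tau> in \<open>auto simp: congr_type_def\<close>)
qed

definition separated_of_size :: "('l list \<Rightarrow> 'c) \<Rightarrow> (nat \<Rightarrow> 'l) \<Rightarrow> nat \<Rightarrow> bool" where
  "separated_of_size \<tau> w n \<longleftrightarrow> (\<exists>x. finite x \<and> card x = n \<and> (\<forall>k. separated \<tau> w k x))"

text \<open>A hit can serve as a cut point: the prefix up to it has the first type, the factor from
  \<open>i\<close> to it the second, and merging with \<open>i\<close> transfers the second type to
  factors that start at the hit itself.\<close>

definition pair_hits :: "('l list \<Rightarrow> 'c) \<Rightarrow> (nat \<Rightarrow> 'l) \<Rightarrow> nat \<Rightarrow> 'c \<times> 'c \<Rightarrow> nat \<Rightarrow> nat set" where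
  "pair_hits \<tau> w i me k =
     {j. i < j \<and> mergeable \<tau> w k i j \<and> \<tau> (sub w 0 j) = fst me \<and> \<tau> (sub w i j) = snd me}"

text \<open>Otherwise some \<open>b\<close> lies beyond \<open>x\<close> and beyond all hits. It
  merges with no member of \<open>x\<close>, so \<open>insert b x\<close> contradicts
  maximality.\<close>

lemma exists_infinite_hits:
  assumes \<tau>: "congr_type \<tau>" and x: "finite x" "\<And>k. separated \<tau> w k x"
    and max: "\<not> separated_of_size \<tau> w (Suc (card x))"
  shows "\<exists>i\<in>x. \<exists>me\<in>range \<tau> \<times> range \<tau>. infinite (\<Union>k. pair_hits \<tau> w i me k)"
proof (rule ccontr)
  assume neg: "\<not> ?thesis"
  have fin: "finite (\<Union>i\<in>x. \<Union>me\<in>range \<tau> \<times> range \<tau>. \<Union>k. pair_hits \<tau> w i me k)"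
  proof (rule finite_UN_I[OF x(1)], rule finite_UN_I)
    show "finite (range \<tau> \<times> range \<tau>)" using \<tau> by (simp add: congr_type_def)
  qed (use neg in blast)
  obtain b where b: "\<forall>i \<in> x \<union> (\<Union>i\<in>x. \<Union>me\<in>range \<tau> \<times> range \<tau>. \<Union>k. pair_hits \<tau> w i me k). i < b"
    using finite_UnI[OF x(1) fin] finite_nat_set_iff_bounded by blast
  have "b \<notin> x" using b by blast
  have "\<not> mergeable \<tau> w k i b" if "i \<in> x" for i k
  proof
    assume "mergeable \<tau> w k i b"
    then have "b \<in> pair_hits \<tau> w i (\<tau> (sub w 0 b), \<tau> (sub w i b)) k"
      using b that by (simp add: pair_hits_def)
    moreover have "(\<tau> (sub w 0 b), \<tau> (sub w i b)) \<in> range \<tau> \<times> range \<tau>" by simp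
    ultimately have "b < b" using b that by blast
    then show False by simp
  qed
  then have "separated \<tau> w k (insert b x)" for k
    using x(2)[of k] mergeable_sym[of \<tau> w k] unfolding separated_def by blast
  then have "separated_of_size \<tau> w (Suc (card x))"
    unfolding separated_of_size_def using x(1) \<open>b \<notin> x\<close>
    by (intro exI[of _ "insert b x"]) auto
  then show False using max by simp
qed

definition ultimate_types :: "('l list \<Rightarrow> 'c) \<Rightarrow> (nat \<Rightarrow> 'l) \<Rightarrow> (nat \<Rightarrow> nat) \<Rightarrow> 'c \<times> 'c \<Rightarrow> bool" where
  "ultimate_types \<tau> w f me \<longleftrightarrow> factoring f \<and>
     \<tau> (seg w f 0) = fst me \<and> (\<forall>i. \<tau> (seg w f (Suc i)) = snd me)"

text \<open>Let \<open>j\<close> have merged with \<open>i\<close> by time \<open>k\<close>. For a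
  later hit \<open>j'\<close> beyond \<open>k\<close>, the factors from \<open>j\<close> and from
  \<open>i\<close> to \<open>j'\<close> have the same type, namely \<open>snd me\<close>. Iterating
  the choice of \<open>j'\<close> gives the cut points.\<close>

lemma infinite_hits_factoring:
  assumes \<tau>: "congr_type \<tau>" and inf: "infinite (\<Union>k. pair_hits \<tau> w i me k)"
  shows "\<exists>f. ultimate_types \<tau> w f me"
proof -
  let ?H = "\<Union>k. pair_hits \<tau> w i me k"
  have step: "\<exists>j'\<in>?H. j < j' \<and> \<tau> (sub w j j') = snd me" if "j \<in> ?H" for j
  proof -
    from that obtain k where k: "i < j" "mergeable \<tau> w k i j" by (auto simp: pair_hits_def)
    obtain j' where j': "j' \<in> ?H" "j' > max j k" using inf unfolding infinite_nat_iff_unbounded by blast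
    then have "mergeable \<tau> w j' i j" by (intro mergeable_mono[OF \<tau> k(2)]) auto
    then have "\<tau> (sub w j j') = snd me" using j'(1) unfolding mergeable_def pair_hits_def by auto
    then show ?thesis using j' by auto
  qed
  then obtain nxt where nxt: "\<And>j. j \<in> ?H \<Longrightarrow> nxt j \<in> ?H \<and> j < nxt j \<and> \<tau> (sub w j (nxt j)) = snd me"
    by metis
  obtain j0 where j0: "j0 \<in> ?H" using inf by (metis ex_in_conv finite.emptyI)
  define f where "f n = (case n of 0 \<Rightarrow> 0 | Suc n' \<Rightarrow> (nxt ^^ n') j0)" for n
  have fS: "f (Suc n) \<in> ?H" for n by (induction n) (use j0 nxt in \<open>auto simp: f_def\<close>)
  have fSS: "f (Suc (Suc n)) = nxt (f (Suc n))" for n by (simp add: f_def)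
  have "f n < f (Suc n)" for n
    using fS[of n] nxt[OF fS] by (cases n) (auto simp: fSS, auto simp: f_def pair_hits_def)
  then have "factoring f" by (auto simp: factoring_def strict_mono_Suc_iff f_def)
  moreover have "\<tau> (seg w f 0) = fst me" using fS[of 0] by (auto simp: pair_hits_def f_def)
  moreover have "\<tau> (seg w f (Suc n)) = snd me" for n using nxt[OF fS] by (simp add: fSS)
  ultimately show ?thesis unfolding ultimate_types_def by blast
qed

lemma maximal_separated:
  assumes \<tau>: "congr_type \<tau>"
  obtains n where "n \<le> card (range \<tau>)" "separated_of_size \<tau> w n" "\<not> separated_of_size \<tau> w (Suc n)"
proof -
  have 0: "separated_of_size \<tau> w 0" unfolding separated_of_size_def separated_def by (intro exI[of _ "{}"]) auto
  have b: "separated_of_size \<tau> w n \<Longrightarrow> n \<le> card (range \<tau>)" for n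
    unfolding separated_of_size_def using separated_card[OF \<tau>] by blast
  have "separated_of_size \<tau> w (GREATEST n. separated_of_size \<tau> w n)"
    using GreatestI_nat[of "separated_of_size \<tau> w" 0] 0 b by blast
  moreover have "\<not> separated_of_size \<tau> w (Suc (GREATEST n. separated_of_size \<tau> w n))"
    using Greatest_le_nat[of "separated_of_size \<tau> w" _ "card (range \<tau>)"] b by fastforce
  ultimately show ?thesis using that b by blast
qed

lemma ultimate_factoring:
  assumes \<tau>: "congr_type \<tau>"
  shows "\<exists>me f. ultimate_types \<tau> w f me"
proof -
  obtain n where n: "separated_of_size \<tau> w n" "\<not> separated_of_size \<tau> w (Suc n)" using maximal_separated[OF \<tau>] .
  then obtain x where "finite x" "card x = n" "\<And>k. separated \<tau> w k x" unfolding separated_of_size_def by blast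
  then show ?thesis using exists_infinite_hits[OF \<tau>] n(2) infinite_hits_factoring[OF \<tau>] by blast
qed

definition good_types :: "('l list \<Rightarrow> 'c) \<Rightarrow> (nat \<Rightarrow> 'l) set \<Rightarrow> ('c \<times> 'c) set" where
  "good_types \<tau> L = {me. \<exists>w\<in>L. \<exists>f. ultimate_types \<tau> w f me}"

text \<open>Words with the same pair have factorizations whose types agree throughout, so saturation
  puts both into \<open>L\<close> or neither.\<close>

lemma good_types_iff:
  assumes "saturates \<tau> L" "ultimate_types \<tau> w f me"
  shows "w \<in> L \<longleftrightarrow> me \<in> good_types \<tau> L"
proof
  assume "me \<in> good_types \<tau> L"
  then obtain w' f' where w': "w' \<in> L" "ultimate_types \<tau> w' f' me" unfolding good_types_def by blast
  have "\<tau> (seg w f i) = \<tau> (seg w' f' i)" for i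
    using assms(2) w'(2) unfolding ultimate_types_def by (cases i) auto
  then have "w \<in> L \<longleftrightarrow> w' \<in> L"
    by (intro saturatesD[OF assms(1), of f f']) (use assms(2) w'(2) in \<open>auto simp: ultimate_types_def\<close>)
  with w' show "w \<in> L" by simp
qed (use assms in \<open>auto simp: good_types_def\<close>)

section \<open>Recognizable languages as Muller conditions on prefixes\<close>

definition inf_colors :: "'k set \<Rightarrow> ('k \<Rightarrow> 'l list \<Rightarrow> bool) \<Rightarrow> (nat \<Rightarrow> 'l) \<Rightarrow> 'k set" where
  "inf_colors C col w = {c \<in> C. \<exists>\<^sub>\<infinity>k. col c (sub w 0 k)}"

text \<open>Learning in the limit: the least candidate not yet refuted never decreases. A candidate
  that is never refuted bounds it, so it stabilises; conversely its limit is never refuted.\<close>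

lemma Least_guess:
  fixes ok :: "nat \<Rightarrow> nat \<Rightarrow> bool"
  assumes anti: "\<And>x k l. ok x l \<Longrightarrow> k \<le> l \<Longrightarrow> ok x k" and ex: "\<And>k. \<exists>x. ok x k"
  defines "g \<equiv> \<lambda>k. LEAST x. ok x k"
  shows "(\<exists>x. \<forall>k. ok x k) \<longleftrightarrow> \<not> (\<exists>\<^sub>\<infinity>k. g k \<noteq> g (Suc k))" (is ?A)
    and "(\<exists>x. \<forall>k. ok x k) \<Longrightarrow> \<exists>x. (\<forall>k. ok x k) \<and> (\<forall>\<^sub>\<infinity>k. g k = x)" (is "_ \<Longrightarrow> ?B")
proof -
  have okg: "ok (g k) k" for k unfolding g_def by (rule LeastI_ex[OF ex])
  have mono: "g k \<le> g l" if "k \<le> l" for k l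
    unfolding g_def by (rule Least_le) (use okg[of l] anti that in \<open>simp add: g_def\<close>)
  have B: "\<exists>x. (\<forall>k. ok x k) \<and> (\<forall>\<^sub>\<infinity>k. g k = x)" if "\<exists>x. \<forall>k. ok x k"
  proof -
    obtain x where "\<forall>k. ok x k" using \<open>\<exists>x. \<forall>k. ok x k\<close> by blast
    then have le: "g k \<le> x" for k unfolding g_def by (simp add: Least_le)
    define y where "y = (GREATEST y. \<exists>k. g k = y)"
    obtain k0 where k0: "g k0 = y"
      using GreatestI_nat[of "\<lambda>y. \<exists>k. g k = y" "g 0" x] le unfolding y_def by blast
    have ley: "g k \<le> y" for k
      unfolding y_def using le by (intro Greatest_le_nat[of _ _ x]) auto
    have eq: "g k = y" if "k \<ge> k0" for k using ley[of k] mono[OF that] k0 by simp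
    have "ok y k" for k using okg[of "max k k0"] eq[of "max k k0"] anti by fastforce
    moreover have "\<forall>\<^sub>\<infinity>k. g k = y" using eq unfolding MOST_nat_le by blast
    ultimately show ?thesis by blast
  qed
  then show "(\<exists>x. \<forall>k. ok x k) \<Longrightarrow> ?B" .
  show ?A
  proof
    assume "\<exists>x. \<forall>k. ok x k"
    then obtain x where "\<forall>\<^sub>\<infinity>k. g k = x" using B by blast
    then obtain m where "\<forall>k\<ge>m. g k = x" unfolding MOST_nat_le by blast
    then have "\<forall>\<^sub>\<infinity>k. g k = g (Suc k)" unfolding MOST_nat_le by (intro exI[of _ m]) simp
    then show "\<not> (\<exists>\<^sub>\<infinity>k. g k \<noteq> g (Suc k))" by (simp add: not_INFM)
  next
    assume "\<not> (\<exists>\<^sub>\<infinity>k. g k \<noteq> g (Suc k))"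
    then obtain m where m: "\<forall>k\<ge>m. g k = g (Suc k)" unfolding not_INFM MOST_nat_le by auto
    have eq: "g (m + d) = g m" for d
    proof (induction d)
      case (Suc d) then show ?case using m[rule_format, of "m + d"] by simp
    qed simp
    have "ok (g m) k" for k
      using okg[of "m + k"] anti[of "g m" "m + k" k] eq[of k] by simp
    then show "\<exists>x. \<forall>k. ok x k" by blast
  qed
qed

text \<open>Turns the size of a limit set, which no prefix decides, into the recurrence of an event
  that prefixes do decide.\<close>

lemma infinite_Union_chain:
  fixes A :: "nat \<Rightarrow> nat set"
  assumes mono: "\<And>k l. k \<le> l \<Longrightarrow> A k \<subseteq> A l" and fin: "\<And>k. finite (A k)"
  shows "infinite (\<Union>k. A k) \<longleftrightarrow> (\<exists>\<^sub>\<infinity>k. A k \<noteq> A (Suc k))"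
proof
  assume inf: "infinite (\<Union>k. A k)"
  show "\<exists>\<^sub>\<infinity>k. A k \<noteq> A (Suc k)"
  proof (rule ccontr)
    assume "\<not> (\<exists>\<^sub>\<infinity>k. A k \<noteq> A (Suc k))"
    then obtain m where m: "\<forall>k\<ge>m. A k = A (Suc k)" unfolding not_INFM MOST_nat_le by auto
    have eq: "A (m + d) = A m" for d
    proof (induction d)
      case (Suc d) then show ?case using m[rule_format, of "m + d"] by simp
    qed simp
    have "A k \<subseteq> A m" for k using mono[of k "m + k"] eq[of k] by simp
    then have "(\<Union>k. A k) \<subseteq> A m" by blast
    then show False using inf fin finite_subset by blast
  qed
next
  assume inf: "\<exists>\<^sub>\<infinity>k. A k \<noteq> A (Suc k)"
  show "infinite (\<Union>k. A k)"
  proof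
    assume fU: "finite (\<Union>k. A k)"
    then have "\<exists>n. \<forall>a \<in> (\<Union>k. A k). a \<in> A n"
    proof (rule finite_subset_Union_chain[where \<B> = "range A", of "\<Union>k. A k"])
      show "subset.chain UNIV (range A)"
        unfolding subset_chain_def by (metis UNIV_I imageE mono nle_le subsetI)
    qed auto
    then obtain n where n: "(\<Union>k. A k) \<subseteq> A n" by blast
    have "A k = A (Suc k)" if "k \<ge> n" for k
    proof
      show "A k \<subseteq> A (Suc k)" by (rule mono) simp
      show "A (Suc k) \<subseteq> A k" using n mono[OF that] by blast
    qed
    then have "\<not> (\<exists>\<^sub>\<infinity>k. A k \<noteq> A (Suc k))" unfolding not_INFM MOST_nat_le by auto
    then show False using inf by blast
  qed
qed

context
  fixes \<tau> :: "'l list \<Rightarrow> 'c"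
  assumes \<tau>: "congr_type \<tau>"
begin

definition candidate :: "(nat \<Rightarrow> 'l) \<Rightarrow> nat \<Rightarrow> nat \<Rightarrow> nat \<Rightarrow> bool" where
  "candidate w n x k \<longleftrightarrow> card (set_decode x) = n \<and> separated \<tau> w k (set_decode x)"

definition guess :: "(nat \<Rightarrow> 'l) \<Rightarrow> nat \<Rightarrow> nat \<Rightarrow> nat" where
  "guess w n k = (LEAST x. candidate w n x k)"

text \<open>The event that a member of the current guess gains a hit. It is observable on the prefix
  of length \<open>Suc k\<close>.\<close>

definition flash :: "(nat \<Rightarrow> 'l) \<Rightarrow> nat \<Rightarrow> 'c \<times> 'c \<Rightarrow> nat \<Rightarrow> bool" where
  "flash w n me k \<longleftrightarrow> (\<exists>i\<in>set_decode (guess w n k). pair_hits \<tau> w i me k \<noteq> pair_hits \<tau> w i me (Suc k))"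

lemma candidate_limit:
  shows "separated_of_size \<tau> w n \<longleftrightarrow> \<not> (\<exists>\<^sub>\<infinity>k. guess w n k \<noteq> guess w n (Suc k))"
    and "separated_of_size \<tau> w n \<Longrightarrow> \<exists>x. (\<forall>k. candidate w n x k) \<and> (\<forall>\<^sub>\<infinity>k. guess w n k = x)"
proof -
  have anti: "candidate w n x k" if "candidate w n x l" "k \<le> l" for x k l
    using that mergeable_mono[OF \<tau>] unfolding candidate_def separated_def by blast
  have ex: "\<exists>x. candidate w n x k" for k
  proof (intro exI)
    \<comment> \<open>Positions from \<open>k\<close> on cannot have merged by time
      \<open>k\<close>, so at every time an unrefuted candidate of each size exists.\<close>
    show "candidate w n (set_encode {k..<k + n}) k"
      by (auto simp: candidate_def separated_def mergeable_def)
  qed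
  have "separated_of_size \<tau> w n \<longleftrightarrow> (\<exists>x. \<forall>k. candidate w n x k)"
    unfolding separated_of_size_def candidate_def by (metis finite_set_decode set_encode_inverse)
  then show "separated_of_size \<tau> w n \<longleftrightarrow> \<not> (\<exists>\<^sub>\<infinity>k. guess w n k \<noteq> guess w n (Suc k))"
    and "separated_of_size \<tau> w n \<Longrightarrow> \<exists>x. (\<forall>k. candidate w n x k) \<and> (\<forall>\<^sub>\<infinity>k. guess w n k = x)"
    using Least_guess[of "candidate w n", OF anti ex] unfolding guess_def by auto
qed

lemma flash_infinite:
  assumes "\<forall>\<^sub>\<infinity>k. guess w n k = x"
  shows "(\<exists>\<^sub>\<infinity>k. flash w n me k) \<longleftrightarrow> (\<exists>i\<in>set_decode x. infinite (\<Union>k. pair_hits \<tau> w i me k))"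
proof -
  have "(\<exists>\<^sub>\<infinity>k. flash w n me k) \<longleftrightarrow>
      (\<exists>\<^sub>\<infinity>k. \<exists>i\<in>set_decode x. pair_hits \<tau> w i me k \<noteq> pair_hits \<tau> w i me (Suc k))"
    by (rule frequently_cong[OF assms]) (simp add: flash_def)
  also have "\<dots> \<longleftrightarrow> (\<exists>i\<in>set_decode x. \<exists>\<^sub>\<infinity>k. pair_hits \<tau> w i me k \<noteq> pair_hits \<tau> w i me (Suc k))"
    by (simp add: INFM_finite_Bex_distrib)
  also have "\<dots> \<longleftrightarrow> (\<exists>i\<in>set_decode x. infinite (\<Union>k. pair_hits \<tau> w i me k))"
  proof (intro bex_cong refl infinite_Union_chain[symmetric])
    fix i k l :: nat assume "k \<le> l"
    then show "pair_hits \<tau> w i me k \<subseteq> pair_hits \<tau> w i me l"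
      using mergeable_mono[OF \<tau>] unfolding pair_hits_def by blast
  next
    fix i k
    have "pair_hits \<tau> w i me k \<subseteq> {..<k}" by (auto simp: pair_hits_def mergeable_def)
    then show "finite (pair_hits \<tau> w i me k)" by (rule finite_subset) simp
  qed
  finally show ?thesis .
qed

text \<open>Colours must be functions of histories, whereas these notions take an infinite word.
  \<open>(!) h\<close> turns a history into a word with arbitrary values past its end, and those are
  never read because \<open>Suc k \<le> l\<close>.\<close>

lemma local_on_prefix:
  assumes "k < l"
  shows "guess ((!) (sub w 0 l)) n k = guess w n k"
    and "guess ((!) (sub w 0 l)) n (Suc k) = guess w n (Suc k)"
    and "flash ((!) (sub w 0 l)) n me k = flash w n me k"
proof -
  have m: "mergeable \<tau> ((!) (sub w 0 l)) k' = mergeable \<tau> w k'" if "k' \<le> l" for k'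
    unfolding mergeable_def using that by (simp add: sub_nth_sub)
  have g: "guess ((!) (sub w 0 l)) n k' = guess w n k'" if "k' \<le> l" for k'
    unfolding guess_def candidate_def separated_def using m that by simp
  have p: "pair_hits \<tau> ((!) (sub w 0 l)) i me k' = pair_hits \<tau> w i me k'" if "k' \<le> l" for i k'
    unfolding pair_hits_def using that
    by (intro Collect_cong) (auto simp: m sub_nth_sub mergeable_def)
  show "guess ((!) (sub w 0 l)) n k = guess w n k"
    "guess ((!) (sub w 0 l)) n (Suc k) = guess w n (Suc k)"
    "flash ((!) (sub w 0 l)) n me k = flash w n me k"
    using assms g p by (auto simp: flash_def)
qed

text \<open>A history of length \<open>Suc k\<close> shows the events of time \<open>k\<close>. The
  colour \<open>(n, None)\<close> recurs iff the guess of size \<open>n\<close> never stabilises; if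
  it does stabilise, \<open>(n, Some me)\<close> recurs iff some member of its limit has infinitely
  many hits for \<open>me\<close>.\<close>

definition color :: "nat \<times> ('c \<times> 'c) option \<Rightarrow> 'l list \<Rightarrow> bool" where
  "color c h \<longleftrightarrow> h \<noteq> [] \<and> (case c of
     (n, None) \<Rightarrow> guess ((!) h) n (length h - 1) \<noteq> guess ((!) h) n (length h)
   | (n, Some me) \<Rightarrow> flash ((!) h) n me (length h - 1))"

lemma color_infinite:
  "(\<exists>\<^sub>\<infinity>k. color (n, None) (sub w 0 k)) \<longleftrightarrow> \<not> separated_of_size \<tau> w n"
  "(\<exists>\<^sub>\<infinity>k. color (n, Some me) (sub w 0 k)) \<longleftrightarrow> (\<exists>\<^sub>\<infinity>k. flash w n me k)"
proof -
  have shift: "(\<exists>\<^sub>\<infinity>k. color c (sub w 0 k)) \<longleftrightarrow> (\<exists>\<^sub>\<infinity>k. color c (sub w 0 (Suc k)))" for c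
    using MOST_Suc_iff[of "\<lambda>k. \<not> color c (sub w 0 k)"] unfolding frequently_def by blast
  show "(\<exists>\<^sub>\<infinity>k. color (n, None) (sub w 0 k)) \<longleftrightarrow> \<not> separated_of_size \<tau> w n"
    unfolding shift candidate_limit(1) by (simp add: color_def local_on_prefix)
  show "(\<exists>\<^sub>\<infinity>k. color (n, Some me) (sub w 0 k)) \<longleftrightarrow> (\<exists>\<^sub>\<infinity>k. flash w n me k)"
    unfolding shift by (simp add: color_def local_on_prefix)
qed

lemma saturated_Muller:
  assumes L: "saturates \<tau> L"
  shows "\<exists>C col (F :: (nat \<times> ('c \<times> 'c) option) set set). finite C \<and> (\<forall>w. w \<in> L \<longleftrightarrow> inf_colors C col w \<in> F)"
proof -
  \<comment> \<open>A separated set has at most \<open>card (range \<tau>)\<close> elements, so both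
    a maximal size \<open>n\<close> and \<open>Suc n\<close> are at most \<open>N\<close>.\<close>
  define N where "N = Suc (card (range \<tau>))"
  define C :: "(nat \<times> ('c \<times> 'c) option) set"
    where "C = {..N} \<times> insert None (Some ` (range \<tau> \<times> range \<tau>))"
  \<comment> \<open>The \<open>None\<close> colours locate a size \<open>n\<close> that is attained
    while \<open>Suc n\<close> is not; the flashes at this size reveal the pairs of types of
    ultimate factorizations.\<close>
  define F where "F = {I. \<exists>n<N. (n, None) \<notin> I \<and> (Suc n, None) \<in> I \<and>
      (\<exists>me \<in> good_types \<tau> L. (n, Some me) \<in> I)}"
  have "finite (range \<tau>)" using \<tau> by (simp add: congr_type_def)
  then have "finite C" by (simp add: C_def)
  moreover have "w \<in> L \<longleftrightarrow> inf_colors C color w \<in> F" for w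
  proof
    assume "w \<in> L"
    obtain n where n: "n \<le> card (range \<tau>)" "separated_of_size \<tau> w n" "\<not> separated_of_size \<tau> w (Suc n)"
      using maximal_separated[OF \<tau>] .
    obtain x where x: "\<And>k. candidate w n x k" "\<forall>\<^sub>\<infinity>k. guess w n k = x"
      using candidate_limit(2)[OF n(2)] by blast
    obtain i me where i: "i \<in> set_decode x" "me \<in> range \<tau> \<times> range \<tau>"
      "infinite (\<Union>k. pair_hits \<tau> w i me k)"
    proof -
      have "card (set_decode x) = n" "\<And>k. separated \<tau> w k (set_decode x)"
        using x(1) by (auto simp: candidate_def)
      then show ?thesis
        using exists_infinite_hits[OF \<tau>, of "set_decode x" w] n(3) that
        by (metis finite_set_decode)
    qed
    have "me \<in> good_types \<tau> L"
      using infinite_hits_factoring[OF \<tau> i(3)] \<open>w \<in> L\<close> unfolding good_types_def by blast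
    moreover have "\<exists>\<^sub>\<infinity>k. flash w n me k" using flash_infinite[OF x(2)] i by blast
    ultimately show "inf_colors C color w \<in> F"
    proof -
      have "(n, None) \<notin> inf_colors C color w" "(Suc n, None) \<in> inf_colors C color w"
        "(n, Some me) \<in> inf_colors C color w" "n < N"
        using n i(2) \<open>\<exists>\<^sub>\<infinity>k. flash w n me k\<close> unfolding inf_colors_def mem_Collect_eq color_infinite
        by (auto simp: C_def N_def)
      then show ?thesis unfolding F_def using \<open>me \<in> good_types \<tau> L\<close> by blast
    qed
  next
    assume "inf_colors C color w \<in> F"
    then obtain n me where n: "n < N" "separated_of_size \<tau> w n" and me: "me \<in> good_types \<tau> L"
      "\<exists>\<^sub>\<infinity>k. flash w n me k"
    proof -
      obtain n me where n: "n < N" "(n, None) \<notin> inf_colors C color w" "me \<in> good_types \<tau> L"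
        "(n, Some me) \<in> inf_colors C color w"
        using \<open>inf_colors C color w \<in> F\<close> unfolding F_def by blast
      have "(n, None) \<in> C" using n(1) by (simp add: C_def)
      then show ?thesis
        using n that[of n me] unfolding inf_colors_def mem_Collect_eq color_infinite by blast
    qed
    obtain x where x: "\<forall>\<^sub>\<infinity>k. guess w n k = x" using candidate_limit(2)[OF n(2)] by blast
    then obtain i where "infinite (\<Union>k. pair_hits \<tau> w i me k)" using flash_infinite[OF x] me(2) by blast
    then obtain f where "ultimate_types \<tau> w f me" using infinite_hits_factoring[OF \<tau>] by blast
    then show "w \<in> L" using good_types_iff[OF L] me(1) by blast
  qed
  ultimately show ?thesis by blast
qed

end

section \<open>Determinacy of Muller games\<close>

text \<open>Effectivity: which sets the next letter can be forced into. The player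
  \<open>False\<close> can force a set iff the player \<open>True\<close> cannot force its
  complement, so each round is determined by definition.\<close>

definition eff :: "('a list \<Rightarrow> ('a \<Rightarrow> bool) \<Rightarrow> bool) \<Rightarrow> bool \<Rightarrow> 'a list \<Rightarrow> ('a \<Rightarrow> bool) \<Rightarrow> bool" where
  "eff E P h X \<longleftrightarrow> (if P then E h X else \<not> E h (\<lambda>x. \<not> X x))"

definition follows :: "('a list \<Rightarrow> 'a \<Rightarrow> bool) \<Rightarrow> (nat \<Rightarrow> 'a) \<Rightarrow> nat \<Rightarrow> bool" where
  "follows \<sigma> b n \<longleftrightarrow> (\<forall>k\<ge>n. \<sigma> (sub b 0 k) (b k))"

text \<open>The axioms make the forceable sets of both players upward closed and nonempty.\<close>

locale Muller_game =
  fixes E :: "'a list \<Rightarrow> ('a \<Rightarrow> bool) \<Rightarrow> bool"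
    and col :: "'c \<Rightarrow> 'a list \<Rightarrow> bool"
    and F :: "'c set set"
  assumes E_mono: "E h X \<Longrightarrow> (\<And>x. X x \<Longrightarrow> Y x) \<Longrightarrow> E h Y"
    and E_top: "E h (\<lambda>_. True)"
    and E_bot: "\<not> E h (\<lambda>_. False)"
begin

definition legal :: "bool \<Rightarrow> ('a list \<Rightarrow> 'a \<Rightarrow> bool) \<Rightarrow> bool" where
  "legal P \<sigma> \<longleftrightarrow> (\<forall>h. eff E P h (\<sigma> h))"

text \<open>A history with a \<open>stop\<close> value decides the play early; the subgames of the
  determinacy proof are formed this way. The induction shrinks \<open>C\<close> while
  \<open>F\<close> stays fixed.\<close>

definition outcome :: "('a list \<Rightarrow> bool option) \<Rightarrow> 'c set \<Rightarrow> nat \<Rightarrow> (nat \<Rightarrow> 'a) \<Rightarrow> bool" where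
  "outcome stop C n b =
     (if \<exists>k\<ge>n. stop (sub b 0 k) \<noteq> None
      then the (stop (sub b 0 (LEAST k. n \<le> k \<and> stop (sub b 0 k) \<noteq> None)))
      else inf_colors C col b \<in> F)"

definition wins :: "bool \<Rightarrow> ('a list \<Rightarrow> bool option) \<Rightarrow> 'c set \<Rightarrow> 'a list \<Rightarrow> bool" where
  "wins P stop C v \<longleftrightarrow> (\<exists>\<sigma>. legal P \<sigma> \<and>
     (\<forall>b. sub b 0 (length v) = v \<longrightarrow> follows \<sigma> b (length v) \<longrightarrow> outcome stop C (length v) b = P))"

lemma eff_top: "eff E P h (\<lambda>_. True)"
  using E_top E_bot by (simp add: eff_def)

lemma eff_nonempty: "eff E P h X \<Longrightarrow> \<exists>x. X x"
proof (rule ccontr)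
  assume X: "eff E P h X" and "\<nexists>x. X x"
  then have "X = (\<lambda>_. False)" by auto
  then show False using X E_top[of h] E_bot[of h] by (simp add: eff_def split: if_splits)
qed

lemma eff_dual: "\<not> eff E P h X \<Longrightarrow> eff E (\<not> P) h (\<lambda>x. \<not> X x)"
  by (auto simp: eff_def split: if_splits)

lemma extend_play:
  assumes "legal P \<sigma>"
  obtains b' where "\<And>t. t < k \<Longrightarrow> b' t = b t" "follows \<sigma> b' k"
proof -
  define H where "H d = ((\<lambda>h. h @ [SOME x. \<sigma> h x]) ^^ d) (sub b 0 k)" for d
  define b' where "b' t = (if t < k then b t else SOME x. \<sigma> (H (t - k)) x)" for t
  have H: "sub b' 0 (k + d) = H d" for d
  proof (induction d)
    case 0 then show ?case by (auto simp: H_def b'_def intro: sub_cong)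
  next
    case (Suc d) then show ?case by (simp add: sub_Suc) (simp add: H_def b'_def)
  qed
  have "\<sigma> (sub b' 0 t) (b' t)" if "t \<ge> k" for t
  proof -
    have "\<exists>x. \<sigma> (H (t - k)) x" using eff_nonempty assms unfolding legal_def by blast
    then have "\<sigma> (H (t - k)) (b' t)" unfolding b'_def using that by (simp add: someI_ex)
    then show ?thesis using H[of "t - k"] that by simp
  qed
  then show ?thesis using that[of b'] by (auto simp: b'_def follows_def)
qed

lemma outcome_stop:
  assumes "n \<le> k" "stop (sub b 0 k) = Some Q" "\<And>j. n \<le> j \<Longrightarrow> j < k \<Longrightarrow> stop (sub b 0 j) = None"
  shows "outcome stop C n b = Q"
proof -
  have "(LEAST k. n \<le> k \<and> stop (sub b 0 k) \<noteq> None) = k"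
    using assms by (intro Least_equality) (auto simp: not_less[symmetric])
  then show ?thesis using assms unfolding outcome_def by auto
qed

lemma outcome_nonstop:
  "(\<And>k. n \<le> k \<Longrightarrow> stop (sub b 0 k) = None) \<Longrightarrow> outcome stop C n b \<longleftrightarrow> inf_colors C col b \<in> F"
  unfolding outcome_def by auto

lemma first_stop_cases:
  obtains (never) "\<And>k. n \<le> k \<Longrightarrow> stop (sub b 0 k) = None"
  | (first) k Q where "n \<le> k" "stop (sub b 0 k) = Some Q"
      "\<And>j. n \<le> j \<Longrightarrow> j < k \<Longrightarrow> stop (sub b 0 j) = None"
proof (cases "\<exists>k\<ge>n. stop (sub b 0 k) \<noteq> None")
  case True
  define k where "k = (LEAST k. n \<le> k \<and> stop (sub b 0 k) \<noteq> None)"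
  have "n \<le> k \<and> stop (sub b 0 k) \<noteq> None" unfolding k_def by (rule LeastI_ex) (use True in blast)
  moreover have "stop (sub b 0 j) = None" if "n \<le> j" "j < k" for j
    using not_less_Least[of j "\<lambda>k. n \<le> k \<and> stop (sub b 0 k) \<noteq> None"] that unfolding k_def by blast
  ultimately show ?thesis using first by blast
qed (use never in blast)

lemma outcome_shift:
  assumes "n \<le> k" "\<And>j. n \<le> j \<Longrightarrow> j < k \<Longrightarrow> stop (sub b 0 j) = None"
  shows "outcome stop C n b = outcome stop C k b"
proof (cases rule: first_stop_cases[of k stop b])
  case never
  then have "stop (sub b 0 j) = None" if "n \<le> j" for j using assms that by (cases "j < k") auto
  then show ?thesis using never by (simp add: outcome_nonstop)
next
  case (first l Q)
  then have "stop (sub b 0 j) = None" if "n \<le> j" "j < l" for j using assms that by (cases "j < k") auto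
  then have "outcome stop C n b = Q" using first assms by (intro outcome_stop) auto
  moreover have "outcome stop C k b = Q" using first by (intro outcome_stop) auto
  ultimately show ?thesis by simp
qed

lemma wins_stopped: "stop v = Some Q \<Longrightarrow> wins P stop C v \<longleftrightarrow> P = Q"
proof -
  assume stop: "stop v = Some Q"
  have out: "outcome stop C (length v) b = Q" if "sub b 0 (length v) = v" for b
    using stop that by (intro outcome_stop) auto
  have "\<exists>b. sub b 0 (length v) = v \<and> follows \<sigma> b (length v)" if leg: "legal P \<sigma>" for \<sigma>
  proof -
    obtain b where "\<And>t. t < length v \<Longrightarrow> b t = v ! t" "follows \<sigma> b (length v)"
      using extend_play[OF leg, of "length v" "(!) v"] by blast
    then show ?thesis by (intro exI[of _ b]) (auto intro: nth_equalityI)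
  qed
  moreover have "legal P (\<lambda>_ _. True)" by (simp add: legal_def eff_top)
  ultimately show ?thesis unfolding wins_def using out by blast
qed

text \<open>Follow \<open>\<sigma>\<close> up to the first history that is known to be won, then
  switch for good to a winning strategy chosen for that history.\<close>

lemma wins_continue:
  assumes \<sigma>: "legal P \<sigma>"
    and step: "\<And>b. sub b 0 (length v) = v \<Longrightarrow> follows \<sigma> b (length v) \<Longrightarrow>
      outcome stop C (length v) b = P \<or>
      (\<exists>k\<ge>length v. wins P stop C (sub b 0 k) \<and> (\<forall>j. length v \<le> j \<longrightarrow> j < k \<longrightarrow> stop (sub b 0 j) = None))"
  shows "wins P stop C v"
proof -
  let ?W = "wins P stop C"
  have "\<forall>u. \<exists>\<tau>. legal P \<tau> \<and> (?W u \<longrightarrow> (\<forall>b. sub b 0 (length u) = u \<longrightarrow> follows \<tau> b (length u) \<longrightarrow>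
     outcome stop C (length u) b = P))"
    unfolding wins_def using \<sigma> by blast
  then obtain \<tau> where \<tau>: "\<And>u. legal P (\<tau> u)"
    "\<And>u b. ?W u \<Longrightarrow> sub b 0 (length u) = u \<Longrightarrow> follows (\<tau> u) b (length u) \<Longrightarrow> outcome stop C (length u) b = P"
    by metis
  define hit where "hit u k \<longleftrightarrow> length v \<le> k \<and> k \<le> length u \<and> ?W (take k u)" for u k
  define \<sigma>' where "\<sigma>' u = (if \<exists>k. hit u k then \<tau> (take (LEAST k. hit u k) u) u else \<sigma> u)" for u
  have "legal P \<sigma>'" using \<sigma> \<tau>(1) unfolding legal_def \<sigma>'_def by simp
  moreover have "outcome stop C (length v) b = P"
    if b: "sub b 0 (length v) = v" "follows \<sigma>' b (length v)" for b
  proof (cases "\<exists>k\<ge>length v. ?W (sub b 0 k)")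
    case False
    then have "\<not> hit (sub b 0 k) l" for k l unfolding hit_def by (auto simp: take_sub)
    then have "\<sigma>' (sub b 0 k) = \<sigma> (sub b 0 k)" for k by (simp add: \<sigma>'_def)
    then have "follows \<sigma> b (length v)" using b(2) unfolding follows_def by simp
    then show ?thesis using step[OF b(1)] False by blast
  next
    case True
    define k where "k = (LEAST k. k \<ge> length v \<and> ?W (sub b 0 k))"
    have k: "k \<ge> length v" "?W (sub b 0 k)"
      using LeastI_ex[of "\<lambda>k. k \<ge> length v \<and> ?W (sub b 0 k)"] True unfolding k_def by blast+
    have less: "\<not> ?W (sub b 0 j)" if "length v \<le> j" "j < k" for j
      using not_less_Least[of j "\<lambda>k. k \<ge> length v \<and> ?W (sub b 0 k)"] that unfolding k_def by blast
    have hit: "hit (sub b 0 m) j \<longleftrightarrow> length v \<le> j \<and> j \<le> m \<and> ?W (sub b 0 j)" for m j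
      unfolding hit_def by (auto simp: take_sub)
    have before: "\<sigma>' (sub b 0 m) = \<sigma> (sub b 0 m)" if "m < k" for m
    proof -
      have "\<not> hit (sub b 0 m) j" for j using hit less that by (meson le_less_trans)
      then show ?thesis by (simp add: \<sigma>'_def)
    qed
    have after: "\<sigma>' (sub b 0 m) = \<tau> (sub b 0 k) (sub b 0 m)" if "k \<le> m" for m
    proof -
      have "hit (sub b 0 m) k" using hit k that by blast
      moreover have "(LEAST j. hit (sub b 0 m) j) = k"
        using hit k that less by (intro Least_equality) (auto simp: not_less[symmetric])
      ultimately show ?thesis using that by (auto simp: \<sigma>'_def take_sub)
    qed
    have out_k: "outcome stop C k b = P"
    proof -
      have "\<tau> (sub b 0 k) (sub b 0 m) (b m)" if "k \<le> m" for m
        using b(2) k(1) after[OF that] that unfolding follows_def by (metis order_trans)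
      then show ?thesis using \<tau>(2)[OF k(2), of b] by (simp add: follows_def)
    qed
    \<comment> \<open>\<open>step\<close> speaks of plays that never leave \<open>\<sigma>\<close>,
      so it is applied to \<open>b'\<close>, which shares the first \<open>k\<close> letters with
      \<open>b\<close>. If \<open>b\<close> is stopped before \<open>k\<close>, so is
      \<open>b'\<close>, with the same verdict, and the second alternative of \<open>step\<close> is
      excluded by the minimality of \<open>k\<close> and by the stop.\<close>
    obtain b' where b': "\<And>t. t < k \<Longrightarrow> b' t = b t" "follows \<sigma> b' k" using extend_play[OF \<sigma>, of k b] by blast
    have sub_eq: "sub b' 0 j = sub b 0 j" if "j \<le> k" for j using b'(1) that by (intro sub_cong) auto
    have "follows \<sigma> b' (length v)" unfolding follows_def
    proof (intro allI impI)
      fix m assume "length v \<le> m"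
      then show "\<sigma> (sub b' 0 m) (b' m)"
        using b' b(2) before[of m] unfolding follows_def by (cases "m < k") (auto simp: sub_eq)
    qed
    then have alt: "outcome stop C (length v) b' = P \<or>
      (\<exists>l\<ge>length v. ?W (sub b' 0 l) \<and> (\<forall>j. length v \<le> j \<longrightarrow> j < l \<longrightarrow> stop (sub b' 0 j) = None))"
      using step[of b'] b(1) k(1) sub_eq by simp
    show ?thesis
    proof (cases "\<forall>j. length v \<le> j \<longrightarrow> j < k \<longrightarrow> stop (sub b 0 j) = None")
      case True then show ?thesis using outcome_shift[OF k(1), of stop b C] out_k by blast
    next
      case False
      obtain j Q where j: "length v \<le> j" "j < k" "stop (sub b 0 j) = Some Q"
        "\<And>i. length v \<le> i \<Longrightarrow> i < j \<Longrightarrow> stop (sub b 0 i) = None"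
      proof (cases rule: first_stop_cases[of "length v" stop b])
        case never then show ?thesis using False by blast
      next
        case (first j Q)
        have "j < k" using False first(3) by (meson not_le_imp_less order_less_le_trans)
        then show ?thesis using that first by blast
      qed
      have out: "outcome stop C (length v) b = Q" using j by (intro outcome_stop) auto
      have out': "outcome stop C (length v) b' = Q"
        using j sub_eq by (intro outcome_stop) auto
      have "\<not> (\<exists>l\<ge>length v. ?W (sub b' 0 l) \<and> (\<forall>j. length v \<le> j \<longrightarrow> j < l \<longrightarrow> stop (sub b' 0 j) = None))"
      proof
        assume "\<exists>l\<ge>length v. ?W (sub b' 0 l) \<and> (\<forall>j. length v \<le> j \<longrightarrow> j < l \<longrightarrow> stop (sub b' 0 j) = None)"
        then obtain l where l: "l \<ge> length v" "?W (sub b' 0 l)"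
          "\<forall>j. length v \<le> j \<longrightarrow> j < l \<longrightarrow> stop (sub b' 0 j) = None" by blast
        have "l < k \<Longrightarrow> False" using less[of l] l(1,2) sub_eq[of l] by simp
        moreover have "k \<le> l \<Longrightarrow> False" using l(3) j sub_eq[of j] by force
        ultimately show False by linarith
      qed
      then show ?thesis using alt out out' by blast
    qed
  qed
  ultimately show ?thesis unfolding wins_def by blast
qed

section \<open>Subgames in which one colour ends the play\<close>

context
  fixes P :: bool and stop :: "'a list \<Rightarrow> bool option" and C :: "'c set"
begin

text \<open>The player \<open>P\<close> wins by reaching \<open>c\<close> strictly after
  \<open>u\<close> and loses on entering the winning region of the opponent. Excluding
  \<open>u\<close> itself forces a new visit of \<open>c\<close> in each phase.\<close>

definition stop_at :: "'c \<Rightarrow> 'a list \<Rightarrow> 'a list \<Rightarrow> bool option" where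
  "stop_at c u w =
     (if stop w \<noteq> None then stop w
      else if wins (\<not> P) stop C w then Some (\<not> P)
      else if col c w \<and> length u < length w then Some P else None)"

lemma stop_at_None: "stop_at c u w = None \<longleftrightarrow>
    stop w = None \<and> \<not> wins (\<not> P) stop C w \<and> \<not> (col c w \<and> length u < length w)"
  unfolding stop_at_def by auto

lemma stop_at_lose: "stop_at c u w = Some (\<not> P) \<longleftrightarrow> wins (\<not> P) stop C w"
  unfolding stop_at_def using wins_stopped[of stop w _ "\<not> P" C] by auto

lemma inf_colors_remove:
  assumes "\<And>k. k > n \<Longrightarrow> \<not> col c (sub b 0 k)"
  shows "inf_colors C col b = inf_colors (C - {c}) col b"
proof -
  have "\<not> (\<exists>\<^sub>\<infinity>k. col c (sub b 0 k))" using assms unfolding INFM_nat by blast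
  then show ?thesis unfolding inf_colors_def by blast
qed

text \<open>A play of the subgame that is never stopped shows \<open>c\<close> nowhere after
  \<open>u\<close>, so dropping \<open>c\<close> does not change its recurring colours. A stopped
  play won by the opponent has entered his winning region, where \<open>wins_continue\<close> takes
  over.\<close>

lemma wins_stop_at:
  assumes "wins (\<not> P) (stop_at c u) (C - {c}) u" shows "wins (\<not> P) stop C u"
proof -
  obtain \<sigma> where \<sigma>: "legal (\<not> P) \<sigma>" "\<And>b. sub b 0 (length u) = u \<Longrightarrow> follows \<sigma> b (length u) \<Longrightarrow>
      outcome (stop_at c u) (C - {c}) (length u) b = (\<not> P)"
    using assms unfolding wins_def by blast
  show ?thesis
  proof (rule wins_continue[OF \<sigma>(1)])
    fix b assume b: "sub b 0 (length u) = u" "follows \<sigma> b (length u)"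
    show "outcome stop C (length u) b = (\<not> P) \<or>
      (\<exists>k\<ge>length u. wins (\<not> P) stop C (sub b 0 k) \<and>
        (\<forall>j. length u \<le> j \<longrightarrow> j < k \<longrightarrow> stop (sub b 0 j) = None))"
    proof (cases rule: first_stop_cases[of "length u" "stop_at c u" b])
      case never
      then have n: "stop (sub b 0 k) = None" "length u < k \<longrightarrow> \<not> col c (sub b 0 k)" if "length u \<le> k" for k
        using that by (auto simp: stop_at_None)
      then have "inf_colors C col b = inf_colors (C - {c}) col b"
        by (intro inf_colors_remove[of "length u"]) auto
      then show ?thesis using \<sigma>(2)[OF b] never n by (simp add: outcome_nonstop)
    next
      case (first k Q)
      then have "Q = (\<not> P)" using \<sigma>(2)[OF b] outcome_stop by metis
      then have "wins (\<not> P) stop C (sub b 0 k)" using first(2) stop_at_lose by blast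
      moreover have "stop (sub b 0 j) = None" if "length u \<le> j" "j < k" for j
        using first(3)[OF that] stop_at_None by blast
      ultimately show ?thesis using first(1) by blast
    qed
  qed
qed

text \<open>Without colours every play that is never stopped goes to \<open>P\<close>, so he only
  has to stay outside the winning region of the opponent. If he could not force the next step to
  stay outside, the opponent could force it to lead inside and would have won already.\<close>

lemma wins_trivial:
  assumes "P \<longleftrightarrow> {} \<in> F" "C = {}" "\<not> wins (\<not> P) stop C v"
  shows "wins P stop C v"
proof -
  let ?V = "\<lambda>h. \<not> wins (\<not> P) stop C h"
  have step: "eff E P h (\<lambda>x. ?V (h @ [x]))" if "?V h" "stop h = None" for h
  proof (rule ccontr)
    assume neg: "\<not> eff E P h (\<lambda>x. ?V (h @ [x]))"
    define \<sigma> where "\<sigma> u = (if u = h then (\<lambda>x. wins (\<not> P) stop C (h @ [x])) else (\<lambda>_. True))" for u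
    have leg: "legal (\<not> P) \<sigma>" using eff_dual[OF neg] by (auto simp: legal_def \<sigma>_def eff_top)
    have "wins (\<not> P) stop C h"
    proof (rule wins_continue[OF leg])
      fix b assume b: "sub b 0 (length h) = h" "follows \<sigma> b (length h)"
      have "wins (\<not> P) stop C (sub b 0 (Suc (length h)))"
        using b unfolding follows_def \<sigma>_def by (auto simp: sub_Suc dest: spec[of _ "length h"])
      moreover have "stop (sub b 0 j) = None" if "length h \<le> j" "j < Suc (length h)" for j
        using that b(1) \<open>stop h = None\<close> by (metis le_antisym less_Suc_eq_le)
      ultimately show "outcome stop C (length h) b = (\<not> P) \<or>
        (\<exists>k\<ge>length h. wins (\<not> P) stop C (sub b 0 k) \<and>
          (\<forall>j. length h \<le> j \<longrightarrow> j < k \<longrightarrow> stop (sub b 0 j) = None))"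
        by (meson le_SucI order_refl)
    qed
    then show False using that by simp
  qed
  define \<sigma> where "\<sigma> h = (if ?V h \<and> stop h = None then (\<lambda>x. ?V (h @ [x])) else (\<lambda>_. True))" for h
  have "legal P \<sigma>" using step by (auto simp: legal_def \<sigma>_def eff_top)
  moreover have "outcome stop C (length v) b = P"
    if b: "sub b 0 (length v) = v" "follows \<sigma> b (length v)" for b
  proof -
    have V: "?V (sub b 0 (length v + d))" if "\<And>j. length v \<le> j \<Longrightarrow> j < length v + d \<Longrightarrow> stop (sub b 0 j) = None" for d
      using that
    proof (induction d)
      case (Suc d)
      then have "?V (sub b 0 (length v + d))" "stop (sub b 0 (length v + d)) = None" by auto
      moreover have "\<sigma> (sub b 0 (length v + d)) (b (length v + d))" using b(2) by (simp add: follows_def)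
      ultimately show ?case by (simp add: \<sigma>_def sub_Suc)
    qed (use b assms in simp)
    show ?thesis
    proof (cases rule: first_stop_cases[of "length v" stop b])
      case never
      then show ?thesis using assms by (simp add: outcome_nonstop inf_colors_def)
    next
      case (first k Q)
      then have "?V (sub b 0 k)" using V[of "k - length v"] by simp
      then have "Q = P" using wins_stopped[of stop "sub b 0 k" Q "\<not> P" C, OF first(2)] by blast
      then show ?thesis using first by (intro outcome_stop) auto
    qed
  qed
  ultimately show ?thesis unfolding wins_def by blast
qed

end

text \<open>A player \<open>P\<close> who wins when all colours recur, and whose opponent cannot win from \<open>v\<close>,
  forces the colours in rotation: if he could not force \<open>c\<close> next, then by the
  induction hypothesis the opponent would win the game in which \<open>c\<close> ends the play.\<close>

lemma wins_rotate:
  assumes P: "P \<longleftrightarrow> C \<in> F" and C: "finite C" "C \<noteq> {}"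
    and IH: "\<And>c stop v. c \<in> C \<Longrightarrow> wins P stop (C - {c}) v \<or> wins (\<not> P) stop (C - {c}) v"
    and v: "\<not> wins (\<not> P) stop C v"
  shows "wins P stop C v"
proof -
  let ?V = "\<lambda>h. \<not> wins (\<not> P) stop C h"
  let ?st = "stop_at P stop C"
  have "\<exists>\<sigma>. legal P \<sigma> \<and> (c \<in> C \<and> ?V u \<longrightarrow> (\<forall>b. sub b 0 (length u) = u \<longrightarrow> follows \<sigma> b (length u) \<longrightarrow>
      outcome (?st c u) (C - {c}) (length u) b = P))" for c u
  proof (cases "c \<in> C \<and> ?V u")
    case True
    then have "wins P (?st c u) (C - {c}) u" using IH wins_stop_at by blast
    then show ?thesis unfolding wins_def by blast
  qed (auto intro!: exI[of _ "\<lambda>_ _. True"] simp: legal_def eff_top)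
  then obtain S where S: "\<And>c u. legal P (S c u)"
    "\<And>c u b. c \<in> C \<Longrightarrow> ?V u \<Longrightarrow> sub b 0 (length u) = u \<Longrightarrow> follows (S c u) b (length u) \<Longrightarrow>
      outcome (?st c u) (C - {c}) (length u) b = P"
    by metis
  obtain cs where cs: "set cs = C" using C(1) finite_list by blast
  \<comment> \<open>Cyclic enumeration of the colours, so that each has arbitrarily large
    indices.\<close>
  define cl where "cl i = cs ! (i mod length cs)" for i
  have cl: "cl i \<in> C" for i using cs C(2) by (auto simp: cl_def intro: nth_mem)
  define n where "n = length v"
  \<comment> \<open>The current phase, as its starting time and its index, after \<open>d\<close>
    further rounds. The strategy recomputes it from the history alone.\<close>
  define ph where "ph b = rec_nat (n, 0) (\<lambda>d (r, i).
      if col (cl i) (sub b 0 (n + Suc d)) then (n + Suc d, Suc i) else (r, i))" for b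
  have ph0: "ph b 0 = (n, 0)" for b by (simp add: ph_def)
  have phS: "ph b (Suc d) = (if col (cl (snd (ph b d))) (sub b 0 (n + Suc d))
      then (n + Suc d, Suc (snd (ph b d))) else ph b d)" for b d
    by (simp add: ph_def split: prod.splits)
  have ph_prefix: "ph ((!) (sub b 0 m)) d = ph b d" if "n + d \<le> m" for b d m
    using that
  proof (induction d)
    case (Suc d)
    then show ?case by (simp add: phS sub_nth_sub del: add_Suc_right)
  qed (simp add: ph0)
  define \<sigma> where "\<sigma> u = (let (r, i) = ph ((!) u) (length u - n) in S (cl i) (take r u) u)" for u
  have "legal P \<sigma>" using S(1) by (auto simp: legal_def \<sigma>_def split: prod.splits)
  moreover have "outcome stop C n b = P" if b: "sub b 0 n = v" "follows \<sigma> b n" for b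
  proof -
    define rt where "rt d = fst (ph b d)" for d
    define ix where "ix d = snd (ph b d)" for d
    define pre where "pre k = sub b 0 k" for k
    have len_pre [simp]: "length (pre k) = k" for k by (simp add: pre_def)
    have rt0: "rt 0 = n" "ix 0 = 0" by (simp_all add: rt_def ix_def ph0)
    have switch: "rt (Suc d) = n + Suc d" "ix (Suc d) = Suc (ix d)"
      if "col (cl (ix d)) (pre (n + Suc d))" for d
      using that by (simp_all add: rt_def ix_def phS pre_def)
    have stay: "rt (Suc d) = rt d" "ix (Suc d) = ix d"
      if "\<not> col (cl (ix d)) (pre (n + Suc d))" for d
      using that by (simp_all add: rt_def ix_def phS pre_def)
    have rt_le: "rt d \<le> n + d" for d
    proof (induction d)
      case (Suc d) then show ?case
        by (cases "col (cl (ix d)) (pre (n + Suc d))") (simp_all add: switch stay)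
    qed (simp add: rt0)
    have rt_ge: "n \<le> rt d" for d
    proof (induction d)
      case (Suc d) then show ?case
        by (cases "col (cl (ix d)) (pre (n + Suc d))") (simp_all add: switch stay)
    qed (simp add: rt0)
    have move: "S (cl (ix d)) (pre (rt d)) (pre (n + d)) (b (n + d))" for d
    proof -
      have "\<sigma> (sub b 0 (n + d)) (b (n + d))" using b(2) unfolding follows_def by simp
      then have "S (cl (ix d)) (take (rt d) (sub b 0 (n + d))) (sub b 0 (n + d)) (b (n + d))"
        by (simp add: \<sigma>_def ph_prefix rt_def ix_def split: prod.splits)
      then show ?thesis using rt_le[of d] by (simp add: take_sub pre_def)
    qed
    define inv where "inv d \<longleftrightarrow> ?V (pre (rt d))
        \<and> (\<forall>k. rt d \<le> k \<and> k < n + d \<longrightarrow> ?st (cl (ix d)) (pre (rt d)) (pre k) = None)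
        \<and> (\<forall>k. rt d < k \<and> k \<le> n + d \<longrightarrow> \<not> col (cl (ix d)) (pre k))
        \<and> (\<forall>k. rt d \<le> k \<and> k < n + d \<longrightarrow> S (cl (ix d)) (pre (rt d)) (pre k) (b k))" for d
    \<comment> \<open>If the opponent's region were entered during a phase, the play could be
      continued by the phase strategy, and the subgame of that phase, which this strategy wins,
      would be stopped as lost.\<close>
    have safe: "?V (pre m)"
      if m: "r \<le> m" and V: "?V (pre r)" and nostop: "\<And>k. r \<le> k \<Longrightarrow> k < m \<Longrightarrow> ?st (cl i) (pre r) (pre k) = None"
        and mv: "\<And>k. r \<le> k \<Longrightarrow> k < m \<Longrightarrow> S (cl i) (pre r) (pre k) (b k)" for r m i
    proof
      assume "wins (\<not> P) stop C (pre m)"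
      then have lose: "?st (cl i) (pre r) (pre m) = Some (\<not> P)" by (simp add: stop_at_lose)
      obtain b' where b': "\<And>t. t < m \<Longrightarrow> b' t = b t" "follows (S (cl i) (pre r)) b' m"
        using extend_play[OF S(1), of m b "cl i" "pre r"] by blast
      have eq: "sub b' 0 k = pre k" if "k \<le> m" for k
        unfolding pre_def using b'(1) that by (intro sub_cong) auto
      have "S (cl i) (pre r) (sub b' 0 k) (b' k)" if "r \<le> k" for k
        using that b' mv[of k] eq[of k] unfolding follows_def by (cases "k < m") auto
      then have "outcome (?st (cl i) (pre r)) (C - {cl i}) (length (pre r)) b' = P"
        using m eq by (intro S(2)[OF cl V]) (auto simp: follows_def)
      moreover have "outcome (?st (cl i) (pre r)) (C - {cl i}) (length (pre r)) b' = (\<not> P)"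
        using m lose nostop eq by (intro outcome_stop) auto
      ultimately show False by simp
    qed
    have inv_safe: "?V (pre (n + d))" if "inv d" for d
      using that rt_le[of d] by (intro safe[of "rt d" "n + d" "ix d"]) (auto simp: inv_def)
    have inv: "inv d" if "\<And>k. n \<le> k \<Longrightarrow> k < n + d \<Longrightarrow> stop (pre k) = None" for d
      using that
    proof (induction d)
      case 0
      then show ?case using v b(1) by (auto simp: inv_def rt0 pre_def n_def)
    next
      case (Suc d)
      then have I: "inv d" and st: "stop (pre (n + d)) = None" by auto
      let ?c = "cl (ix d)"
      have nostop: "?st ?c (pre (rt d)) (pre k) = None" if "rt d \<le> k" "k < n + Suc d" for k
      proof (cases "k < n + d")
        case True then show ?thesis using I that unfolding inv_def by blast
      next
        case False
        then have "k = n + d" using that by simp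
        moreover have "\<not> (col ?c (pre (n + d)) \<and> rt d < n + d)" using I unfolding inv_def by blast
        ultimately show ?thesis using st inv_safe[OF I] by (simp add: stop_at_None)
      qed
      have mv: "S ?c (pre (rt d)) (pre k) (b k)" if "rt d \<le> k" "k < n + Suc d" for k
      proof (cases "k < n + d")
        case True then show ?thesis using I that unfolding inv_def by blast
      next
        case False
        then have "k = n + d" using that by simp
        then show ?thesis using move by simp
      qed
      have V: "?V (pre (rt d))" using I by (simp add: inv_def)
      show ?case
      proof (cases "col ?c (pre (n + Suc d))")
        case True
        have "?V (pre (n + Suc d))"
          by (rule safe[OF _ V nostop mv]) (use rt_le[of d] in auto)
        then show ?thesis unfolding inv_def switch[OF True] by auto
      next
        case False
        have "\<not> col ?c (pre k)" if "rt d < k" "k \<le> n + Suc d" for k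
          using False that I unfolding inv_def by (cases "k = n + Suc d") auto
        then show ?thesis unfolding inv_def stay[OF False] using V nostop mv by blast
      qed
    qed
    show ?thesis
    proof (cases rule: first_stop_cases[of n stop b])
      case (first k Q)
      have "inv (k - n)" using first by (intro inv) (auto simp: pre_def)
      then have "?V (pre k)" using inv_safe[of "k - n"] first(1) by simp
      then have "Q = P" using wins_stopped[of stop "pre k" Q "\<not> P" C] first(2) by (simp add: pre_def)
      then show ?thesis using first by (intro outcome_stop) auto
    next
      case never
      then have inv: "inv d" for d using inv by (simp add: pre_def)
      have out: "outcome stop C n b \<longleftrightarrow> inf_colors C col b \<in> F"
        using never by (rule outcome_nonstop)
      show ?thesis
      proof (cases "\<exists>d0. \<forall>d\<ge>d0. ix d = ix d0")
        \<comment> \<open>Some phase never ends: its colour no longer appears, so winning its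
          subgame is winning the game.\<close>
        case True
        then obtain d0 where d0: "\<And>d. d \<ge> d0 \<Longrightarrow> ix d = ix d0" by blast
        have const: "rt (d0 + e) = rt d0" for e
        proof (induction e)
          case (Suc e)
          have "ix (Suc (d0 + e)) = ix (d0 + e)" using d0[of "Suc (d0 + e)"] d0[of "d0 + e"] by simp
          then have "\<not> col (cl (ix (d0 + e))) (pre (n + Suc (d0 + e)))" using switch(2) by force
          then show ?case using stay(1) Suc by simp
        qed simp
        let ?c = "cl (ix d0)" and ?r = "rt d0"
        have at: "?V (pre ?r)" "?r \<le> k \<Longrightarrow> ?st ?c (pre ?r) (pre k) = None"
          "?r < k \<Longrightarrow> \<not> col ?c (pre k)" "?r \<le> k \<Longrightarrow> S ?c (pre ?r) (pre k) (b k)" for k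
          using inv[of "d0 + Suc k"] const[of "Suc k"] d0[of "d0 + Suc k"] unfolding inv_def by auto
        have "outcome (?st ?c (pre ?r)) (C - {?c}) (length (pre ?r)) b = P"
          using at by (intro S(2)[OF cl]) (auto simp: follows_def pre_def)
        moreover have "outcome (?st ?c (pre ?r)) (C - {?c}) (length (pre ?r)) b
            \<longleftrightarrow> inf_colors (C - {?c}) col b \<in> F"
          using at(2) by (intro outcome_nonstop) (simp add: pre_def)
        moreover have "inf_colors C col b = inf_colors (C - {?c}) col b"
          using at(3) by (intro inf_colors_remove[of ?r]) (simp add: pre_def)
        ultimately show ?thesis using out by simp
      next
        case False
        have mono: "ix (Suc d) = ix d \<or> ix (Suc d) = Suc (ix d)" for d using switch(2) stay(2) by blast
        have ix_le: "ix d \<le> d" for d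
        proof (induction d)
          case (Suc d) then show ?case using mono[of d] by auto
        qed (simp add: rt0)
        have le: "ix d \<le> ix e" if "d \<le> e" for d e
        proof (rule lift_Suc_mono_le[OF _ that])
          fix k show "ix k \<le> ix (Suc k)" using mono[of k] by auto
        qed
        have unb: "\<exists>d. N \<le> ix d" for N
        proof (induction N)
          case (Suc N)
          then obtain d where d: "N \<le> ix d" by blast
          obtain e where "e \<ge> d" "ix e \<noteq> ix d" using False by blast
          then have "Suc N \<le> ix e" using le[of d e] d by simp
          then show ?case by blast
        qed simp
        have ev: "\<exists>d. ix d = i \<and> col (cl i) (pre (n + Suc d))" for i
        proof -
          define d where "d = (LEAST d. Suc i \<le> ix d)"
          have d: "Suc i \<le> ix d" unfolding d_def by (rule LeastI_ex[OF unb])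
          then obtain d' where d': "d = Suc d'" using rt0 by (cases d) auto
          have "\<not> Suc i \<le> ix d'"
            using not_less_Least[of d' "\<lambda>d. Suc i \<le> ix d"] d' unfolding d_def[symmetric] by simp
          then have "ix d' = i" "ix (Suc d') \<noteq> ix d'" using d d' mono[of d'] by auto
          then show ?thesis using stay(2) by blast
        qed
        have "\<exists>\<^sub>\<infinity>k. col c (sub b 0 k)" if "c \<in> C" for c
          unfolding INFM_nat
        proof
          fix M
          obtain q where q: "q < length cs" "cs ! q = c" using \<open>c \<in> C\<close> cs by (metis in_set_conv_nth)
          \<comment> \<open>An index of the colour \<open>c\<close> that exceeds \<open>M\<close>;
            since the index after \<open>d\<close> rounds is at most \<open>d\<close>, it is reached
            only after time \<open>M\<close>.\<close>
          have "(q + length cs * Suc M) mod length cs = q" using q by (metis mod_less mod_mult_self2)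
          then have "cl (q + length cs * Suc M) = c" using q by (simp add: cl_def)
          moreover obtain d where d: "ix d = q + length cs * Suc M"
            "col (cl (q + length cs * Suc M)) (pre (n + Suc d))" using ev by blast
          moreover have "1 * M \<le> length cs * Suc M" using q by (intro mult_le_mono) auto
          then have "M < n + Suc d" using ix_le[of d] d(1) by linarith
          ultimately show "\<exists>k>M. col c (sub b 0 k)" unfolding pre_def by metis
        qed
        then have "inf_colors C col b = C" unfolding inf_colors_def by blast
        then show ?thesis using out P by simp
      qed
    qed
  qed
  ultimately show ?thesis unfolding wins_def n_def by blast
qed

text \<open>Induction on the set of colours with \<open>stop\<close> arbitrary, since subgames nest
  and each adds its own stopping rule. The roles are fixed by \<open>C\<close>: the player
  \<open>P\<close> is the one who wins if all colours recur.\<close>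

theorem Muller_determined:
  assumes "finite C"
  shows "wins True stop C v \<or> wins False stop C v"
  using assms
proof (induction C arbitrary: stop v rule: finite_psubset_induct)
  case (psubset C)
  define P where "P \<longleftrightarrow> C \<in> F"
  have IH: "wins P stop (C - {c}) v \<or> wins (\<not> P) stop (C - {c}) v" if "c \<in> C" for c stop v
    using psubset(2)[of "C - {c}"] that by (cases P) auto
  have "wins P stop C v \<or> wins (\<not> P) stop C v"
  proof (cases "C = {}")
    case True then show ?thesis using wins_trivial[of P C stop v] P_def by blast
  next
    case False then show ?thesis using wins_rotate[of P C stop v] psubset(1) P_def IH by blast
  qed
  then show ?case by (cases P) auto
qed

end

section \<open>Existentially quantified LTL\<close>

definition expressible :: "'ap set \<Rightarrow> ((nat \<Rightarrow> 'ap set) \<Rightarrow> bool) \<Rightarrow> bool" where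
  "expressible Q R \<longleftrightarrow> (\<exists>\<psi>. ltl_props \<psi> \<subseteq> Q \<and> (\<forall>w. ltl_sem w \<psi> \<longleftrightarrow> R w))"

lemma expressibleI: "ltl_props \<psi> \<subseteq> Q \<Longrightarrow> (\<And>w. ltl_sem w \<psi> \<longleftrightarrow> R w) \<Longrightarrow> expressible Q R"
  unfolding expressible_def by blast

lemma expressible_prop: "p \<in> Q \<Longrightarrow> expressible Q (\<lambda>w. p \<in> w 0)"
  by (rule expressibleI[of "LProp p"]) auto

lemma expressible_not:
  assumes "expressible Q R" shows "expressible Q (\<lambda>w. \<not> R w)"
proof -
  obtain \<psi> where "ltl_props \<psi> \<subseteq> Q" "\<And>w. ltl_sem w \<psi> \<longleftrightarrow> R w"
    using assms unfolding expressible_def by blast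
  then show ?thesis by (intro expressibleI[of "LNot \<psi>"]) auto
qed

lemma expressible_conj:
  assumes "expressible Q R" "expressible Q S" shows "expressible Q (\<lambda>w. R w \<and> S w)"
proof -
  obtain \<psi>1 \<psi>2 where "ltl_props \<psi>1 \<subseteq> Q" "ltl_props \<psi>2 \<subseteq> Q"
    "\<And>w. ltl_sem w \<psi>1 \<longleftrightarrow> R w" "\<And>w. ltl_sem w \<psi>2 \<longleftrightarrow> S w"
    using assms unfolding expressible_def by metis
  then show ?thesis by (intro expressibleI[of "LAnd \<psi>1 \<psi>2"]) auto
qed

lemma expressible_const: "expressible Q (\<lambda>w. b)"
  by (rule expressibleI[of "if b then LTrue else LNot LTrue"]) auto

lemma expressible_imp:
  assumes "expressible Q R" "expressible Q S" shows "expressible Q (\<lambda>w. R w \<longrightarrow> S w)"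
proof -
  have "expressible Q (\<lambda>w. \<not> (R w \<and> \<not> S w))"
    using assms by (intro expressible_not expressible_conj)
  then show ?thesis by simp
qed

lemma expressible_iff:
  assumes "expressible Q R" shows "expressible Q (\<lambda>w. R w \<longleftrightarrow> b)"
  using assms expressible_not[OF assms] by (cases b) simp_all

lemma expressible_next:
  assumes "expressible Q R" shows "expressible Q (\<lambda>w. R (\<lambda>t. w (Suc t)))"
proof -
  obtain \<psi> where "ltl_props \<psi> \<subseteq> Q" "\<And>w. ltl_sem w \<psi> \<longleftrightarrow> R w"
    using assms unfolding expressible_def by blast
  then show ?thesis by (intro expressibleI[of "LNext \<psi>"]) auto
qed

lemma expressible_until:
  assumes "expressible Q R" "expressible Q S"
  shows "expressible Q (\<lambda>w. \<exists>j. S (\<lambda>t. w (t + j)) \<and> (\<forall>i<j. R (\<lambda>t. w (t + i))))"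
proof -
  obtain \<psi>1 \<psi>2 where *: "ltl_props \<psi>1 \<subseteq> Q" "ltl_props \<psi>2 \<subseteq> Q"
    "\<And>w. ltl_sem w \<psi>1 \<longleftrightarrow> R w" "\<And>w. ltl_sem w \<psi>2 \<longleftrightarrow> S w"
    using assms unfolding expressible_def by metis
  show ?thesis by (rule expressibleI[of "LUntil \<psi>1 \<psi>2"]) (use * in auto)
qed

lemma expressible_eventually: "expressible Q R \<Longrightarrow> expressible Q (\<lambda>w. \<exists>j. R (\<lambda>t. w (t + j)))"
  using expressible_until[OF expressible_const[of Q True], of R] by simp

lemma expressible_always: "expressible Q R \<Longrightarrow> expressible Q (\<lambda>w. \<forall>j. R (\<lambda>t. w (t + j)))"
  using expressible_not[OF expressible_eventually[OF expressible_not[of Q R]]] by simp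

lemma expressible_ball:
  assumes "finite A" "\<And>a. a \<in> A \<Longrightarrow> expressible Q (R a)"
  shows "expressible Q (\<lambda>w. \<forall>a\<in>A. R a w)"
  using assms
proof (induction A rule: finite_induct)
  case (insert a A)
  then have "expressible Q (\<lambda>w. R a w \<and> (\<forall>a\<in>A. R a w))" by (intro expressible_conj) auto
  then show ?case by simp
qed (use expressible_const[of _ True] in simp)

lemma expressible_bex:
  assumes "finite A" "\<And>a. a \<in> A \<Longrightarrow> expressible Q (R a)"
  shows "expressible Q (\<lambda>w. \<exists>a\<in>A. R a w)"
  using expressible_not[OF expressible_ball[OF assms(1) expressible_not[OF assms(2)]]] by simp

section \<open>Guessing a factorization by quantified propositions\<close>

lemma factoring_enumerate:
  assumes "infinite K" "0 \<in> K"
  shows "factoring (enumerate K)"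
  unfolding factoring_def strict_mono_Suc_iff
  using enumerate_step[OF assms(1)] assms(2) by (simp add: enumerate_0)

lemma enumerate_next_le: "infinite K \<Longrightarrow> k \<in> K \<Longrightarrow> enumerate K n < k \<Longrightarrow> enumerate K (Suc n) \<le> k"
  by (simp add: enumerate_Suc'' Least_le)

text \<open>The quantified propositions guess a factorization into segments of types
  \<open>m, e, e, \<dots>\<close>: \<open>c\<close> marks the starts of segments, and \<open>x s\<close> holds at a
  position iff the segment up to and including that position has type \<open>s\<close>.\<close>

lemma recognizable_eq_ex_ltl:
  assumes inf: "infinite (UNIV :: 'ap set)" and L: "recognizable L" and P: "finite (P :: 'ap set)"
  obtains ps \<psi> where "distinct ps" "set ps \<inter> P = {}" "ltl_props \<psi> - set ps = P"
    "\<And>w. (\<And>t. w t \<subseteq> P) \<Longrightarrow> w \<in> L \<longleftrightarrow> (\<exists>y. (\<forall>t. y t - set ps = w t) \<and> ltl_sem y \<psi>)"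
proof -
  obtain \<tau> :: "'ap set list \<Rightarrow> nat" where \<tau>: "congr_type \<tau>" "saturates \<tau> L"
    using L unfolding recognizable_def by blast
  define S where "S = range \<tau>"
  have S: "finite S" "\<And>u. \<tau> u \<in> S" using \<tau>(1) by (auto simp: S_def congr_type_def)
  define G where "G = good_types \<tau> L \<inter> S \<times> S"
  have G: "finite G" using S(1) by (simp add: G_def)
  obtain fresh :: "nat \<Rightarrow> 'ap" where fresh: "inj fresh" "range fresh \<subseteq> - P"
    using infinite_countable_subset[of "- P"] inf P by (metis Diff_infinite_finite Compl_eq_Diff_UNIV)
  define c where "c = fresh 0"
  define x where "x s = fresh (Suc s)" for s
  have cx: "c \<notin> P" "x s \<notin> P" "x s \<noteq> c" "c \<noteq> x s" "x s = x s' \<longleftrightarrow> s = s'" for s s'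
    using fresh by (auto simp: c_def x_def inj_eq)
  obtain ps where ps: "distinct ps" "set ps = insert c (x ` S)"
    using finite_distinct_list[of "insert c (x ` S)"] S(1) by auto
  define Q where "Q = P \<union> set ps"
  have inQ: "c \<in> Q" "s \<in> S \<Longrightarrow> x s \<in> Q" "p \<in> P \<Longrightarrow> p \<in> Q" for s p by (auto simp: Q_def ps)
  \<comment> \<open>The transition function of a finite automaton whose states are the types of the
    words read so far.\<close>
  define \<delta> where "\<delta> s a = \<tau> ((SOME u. \<tau> u = s) @ [a])" for s a
  have \<delta>: "\<delta> (\<tau> u) a = \<tau> (u @ [a])" for u a
    unfolding \<delta>_def by (rule congr_typeD[OF \<tau>(1)]) (auto intro: someI[of "\<lambda>y. \<tau> y = \<tau> u"])
  have \<delta>_S: "\<delta> s a \<in> S" for s a by (simp add: \<delta>_def S)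
  define letter where "letter a y \<longleftrightarrow> (\<forall>p\<in>P. p \<in> y 0 \<longleftrightarrow> p \<in> a)" for a and y :: "nat \<Rightarrow> 'ap set"
  define start where "start y \<longleftrightarrow> (\<forall>a\<in>Pow P. letter a y \<longrightarrow> c \<in> y 0 \<longrightarrow> x (\<tau> [a]) \<in> y 0)" for y :: "nat \<Rightarrow> 'ap set"
  define step where "step y \<longleftrightarrow> (\<forall>a\<in>Pow P. \<forall>s\<in>S. letter a (\<lambda>t. y (Suc t)) \<longrightarrow> \<not> c \<in> y (Suc 0) \<longrightarrow>
      x s \<in> y 0 \<longrightarrow> x (\<delta> s a) \<in> y (Suc 0))" for y
  define uniq where "uniq y \<longleftrightarrow> (\<forall>s\<in>S. \<forall>s'\<in>S. x s \<in> y 0 \<longrightarrow> x s' \<in> y 0 \<longrightarrow> s = s')" for y :: "nat \<Rightarrow> 'ap set"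
  \<comment> \<open>A mark at the next position means that a segment ends here, so the label found
    here is the type of the entire segment.\<close>
  define cut where "cut e y \<longleftrightarrow> (c \<in> y (Suc 0) \<longrightarrow> x e \<in> y 0)" for e y
  define first where "first m e y \<longleftrightarrow> x m \<in> y 0 \<and> c \<in> y (Suc 0) \<and> (\<forall>i. cut e (\<lambda>t. y (Suc (t + i))))" for m e y
  \<comment> \<open>The witness \<open>j\<close> is the last position of the first segment:
    \<open>Suc j\<close> carries the first mark after position 0.\<close>
  define acc where "acc y \<longleftrightarrow> (\<exists>me\<in>G. \<exists>j. first (fst me) (snd me) (\<lambda>t. y (t + j)) \<and>
      (\<forall>i<j. \<not> c \<in> y (Suc i)))" for y
  define \<Phi> where "\<Phi> y \<longleftrightarrow> c \<in> y 0 \<and> (\<forall>j. start (\<lambda>t. y (t + j))) \<and> (\<forall>j. step (\<lambda>t. y (t + j)))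
    \<and> (\<forall>j. uniq (\<lambda>t. y (t + j))) \<and> (\<forall>j. \<exists>i. c \<in> y (i + j)) \<and> acc y" for y
  have x0: "expressible Q (\<lambda>y. x s \<in> y 0)" if "s \<in> S" for s by (rule expressible_prop) (rule inQ that)+
  have x1: "expressible Q (\<lambda>y. x s \<in> y (Suc 0))" if "s \<in> S" for s using expressible_next[OF x0[OF that]] .
  have c0: "expressible Q (\<lambda>y. c \<in> y 0)" by (rule expressible_prop) (rule inQ)
  have c1: "expressible Q (\<lambda>y. c \<in> y (Suc 0))" using expressible_next[OF c0] .
  have "expressible Q (letter a)" for a
    unfolding letter_def using P by (intro expressible_ball expressible_iff expressible_prop inQ)
  then have l: "expressible Q (letter a)" "expressible Q (\<lambda>y. letter a (\<lambda>t. y (Suc t)))" for a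
    by (auto intro: expressible_next)
  have "expressible Q start" unfolding start_def
    using P S by (intro expressible_ball expressible_imp l c0 x0) auto
  moreover have "expressible Q step" unfolding step_def
    using P S(1) \<delta>_S by (intro expressible_ball expressible_imp expressible_not l c1 x0 x1) auto
  moreover have "expressible Q uniq" unfolding uniq_def
    using S(1) by (intro expressible_ball expressible_imp expressible_const x0) auto
  moreover have "expressible Q (cut e)" if "e \<in> S" for e unfolding cut_def
    using that by (intro expressible_imp c1 x0)
  then have "expressible Q (\<lambda>y. \<forall>i. cut e (\<lambda>t. y (Suc (t + i))))" if "e \<in> S" for e
    using expressible_next[OF expressible_always[of Q "cut e"]] that by simp
  then have "expressible Q (first m e)" if "m \<in> S" "e \<in> S" for m e unfolding first_def
    using that by (intro expressible_conj x0 c1)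
  then have "expressible Q (\<lambda>y. \<exists>j. first m e (\<lambda>t. y (t + j)) \<and> (\<forall>i<j. \<not> c \<in> y (Suc i)))"
    if "m \<in> S" "e \<in> S" for m e
    using expressible_until[OF expressible_not[OF c1], of "first m e"] that by simp
  then have "expressible Q acc" unfolding acc_def
    using G by (intro expressible_bex) (auto simp: G_def)
  moreover have "expressible Q (\<lambda>y. \<forall>j. \<exists>i. c \<in> y (i + j))"
    using expressible_always[OF expressible_eventually[OF c0]] by (simp add: ac_simps)
  ultimately have "expressible Q (\<lambda>y. \<forall>j. start (\<lambda>t. y (t + j)))"
    "expressible Q (\<lambda>y. \<forall>j. step (\<lambda>t. y (t + j)))" "expressible Q (\<lambda>y. \<forall>j. uniq (\<lambda>t. y (t + j)))"
    "expressible Q acc" "expressible Q (\<lambda>y. \<forall>j. \<exists>i. c \<in> y (i + j))"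
    by (auto intro: expressible_always)
  then have "expressible Q \<Phi>" unfolding \<Phi>_def
    using c0 by (intro expressible_conj) assumption+
  then obtain \<psi>0 where \<psi>0: "ltl_props \<psi>0 \<subseteq> Q" "\<And>w. ltl_sem w \<psi>0 \<longleftrightarrow> \<Phi> w" unfolding expressible_def by blast
  obtain pl where pl: "set pl = P" using finite_list[OF P] by blast
  \<comment> \<open>Tautologies make every proposition of \<open>P\<close> occur, since the free
    propositions have to be exactly \<open>P\<close>.\<close>
  define \<psi> where "\<psi> = foldr (\<lambda>p. LAnd (LOr (LProp p) (LNot (LProp p)))) pl \<psi>0"
  have "ltl_props (foldr (\<lambda>p. LAnd (LOr (LProp p) (LNot (LProp p)))) l \<psi>0) = set l \<union> ltl_props \<psi>0"
    "ltl_sem w (foldr (\<lambda>p. LAnd (LOr (LProp p) (LNot (LProp p)))) l \<psi>0) \<longleftrightarrow> ltl_sem w \<psi>0" for l w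
    by (induction l) auto
  then have \<psi>: "ltl_props \<psi> = P \<union> ltl_props \<psi>0" "\<And>w. ltl_sem w \<psi> \<longleftrightarrow> \<Phi> w"
    using \<psi>0 pl by (auto simp: \<psi>_def)
  have disj: "set ps \<inter> P = {}" using cx by (auto simp: ps)
  show ?thesis
  proof (rule that)
    show "distinct ps" "set ps \<inter> P = {}" by fact+
    show "ltl_props \<psi> - set ps = P" using \<psi>(1) \<psi>0(1) disj by (auto simp: Q_def)
    fix w :: "nat \<Rightarrow> 'ap set" assume w: "\<And>t. w t \<subseteq> P"
    show "w \<in> L \<longleftrightarrow> (\<exists>y. (\<forall>t. y t - set ps = w t) \<and> ltl_sem y \<psi>)"
    proof
      assume "w \<in> L"
      obtain f me where f: "ultimate_types \<tau> w f me" using ultimate_factoring[OF \<tau>(1)] by blast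
      then have fac: "factoring f" and f0: "\<tau> (seg w f 0) = fst me" and fS: "\<And>i. \<tau> (seg w f (Suc i)) = snd me"
        unfolding ultimate_types_def by auto
      have me: "me \<in> G"
        using good_types_iff[OF \<tau>(2) f] \<open>w \<in> L\<close> f0 fS[of 0] S(2) by (auto simp: G_def mem_Times_iff) (metis S(2))+
      define y where "y t = w t \<union> {p. p = c \<and> t \<in> range f}
          \<union> {x s |s. \<exists>k. f k \<le> t \<and> t < f (Suc k) \<and> s = \<tau> (sub w (f k) (Suc t))}" for t
      have yP: "p \<in> y t \<longleftrightarrow> p \<in> w t" if "p \<in> P" for p t using that cx by (auto simp: y_def)
      have yc: "c \<in> y t \<longleftrightarrow> t \<in> range f" for t using cx w[of t] by (auto simp: y_def)
      have yx: "x s \<in> y t \<longleftrightarrow> (\<exists>k. f k \<le> t \<and> t < f (Suc k) \<and> s = \<tau> (sub w (f k) (Suc t)))" for s t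
        using cx w[of t] by (auto simp: y_def)
      have letter: "letter a (\<lambda>t. y (t + j)) \<longleftrightarrow> w j = a" if "a \<subseteq> P" for a j
        using that w[of j] by (auto simp: letter_def yP)
      have letter': "letter a (\<lambda>t. y (Suc (t + j))) \<longleftrightarrow> w (Suc j) = a" if "a \<subseteq> P" for a j
        using letter[OF that, of "Suc j"] by simp
      have start: "start (\<lambda>t. y (t + j))" for j
        unfolding start_def
      proof (intro ballI impI)
        fix a assume "a \<in> Pow P" "letter a (\<lambda>t. y (t + j))" "c \<in> y (0 + j)"
        then obtain k where "w j = a" "j = f k" using letter yc by auto
        then show "x (\<tau> [a]) \<in> y (0 + j)"
          using factoring_less[OF fac, of k] by (auto simp: yx sub_Suc intro!: exI[of _ k])
      qed
      have no_cut: "f k \<le> j \<Longrightarrow> j < f (Suc k) \<Longrightarrow> Suc j \<notin> range f \<Longrightarrow> Suc j < f (Suc k)" for j k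
        by (metis Suc_lessI rangeI)
      have step: "step (\<lambda>t. y (t + j))" for j
        unfolding step_def
      proof (intro ballI impI)
        fix a s assume "a \<in> Pow P" "letter a (\<lambda>t. y (Suc t + j))" "\<not> c \<in> y (Suc 0 + j)" "x s \<in> y (0 + j)"
        then obtain k where a: "w (Suc j) = a" "Suc j \<notin> range f" and k: "f k \<le> j" "j < f (Suc k)"
          "s = \<tau> (sub w (f k) (Suc j))" using letter' yc yx by auto
        have "\<delta> s a = \<tau> (sub w (f k) (Suc (Suc j)))" using k a by (simp add: \<delta> sub_Suc)
        then show "x (\<delta> s a) \<in> y (Suc 0 + j)"
          using no_cut[OF k(1,2) a(2)] k(1) by (auto simp: yx intro!: exI[of _ k])
      qed
      have uniq: "uniq (\<lambda>t. y (t + j))" for j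
        unfolding uniq_def
      proof (intro ballI impI)
        fix s s' assume "x s \<in> y (0 + j)" "x s' \<in> y (0 + j)"
        then obtain k k' where k: "f k \<le> j" "j < f (Suc k)" "s = \<tau> (sub w (f k) (Suc j))"
          and k': "f k' \<le> j" "j < f (Suc k')" "s' = \<tau> (sub w (f k') (Suc j))" by (auto simp: yx)
        show "s = s'" using factoring_unique[OF fac k(1,2) k'(1,2)] k(3) k'(3) by simp
      qed
      have last: "x (\<tau> (seg w f k)) \<in> y (f (Suc k) - 1)" for k
        using factoring_less[OF fac, of k] by (auto simp: yx intro!: exI[of _ k])
      have "acc y" unfolding acc_def
      proof (intro bexI[OF _ me] exI[of _ "f (Suc 0) - 1"] conjI allI impI)
        have p: "f 0 = 0" "f 0 < f (Suc 0)" using fac factoring_less[OF fac, of 0] by (auto simp: factoring_def)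
        have "cut (snd me) (\<lambda>t. y (Suc (t + i + (f (Suc 0) - 1))))" for i
          unfolding cut_def
        proof
          let ?j = "Suc (0 + i + (f (Suc 0) - 1))"
          assume "c \<in> y (Suc (Suc 0 + i + (f (Suc 0) - 1)))"
          then obtain k where k: "Suc ?j = f k" using yc by auto
          then have "f (Suc 0) < f k" using p by simp
          then have "\<not> k \<le> Suc 0" using factoring_le[OF fac, of k "Suc 0"] by linarith
          then obtain k' where k': "k = Suc (Suc k')" by (metis not_less_eq_eq Suc_le_D Suc_le_mono le0)
          then have "x (\<tau> (seg w f (Suc k'))) \<in> y ?j" using last[of "Suc k'"] k by (metis diff_Suc_1)
          then show "x (snd me) \<in> y ?j" using fS by simp
        qed
        then show "first (fst me) (snd me) (\<lambda>t. y (t + (f (Suc 0) - 1)))"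
          unfolding first_def using last[of 0] f0 p by (simp add: yc)
        fix i assume i: "i < f (Suc 0) - 1"
        show "\<not> c \<in> y (Suc i)"
        proof
          assume "c \<in> y (Suc i)"
          then obtain k where k: "Suc i = f k" using yc by auto
          then have "k \<noteq> 0" using p by (metis nat.distinct(1))
          then have "f (Suc 0) \<le> f k" by (intro factoring_le[OF fac]) simp
          then show False using i k by simp
        qed
      qed
      moreover have "\<exists>i. c \<in> y (i + j)" for j
        using factoring_ge[OF fac, of j] by (intro exI[of _ "f j - j"]) (simp add: yc)
      moreover have "c \<in> y 0" using fac unfolding yc factoring_def by (metis rangeI)
      ultimately have "\<Phi> y" unfolding \<Phi>_def using start step uniq by blast
      moreover have "y t - set ps = w t" for t
        using w[of t] disj S(2) by (auto simp: y_def ps)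
      ultimately show "\<exists>y. (\<forall>t. y t - set ps = w t) \<and> ltl_sem y \<psi>" using \<psi>(2) by blast
    next
      assume "\<exists>y. (\<forall>t. y t - set ps = w t) \<and> ltl_sem y \<psi>"
      then obtain y where yw: "\<And>t. y t - set ps = w t" and \<Phi>: "\<Phi> y" using \<psi>(2) by blast
      have yP: "p \<in> y t \<longleftrightarrow> p \<in> w t" if "p \<in> P" for p t using that yw[of t] disj by auto
      have letter: "letter (w j) (\<lambda>t. y (t + j))" for j by (simp add: letter_def yP)
      have start: "c \<in> y j \<Longrightarrow> x (\<tau> [w j]) \<in> y j" for j
        using \<Phi> letter[of j] w[of j] unfolding \<Phi>_def start_def by (metis Pow_iff add_0)
      have step: "x (\<delta> s (w (Suc j))) \<in> y (Suc j)" if "s \<in> S" "x s \<in> y j" "c \<notin> y (Suc j)" for s j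
        using \<Phi> letter[of "Suc j"] w[of "Suc j"] that unfolding \<Phi>_def step_def by auto
      have uniq: "s = s'" if "x s \<in> y j" "x s' \<in> y j" "s \<in> S" "s' \<in> S" for s s' j
        using \<Phi> that unfolding \<Phi>_def uniq_def by (metis add_0)
      obtain m e j where me: "(m, e) \<in> G" and j: "x m \<in> y j" "c \<in> y (Suc j)" "\<And>i. i < j \<Longrightarrow> c \<notin> y (Suc i)"
        and e: "\<And>i. c \<in> y (Suc (Suc (i + j))) \<Longrightarrow> x e \<in> y (Suc (i + j))"
        using \<Phi> unfolding \<Phi>_def acc_def first_def cut_def by auto
      define K where "K = {t. c \<in> y t}"
      have "\<exists>n>k. n \<in> K" for k
      proof -
        obtain i where "c \<in> y (i + Suc k)" using \<Phi> unfolding \<Phi>_def by blast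
        then show ?thesis by (intro exI[of _ "i + Suc k"]) (simp add: K_def)
      qed
      then have K: "infinite K" "0 \<in> K"
        using \<Phi> by (auto simp: K_def \<Phi>_def infinite_nat_iff_unbounded)
      define f where "f = enumerate K"
      have fac: "factoring f" unfolding f_def by (rule factoring_enumerate[OF K])
      have fK: "c \<in> y (f k)" for k using enumerate_in_set[OF K(1), of k] by (simp add: f_def K_def)
      have nxt: "f (Suc n) \<le> k" if "c \<in> y k" "f n < k" for n k
        using that enumerate_next_le[OF K(1)] by (simp add: f_def K_def)
      \<comment> \<open>\<open>start\<close> and \<open>step\<close> only force the correct label to
        be present; \<open>uniq\<close> later excludes any other label of \<open>S\<close>.\<close>
      have seg_type: "x (\<tau> (sub w (f n) (Suc (f n + d)))) \<in> y (f n + d)" if "f n + d < f (Suc n)" for n d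
        using that
      proof (induction d)
        case 0 then show ?case using start[OF fK[of n]] by (simp add: sub_Suc)
      next
        case (Suc d)
        have "c \<notin> y (Suc (f n + d))" using nxt[of "Suc (f n + d)" n] Suc(2) by auto
        then have "x (\<delta> (\<tau> (sub w (f n) (Suc (f n + d)))) (w (Suc (f n + d)))) \<in> y (Suc (f n + d))"
          using Suc S(2) by (intro step) auto
        then show ?case by (simp add: \<delta> sub_Suc)
      qed
      have last: "x (\<tau> (seg w f n)) \<in> y (f (Suc n) - 1)" for n
        using seg_type[of n "f (Suc n) - 1 - f n"] factoring_less[OF fac, of n] by simp
      have SS: "m \<in> S" "e \<in> S" using me by (auto simp: G_def)
      have p: "f 0 = 0" "0 < f (Suc 0)" using fac factoring_less[OF fac, of 0] by (auto simp: factoring_def)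
      have "f (Suc 0) \<le> Suc j" using nxt[of "Suc j" 0] j(2) p by simp
      moreover have "\<not> f (Suc 0) - 1 < j" using j(3)[of "f (Suc 0) - 1"] fK[of "Suc 0"] p by auto
      ultimately have f1: "f (Suc 0) = Suc j" using p by simp
      have "\<tau> (seg w f 0) = m" using uniq[OF _ j(1) S(2) SS(1)] last[of 0] f1 by simp
      moreover have "\<tau> (seg w f (Suc n)) = e" for n
      proof -
        have "f (Suc 0) < f (Suc (Suc n))"
          using factoring_le[OF fac, of "Suc 0" "Suc n"] factoring_less[OF fac, of "Suc n"] by simp
        then obtain i where i: "f (Suc (Suc n)) = Suc (Suc (i + j))"
          using f1 less_imp_Suc_add[of "Suc j" "f (Suc (Suc n))"] by (auto simp: ac_simps)
        then have "x e \<in> y (Suc (i + j))" using e fK[of "Suc (Suc n)"] by simp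
        then show ?thesis using uniq[OF _ _ S(2) SS(2)] last[of "Suc n"] i by auto
      qed
      ultimately have "ultimate_types \<tau> w f (m, e)" unfolding ultimate_types_def using fac by simp
      then show "w \<in> L" using good_types_iff[OF \<tau>(2)] me by (simp add: G_def)
    qed
  qed
qed

section \<open>Existential prefixes in the Tarski and the behavioral semantics\<close>

lemma asg_word_upd: "asg_word (\<chi>(p \<mapsto> f)) t = asg_word \<chi> t - {p} \<union> {q. q = p \<and> f t}"
  by (auto simp: asg_word_def)

lemma qsat_exs:
  "qsat \<chi> (foldr QEx ps (QLtl \<psi>)) \<longleftrightarrow>
    (\<exists>y. (\<forall>t. y t - set ps = asg_word \<chi> t - set ps) \<and> ltl_sem y \<psi>)"
proof (induction ps arbitrary: \<chi>)
  case Nil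
  have "(\<forall>t. y t = asg_word \<chi> t) \<longleftrightarrow> y = asg_word \<chi>" for y by auto
  then show ?case by (simp add: ltl_models_def)
next
  case (Cons p ps)
  have *: "(\<exists>f. \<forall>t. y t - set ps = asg_word (\<chi>(p \<mapsto> f)) t - set ps) \<longleftrightarrow>
      (\<forall>t. y t - set (p # ps) = asg_word \<chi> t - set (p # ps))" for y
  proof
    assume "\<forall>t. y t - set (p # ps) = asg_word \<chi> t - set (p # ps)"
    then have "y t - set ps = asg_word (\<chi>(p \<mapsto> (\<lambda>t. p \<in> y t))) t - set ps" for t
      unfolding asg_word_upd by (auto simp: set_eq_iff)
    then show "\<exists>f. \<forall>t. y t - set ps = asg_word (\<chi>(p \<mapsto> f)) t - set ps" by blast
  next
    assume "\<exists>f. \<forall>t. y t - set ps = asg_word (\<chi>(p \<mapsto> f)) t - set ps"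
    then obtain f where f: "y t - set ps = asg_word (\<chi>(p \<mapsto> f)) t - set ps" for t by blast
    have "y t - set (p # ps) = asg_word \<chi> t - set (p # ps)" for t
      using f[of t] unfolding asg_word_upd by (simp add: set_eq_iff) blast
    then show "\<forall>t. y t - set (p # ps) = asg_word \<chi> t - set (p # ps)" by blast
  qed
  have "qsat \<chi> (foldr QEx (p # ps) (QLtl \<psi>)) \<longleftrightarrow>
      (\<exists>f y. (\<forall>t. y t - set ps = asg_word (\<chi>(p \<mapsto> f)) t - set ps) \<and> ltl_sem y \<psi>)"
    by (simp only: foldr.simps o_apply qsat.simps Cons)
  also have "\<dots> \<longleftrightarrow> (\<exists>y. (\<exists>f. \<forall>t. y t - set ps = asg_word (\<chi>(p \<mapsto> f)) t - set ps) \<and> ltl_sem y \<psi>)"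
    by blast
  finally show ?case unfolding * .
qed

lemma qfree_exs: "qfree (foldr QEx ps (QLtl \<psi>)) = ltl_props \<psi> - set ps"
  by (induction ps) auto

text \<open>On a single assignment a functor contributes just one valuation, and constant functors,
  which are behavioral, already provide all of them.\<close>

lemma extB_singletons:
  assumes "\<And>X. X \<in> \<X> \<Longrightarrow> \<exists>\<chi>. X = {\<chi>}"
  shows "extB \<X> p = {{\<chi>(p \<mapsto> f)} |\<chi> f. {\<chi>} \<in> \<X>}"
proof (intro set_eqI iffI)
  fix Y assume "Y \<in> extB \<X> p"
  then obtain X F where Y: "Y = ext X F p" "X \<in> \<X>" unfolding extB_def by blast
  moreover obtain \<chi> where "X = {\<chi>}" using assms[OF Y(2)] by blast
  ultimately show "Y \<in> {{\<chi>(p \<mapsto> f)} |\<chi> f. {\<chi>} \<in> \<X>}" unfolding ext_def by auto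
next
  fix Y assume "Y \<in> {{\<chi>(p \<mapsto> f)} |\<chi> f. {\<chi>} \<in> \<X>}"
  then obtain \<chi> f where Y: "Y = {\<chi>(p \<mapsto> f)}" "{\<chi>} \<in> \<X>" by blast
  have "(\<lambda>_. f) \<in> FncB (hyp_ap \<X>)" by (simp add: FncB_def behavioral_def)
  moreover have "Y = ext {\<chi>} (\<lambda>_. f) p" using Y by (simp add: ext_def)
  ultimately show "Y \<in> extB \<X> p" unfolding extB_def using Y by blast
qed

text \<open>Stated for families of singletons because \<open>extB\<close> turns one singleton into
  such a family; the induction stays within them.\<close>

lemma gfg_sem_exs:
  assumes "\<And>X. X \<in> \<X> \<Longrightarrow> \<exists>\<chi>. X = {\<chi>}"
  shows "gfg_sem EA \<X> (map (Pair QE) ps) \<psi> \<longleftrightarrow> (\<exists>\<chi>. {\<chi>} \<in> \<X> \<and> qsat \<chi> (foldr QEx ps (QLtl \<psi>)))"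
  using assms
proof (induction ps arbitrary: \<X>)
  case Nil
  show ?case
  proof
    assume "gfg_sem EA \<X> (map (Pair QE) []) \<psi>"
    then obtain X where "X \<in> \<X>" "\<forall>\<chi>\<in>X. ltl_models \<chi> \<psi>" by auto
    then show "\<exists>\<chi>. {\<chi>} \<in> \<X> \<and> qsat \<chi> (foldr QEx [] (QLtl \<psi>))" using Nil by fastforce
  qed auto
next
  case (Cons p ps)
  have ext: "extB \<X> p = {{\<chi>(p \<mapsto> f)} |\<chi> f. {\<chi>} \<in> \<X>}" by (rule extB_singletons[OF Cons(2)])
  have "gfg_sem EA (extB \<X> p) (map (Pair QE) ps) \<psi> \<longleftrightarrow>
      (\<exists>\<chi>. {\<chi>} \<in> extB \<X> p \<and> qsat \<chi> (foldr QEx ps (QLtl \<psi>)))"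
    by (rule Cons(1)) (auto simp: ext)
  then show ?case by (auto simp: ext)
qed

section \<open>QPTL-definable languages are recognizable\<close>

definition project_out :: "'ap \<Rightarrow> (nat \<Rightarrow> 'ap set) set \<Rightarrow> (nat \<Rightarrow> 'ap set) set" where
  "project_out p L = {w. \<exists>w'. (\<forall>t. w t - {p} = w' t - {p}) \<and> w' \<in> L}"

lemma asg_word_project_out: "asg_word \<chi> \<in> project_out p L \<longleftrightarrow> (\<exists>f. asg_word (\<chi>(p \<mapsto> f)) \<in> L)"
proof
  assume "asg_word \<chi> \<in> project_out p L"
  then obtain w where w: "\<And>t. asg_word \<chi> t - {p} = w t - {p}" "w \<in> L" unfolding project_out_def by blast
  have "asg_word (\<chi>(p \<mapsto> (\<lambda>t. p \<in> w t))) = w" using w(1) by (auto simp: asg_word_upd fun_eq_iff set_eq_iff)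
  then show "\<exists>f. asg_word (\<chi>(p \<mapsto> f)) \<in> L" using w(2) by metis
next
  assume "\<exists>f. asg_word (\<chi>(p \<mapsto> f)) \<in> L"
  then obtain f where "asg_word (\<chi>(p \<mapsto> f)) \<in> L" by blast
  then show "asg_word \<chi> \<in> project_out p L"
    unfolding project_out_def by (auto simp: asg_word_upd intro!: exI[of _ "asg_word (\<chi>(p \<mapsto> f))"])
qed

lemma recognizable_project_out: "recognizable L \<Longrightarrow> recognizable (project_out p L)"
  unfolding project_out_def by (rule recognizable_proj)

lemma recognizable_qptl: "\<exists>L. recognizable L \<and> (\<forall>\<chi>. qsat \<chi> \<phi> \<longleftrightarrow> asg_word \<chi> \<in> L)"
proof (induction \<phi>)
  case (QLtl \<psi>)
  show ?case by (rule exI[of _ "{w. ltl_sem w \<psi>}"]) (simp add: recognizable_ltl ltl_models_def)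
next
  case (QNot \<phi>)
  then show ?case using recognizable_Compl by (metis ComplD ComplI qsat.simps(2))
next
  case (QAnd \<phi>1 \<phi>2)
  then show ?case using recognizable_Int by (metis IntD1 IntD2 IntI qsat.simps(3))
next
  case (QOr \<phi>1 \<phi>2)
  then show ?case using recognizable_Un by (metis UnE UnI1 UnI2 qsat.simps(4))
next
  case (QEx p \<phi>)
  then obtain L where "recognizable L" "\<forall>\<chi>. qsat \<chi> \<phi> \<longleftrightarrow> asg_word \<chi> \<in> L" by blast
  then show ?case
    by (intro exI[of _ "project_out p L"]) (simp add: recognizable_project_out asg_word_project_out)
next
  case (QAll p \<phi>)
  then obtain L where "recognizable L" "\<forall>\<chi>. qsat \<chi> \<phi> \<longleftrightarrow> asg_word \<chi> \<in> L" by blast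
  then show ?case
    using asg_word_project_out[of _ p "- L"]
    by (intro exI[of _ "- project_out p (- L)"]) (simp add: recognizable_project_out recognizable_Compl)
qed

lemma finite_ltl_props: "finite (ltl_props \<psi>)"
  by (induction \<psi>) auto

lemma finite_qfree: "finite (qfree \<phi>)"
  by (induction \<phi>) (auto simp: finite_ltl_props)

lemma asg_word_dom: "\<chi> \<in> Asg P \<Longrightarrow> asg_word \<chi> t \<subseteq> P"
  by (auto simp: Asg_def asg_word_def)

lemma recognizable_ex_ltl_asg:
  assumes "infinite (UNIV :: 'ap set)" "recognizable L" "finite (P :: 'ap set)"
  obtains ps \<psi> where "distinct ps" "ltl_props \<psi> - set ps = P"
    "\<And>\<chi>. \<chi> \<in> Asg P \<Longrightarrow> qsat \<chi> (foldr QEx ps (QLtl \<psi>)) \<longleftrightarrow> asg_word \<chi> \<in> L"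
proof -
  obtain ps \<psi> where *: "distinct ps" "set ps \<inter> P = {}" "ltl_props \<psi> - set ps = P"
    "\<And>w. (\<And>t. w t \<subseteq> P) \<Longrightarrow> w \<in> L \<longleftrightarrow> (\<exists>y. (\<forall>t. y t - set ps = w t) \<and> ltl_sem y \<psi>)"
    by (rule recognizable_eq_ex_ltl[OF assms]) blast
  show ?thesis
  proof (rule that[OF *(1,3)])
    fix \<chi> :: "'ap asg" assume "\<chi> \<in> Asg P"
    then have sub: "asg_word \<chi> t \<subseteq> P" for t by (rule asg_word_dom)
    then have "asg_word \<chi> t - set ps = asg_word \<chi> t" for t using *(2) by blast
    then show "qsat \<chi> (foldr QEx ps (QLtl \<psi>)) \<longleftrightarrow> asg_word \<chi> \<in> L"
      using *(4)[of "asg_word \<chi>"] sub by (simp add: qsat_exs)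
  qed
qed

section \<open>Behavioral quantification as a game\<close>

text \<open>The semantics with an arbitrary target set in place of a formula: eliminating the last
  quantifier leads to targets \<open>{\<chi>. \<chi>(p \<mapsto> F \<chi>) \<in> W}\<close>, which
  need not come from LTL.\<close>

fun hsem :: "flag \<Rightarrow> 'ap hyperasg \<Rightarrow> (quant \<times> 'ap) list \<Rightarrow> 'ap asg set \<Rightarrow> bool" where
  "hsem EA \<X> [] W = (\<exists>X\<in>\<X>. X \<subseteq> W)"
| "hsem AE \<X> [] W = (\<forall>X\<in>\<X>. \<exists>\<chi>\<in>X. \<chi> \<in> W)"
| "hsem EA \<X> ((QE, p) # qs) W = hsem EA (extB \<X> p) qs W"
| "hsem AE \<X> ((QE, p) # qs) W = hsem EA (extB (dual \<X>) p) qs W"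
| "hsem AE \<X> ((QA, p) # qs) W = hsem AE (extB \<X> p) qs W"
| "hsem EA \<X> ((QA, p) # qs) W = hsem AE (extB (dual \<X>) p) qs W"

lemma gfg_sem_hsem: "gfg_sem fl \<X> qs \<psi> \<longleftrightarrow> hsem fl \<X> qs {\<chi>. ltl_models \<chi> \<psi>}"
  by (induction fl \<X> qs \<psi> rule: gfg_sem.induct) auto

fun flip_quant :: "quant \<Rightarrow> quant" where
  "flip_quant QE = QA"
| "flip_quant QA = QE"

fun flip_flag :: "flag \<Rightarrow> flag" where
  "flip_flag EA = AE"
| "flip_flag AE = EA"

abbreviation flip :: "(quant \<times> 'ap) list \<Rightarrow> (quant \<times> 'ap) list" where
  "flip qs \<equiv> map (apfst flip_quant) qs"

lemma map_snd_flip [simp]: "map snd (flip qs) = map snd qs"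
  by simp

text \<open>The clauses for the two flags mirror each other, so universal quantifiers and
  refutations reduce to the existential case.\<close>

lemma hsem_flip: "hsem (flip_flag fl) \<X> (flip qs) (- W) \<longleftrightarrow> \<not> hsem fl \<X> qs W"
  by (induction fl \<X> qs W rule: hsem.induct) auto

definition hyper :: "'ap set \<Rightarrow> 'ap hyperasg \<Rightarrow> bool" where
  "hyper P \<X> \<longleftrightarrow> \<X> \<noteq> {} \<and> {} \<notin> \<X> \<and> \<X> \<subseteq> Pow (Asg P)"

lemma hyp_ap_hyper: assumes "hyper P \<X>" shows "hyp_ap \<X> = P"
proof -
  obtain X \<chi> where "X \<in> \<X>" "\<chi> \<in> X" using assms unfolding hyper_def by (metis all_not_in_conv)
  then have "\<exists>X\<in>\<X>. (SOME \<chi>. \<exists>X\<in>\<X>. \<chi> \<in> X) \<in> X" by (intro someI_ex[of "\<lambda>\<chi>. \<exists>X\<in>\<X>. \<chi> \<in> X"]) blast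
  then show ?thesis using assms unfolding hyp_ap_def hyper_def Asg_def by blast
qed

lemma hyper_dual: assumes "hyper P \<X>" shows "hyper P (dual \<X>)"
proof -
  have "is_choice \<X> (\<lambda>X. SOME \<chi>. \<chi> \<in> X)"
    using assms unfolding is_choice_def hyper_def by (metis some_in_eq)
  then have "dual \<X> \<noteq> {}" unfolding dual_def by blast
  then show ?thesis using assms unfolding hyper_def dual_def is_choice_def by auto
qed

lemma const_FncB: "(\<lambda>_. f) \<in> FncB P"
  by (simp add: FncB_def behavioral_def)

lemma hyper_extB: assumes "hyper P \<X>" shows "hyper (insert p P) (extB \<X> p)"
proof -
  have "extB \<X> p \<noteq> {}" using assms const_FncB unfolding extB_def hyper_def by fastforce
  moreover have "{} \<notin> extB \<X> p" using assms unfolding extB_def ext_def hyper_def by auto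
  moreover have "extB \<X> p \<subseteq> Pow (Asg (insert p P))"
  proof (rule subsetI, rule PowI, rule subsetI)
    fix Y v assume "Y \<in> extB \<X> p" "v \<in> Y"
    then obtain X F \<chi> where "X \<in> \<X>" "\<chi> \<in> X" "v = \<chi>(p \<mapsto> F \<chi>)" unfolding extB_def ext_def by blast
    moreover from this have "dom \<chi> = P" using assms unfolding hyper_def Asg_def by blast
    ultimately show "v \<in> Asg (insert p P)" by (simp add: Asg_def)
  qed
  ultimately show ?thesis by (simp add: hyper_def)
qed

text \<open>The functors of the last quantifier only read the propositions before it, so they can be
  quantified first: the semantics unfolds from the end of the prefix.\<close>

lemma hsem_snoc_QE:
  assumes "hyper P \<X>"
  shows "hsem fl \<X> (qs @ [(QE, p)]) W \<longleftrightarrow>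
    (\<exists>F\<in>FncB (P \<union> snd ` set qs). hsem fl \<X> qs {\<chi>. \<chi>(p \<mapsto> F \<chi>) \<in> W})"
  using assms
proof (induction qs arbitrary: fl \<X> P)
  case Nil
  have ext: "ext X F p \<subseteq> W \<longleftrightarrow> X \<subseteq> {\<chi>. \<chi>(p \<mapsto> F \<chi>) \<in> W}" for X F unfolding ext_def by auto
  have last: "hsem EA (extB \<Y> p) [] W \<longleftrightarrow> (\<exists>F\<in>FncB P. hsem EA \<Y> [] {\<chi>. \<chi>(p \<mapsto> F \<chi>) \<in> W})"
    if "hyper P \<Y>" for \<Y>
    unfolding hsem.simps ext[symmetric] extB_def hyp_ap_hyper[OF that] by blast
  show ?case
  proof (cases fl)
    case EA
    then show ?thesis using last[OF Nil]
      by (simp only: append_Nil hsem.simps(3) list.set image_empty Un_empty_right)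
  next
    case AE
    \<comment> \<open>Skolemization: selecting a good assignment from each member is a choice
      function, and its image is the required member of the dual.\<close>
    have dual: "hsem EA (dual \<X>) [] V \<longleftrightarrow> hsem AE \<X> [] V" for V
    proof
      assume "hsem AE \<X> [] V"
      then obtain c where "\<forall>X\<in>\<X>. c X \<in> X \<and> c X \<in> V" by (metis hsem.simps(2))
      then have "is_choice \<X> c" "c ` \<X> \<subseteq> V" unfolding is_choice_def by auto
      then show "hsem EA (dual \<X>) [] V" unfolding dual_def by auto
    qed (auto simp: dual_def is_choice_def)
    show ?thesis using AE last[OF hyper_dual[OF Nil]]
      by (simp only: dual append_Nil hsem.simps(4) list.set image_empty Un_empty_right)
  qed
next
  case (Cons a qs)
  obtain Q q where a: "a = (Q, q)" by (cases a)
  have *: "insert q P \<union> snd ` set qs = P \<union> snd ` set (a # qs)" by (auto simp: a)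
  note IH = Cons(1)[OF hyper_extB[OF Cons(2)], of _ q] Cons(1)[OF hyper_extB[OF hyper_dual[OF Cons(2)]], of _ q]
  show ?case by (cases fl; cases Q) (simp_all only: a append_Cons hsem.simps IH *[unfolded a])
qed

lemma hsem_snoc_QA:
  assumes "hyper P \<X>"
  shows "hsem fl \<X> (qs @ [(QA, p)]) W \<longleftrightarrow>
    (\<forall>F\<in>FncB (P \<union> snd ` set qs). hsem fl \<X> qs {\<chi>. \<chi>(p \<mapsto> F \<chi>) \<in> W})"
proof -
  have [simp]: "snd ` apfst flip_quant ` set qs = snd ` set qs" by (simp add: image_image)
  have "hsem fl \<X> (qs @ [(QA, p)]) W \<longleftrightarrow> \<not> hsem (flip_flag fl) \<X> (flip qs @ [(QE, p)]) (- W)"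
    using hsem_flip[of fl \<X> "qs @ [(QA, p)]" W] by simp
  also have "\<dots> \<longleftrightarrow> (\<forall>F\<in>FncB (P \<union> snd ` set qs).
      \<not> hsem (flip_flag fl) \<X> (flip qs) (- {\<chi>. \<chi>(p \<mapsto> F \<chi>) \<in> W}))"
    unfolding hsem_snoc_QE[OF assms] by (simp add: Collect_neg_eq)
  finally show ?thesis using hsem_flip by blast
qed

text \<open>Behaviorality constrains one proposition at a time, so the finitely many differing
  propositions are exchanged one after another.\<close>

lemma FncB_agree:
  assumes F: "F \<in> FncB P" and v: "v \<in> Asg P" "v' \<in> Asg P"
    and fin: "finite {q\<in>P. v q \<noteq> v' q}"
    and agree: "\<And>q s. q \<in> P \<Longrightarrow> s \<le> t \<Longrightarrow> the (v q) s = the (v' q) s"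
  shows "F v t = F v' t"
proof -
  define D where "D = {q\<in>P. v q \<noteq> v' q}"
  have "F v t = F u t" if "finite A" "A \<subseteq> P" "u = (\<lambda>q. if q \<in> A then v' q else v q)" for A u
    using that
  proof (induction A arbitrary: u rule: finite_induct)
    case (insert a A)
    define u' where "u' = (\<lambda>q. if q \<in> A then v' q else v q)"
    have asg: "u \<in> Asg P" "u' \<in> Asg P"
      using v insert(4,5) unfolding Asg_def u'_def by (auto simp: dom_def set_eq_iff)
    have "agree_upto P a t u' u"
      unfolding agree_upto_def u'_def insert(5) using insert(2,4) agree by auto
    then have "F u' t = F u t"
      using F asg insert(4) unfolding FncB_def behavioral_def by blast
    then show ?case using insert(3)[OF _ u'_def] insert(4) by simp
  qed simp
  from this[of D "\<lambda>q. if q \<in> D then v' q else v q"]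
  have "F v t = F (\<lambda>q. if q \<in> D then v' q else v q) t" using fin by (auto simp: D_def)
  also have "(\<lambda>q. if q \<in> D then v' q else v q) = v'"
  proof
    fix q show "(if q \<in> D then v' q else v q) = v' q"
      using v by (cases "q \<in> P") (auto simp: D_def Asg_def domIff)
  qed
  finally show ?thesis .
qed

section \<open>Causal strategies and their conversion into functors\<close>

definition plays :: "'ap set \<Rightarrow> 'ap asg \<Rightarrow> 'ap set \<Rightarrow> 'ap asg set" where
  "plays P \<chi> A = {v. dom v = P \<union> A \<and> (\<forall>q\<in>P. v q = \<chi> q)}"

text \<open>Equality of what is known when the \<open>i\<close>-th proposition receives its value at
  time \<open>t\<close>: the whole past, and the present of the propositions quantified
  earlier.\<close>

definition agree_before :: "(quant \<times> 'ap) list \<Rightarrow> nat \<Rightarrow> nat \<Rightarrow> 'ap asg \<Rightarrow> 'ap asg \<Rightarrow> bool" where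
  "agree_before qs i t v v' \<longleftrightarrow>
     (\<forall>q\<in>snd ` set qs. \<forall>s<t. the (v q) s = the (v' q) s) \<and>
     (\<forall>j<i. the (v (snd (qs ! j))) t = the (v' (snd (qs ! j))) t)"

definition causal :: "'ap set \<Rightarrow> 'ap asg \<Rightarrow> (quant \<times> 'ap) list \<Rightarrow> ('ap \<Rightarrow> 'ap asg \<Rightarrow> tval) \<Rightarrow> bool" where
  "causal P \<chi> qs \<kappa> \<longleftrightarrow> (\<forall>i<length qs. fst (qs ! i) = QE \<longrightarrow>
     (\<forall>v\<in>plays P \<chi> (snd ` set qs). \<forall>v'\<in>plays P \<chi> (snd ` set qs). \<forall>t. agree_before qs i t v v' \<longrightarrow>
        \<kappa> (snd (qs ! i)) v t = \<kappa> (snd (qs ! i)) v' t))"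

definition consistent :: "(quant \<times> 'ap) list \<Rightarrow> ('ap \<Rightarrow> 'ap asg \<Rightarrow> tval) \<Rightarrow> 'ap asg \<Rightarrow> bool" where
  "consistent qs \<kappa> v \<longleftrightarrow> (\<forall>i<length qs. fst (qs ! i) = QE \<longrightarrow> the (v (snd (qs ! i))) = \<kappa> (snd (qs ! i)) v)"

definition causal_wins :: "'ap set \<Rightarrow> 'ap asg \<Rightarrow> (quant \<times> 'ap) list \<Rightarrow> 'ap asg set \<Rightarrow> bool" where
  "causal_wins P \<chi> qs W \<longleftrightarrow> (\<exists>\<kappa>. causal P \<chi> qs \<kappa> \<and>
     (\<forall>v\<in>plays P \<chi> (snd ` set qs). consistent qs \<kappa> v \<longrightarrow> v \<in> W))"

definition agree_upto_all :: "'ap set \<Rightarrow> nat \<Rightarrow> 'ap asg \<Rightarrow> 'ap asg \<Rightarrow> bool" where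
  "agree_upto_all A t v v' \<longleftrightarrow> (\<forall>q\<in>A. \<forall>s\<le>t. the (v q) s = the (v' q) s)"

lemma plays_upd: "v \<in> plays P \<chi> A \<Longrightarrow> p \<notin> P \<Longrightarrow> v(p \<mapsto> f) \<in> plays P \<chi> (insert p A)"
  unfolding plays_def by auto

lemma agree_before_snoc:
  assumes "p \<notin> snd ` set qs" "i \<le> length qs" "agree_before qs i t v v'" "\<And>s. s < t \<Longrightarrow> f s = f' s"
  shows "agree_before (qs @ [(Q, p)]) i t (v(p \<mapsto> f)) (v'(p \<mapsto> f'))"
proof -
  have "snd (qs ! j) \<noteq> p" if "j < i" for j
    using assms(1,2) that by (metis image_eqI less_le_trans nth_mem)
  then show ?thesis using assms unfolding agree_before_def by (auto simp: nth_append)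
qed

text \<open>With \<open>F\<close> fixed for the last proposition, the other responses recompute that
  proposition. They read it only at times below \<open>t\<close>, where \<open>F\<close> depends on
  values below \<open>t\<close>, so they stay causal. \<open>FE\<close> asks that an existential
  \<open>F\<close> reproduce the response of \<open>\<kappa>\<close>.\<close>

lemma causal_wins_snoc:
  assumes p: "p \<notin> P" "p \<notin> snd ` set qs"
    and \<kappa>: "causal P \<chi> (qs @ [(Q, p)]) \<kappa>"
    and win: "\<And>v. v \<in> plays P \<chi> (snd ` set (qs @ [(Q, p)])) \<Longrightarrow> consistent (qs @ [(Q, p)]) \<kappa> v \<Longrightarrow> v \<in> W"
    and F: "\<And>v v' t. v \<in> plays P \<chi> (snd ` set qs) \<Longrightarrow> v' \<in> plays P \<chi> (snd ` set qs) \<Longrightarrow>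
      agree_upto_all (snd ` set qs) t v v' \<Longrightarrow> F v t = F v' t"
    and FE: "\<And>v. Q = QE \<Longrightarrow> v \<in> plays P \<chi> (snd ` set qs) \<Longrightarrow> F v = \<kappa> p (v(p \<mapsto> F v))"
  shows "causal_wins P \<chi> qs {v. v(p \<mapsto> F v) \<in> W}"
proof -
  define \<kappa>' where "\<kappa>' q v = \<kappa> q (v(p \<mapsto> F v))" for q v
  have ins: "snd ` set (qs @ [(Q, p)]) = insert p (snd ` set qs)" by simp
  have neq: "snd (qs ! i) \<noteq> p" if "i < length qs" for i
    using p(2) that by (metis image_eqI nth_mem)
  have "causal P \<chi> qs \<kappa>'" unfolding causal_def
  proof (intro allI impI ballI)
    fix i v v' t
    assume i: "i < length qs" "fst (qs ! i) = QE"
      and v: "v \<in> plays P \<chi> (snd ` set qs)" "v' \<in> plays P \<chi> (snd ` set qs)"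
      and ag: "agree_before qs i t v v'"
    have "F v s = F v' s" if "s < t" for s
      using ag that by (intro F[OF v]) (auto simp: agree_before_def agree_upto_all_def)
    then have "agree_before (qs @ [(Q, p)]) i t (v(p \<mapsto> F v)) (v'(p \<mapsto> F v'))"
      using i ag by (intro agree_before_snoc p) auto
    moreover have "v(p \<mapsto> F v) \<in> plays P \<chi> (snd ` set (qs @ [(Q, p)]))"
      "v'(p \<mapsto> F v') \<in> plays P \<chi> (snd ` set (qs @ [(Q, p)]))"
      unfolding ins using v p(1) by (auto intro: plays_upd)
    ultimately show "\<kappa>' (snd (qs ! i)) v t = \<kappa>' (snd (qs ! i)) v' t"
      using \<kappa>[unfolded causal_def, rule_format, of i] i unfolding \<kappa>'_def by (simp add: nth_append)
  qed
  moreover have "v(p \<mapsto> F v) \<in> W"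
    if v: "v \<in> plays P \<chi> (snd ` set qs)" and con: "consistent qs \<kappa>' v" for v
  proof (rule win)
    show "v(p \<mapsto> F v) \<in> plays P \<chi> (snd ` set (qs @ [(Q, p)]))"
      unfolding ins using v p(1) by (rule plays_upd)
    show "consistent (qs @ [(Q, p)]) \<kappa> (v(p \<mapsto> F v))" unfolding consistent_def
    proof (intro allI impI)
      fix i assume i: "i < length (qs @ [(Q, p)])" "fst ((qs @ [(Q, p)]) ! i) = QE"
      show "the ((v(p \<mapsto> F v)) (snd ((qs @ [(Q, p)]) ! i))) = \<kappa> (snd ((qs @ [(Q, p)]) ! i)) (v(p \<mapsto> F v))"
      proof (cases "i < length qs")
        case True
        then show ?thesis using con i neq unfolding consistent_def \<kappa>'_def by (simp add: nth_append)
      next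
        case False
        then have "i = length qs" using i(1) by simp
        then show ?thesis using i(2) FE[OF _ v] by simp
      qed
    qed
  qed
  ultimately show ?thesis unfolding causal_wins_def by blast
qed

text \<open>Induction from the last quantifier. A universal one is met by every behavioral functor.
  For an existential one, the response may read its own past, and the functor is the solution of
  this recursion over time.\<close>

lemma causal_wins_hsem:
  assumes "dom \<chi> = P" "distinct (map snd qs)" "snd ` set qs \<inter> P = {}" "causal_wins P \<chi> qs W"
  shows "hsem fl {{\<chi>}} qs W"
  using assms(2-)
proof (induction qs arbitrary: W rule: rev_induct)
  case Nil
  have "\<chi> \<in> plays P \<chi> {}" using assms(1) by (simp add: plays_def)
  then have "\<chi> \<in> W" using Nil(3) unfolding causal_wins_def consistent_def by auto
  then show ?case by (cases fl) auto
next
  case (snoc a qs)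
  obtain Q p where a: "a = (Q, p)" by (cases a)
  have p: "p \<notin> P" "p \<notin> snd ` set qs" and dist: "distinct (map snd qs)" "snd ` set qs \<inter> P = {}"
    using snoc(2,3) by (auto simp: a)
  have hyp: "hyper P {{\<chi>}}" using assms(1) by (auto simp: hyper_def Asg_def)
  obtain \<kappa> where \<kappa>: "causal P \<chi> (qs @ [(Q, p)]) \<kappa>"
    and win: "\<And>v. v \<in> plays P \<chi> (snd ` set (qs @ [(Q, p)])) \<Longrightarrow> consistent (qs @ [(Q, p)]) \<kappa> v \<Longrightarrow> v \<in> W"
    using snoc(4) unfolding causal_wins_def a by blast
  show ?case
  proof (cases Q)
    case QA
    have "hsem fl {{\<chi>}} qs {v. v(p \<mapsto> F v) \<in> W}" if F: "F \<in> FncB (P \<union> snd ` set qs)" for F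
    proof (rule snoc(1)[OF dist], rule causal_wins_snoc[OF p \<kappa> win])
      fix v v' t
      assume v: "v \<in> plays P \<chi> (snd ` set qs)" "v' \<in> plays P \<chi> (snd ` set qs)"
        and ag: "agree_upto_all (snd ` set qs) t v v'"
      show "F v t = F v' t"
      proof (rule FncB_agree[OF F])
        have "{q \<in> P \<union> snd ` set qs. v q \<noteq> v' q} \<subseteq> snd ` set qs" using v unfolding plays_def by auto
        then show "finite {q \<in> P \<union> snd ` set qs. v q \<noteq> v' q}" by (rule finite_subset) simp
      qed (use v ag in \<open>auto simp: plays_def Asg_def agree_upto_all_def\<close>)
    qed (use QA in auto)
    then show ?thesis unfolding a QA hsem_snoc_QA[OF hyp] by blast
  next
    case QE
    \<comment> \<open>\<open>G v t\<close> is correct below \<open>t\<close>; its default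
      \<open>False\<close> elsewhere is not read when the value at \<open>t\<close> is
      computed.\<close>
    define G where "G v = rec_nat (\<lambda>_. False) (\<lambda>t g. g(t := \<kappa> p (v(p \<mapsto> g)) t))" for v
    define F where "F v t = G v (Suc t) t" for v t
    have GS: "G v (Suc t) = (G v t)(t := \<kappa> p (v(p \<mapsto> G v t)) t)" for v t by (simp add: G_def)
    have GF: "G v t s = F v s" if "s < t" for v t s
      using that
    proof (induction t)
      case (Suc t) then show ?case by (cases "s = t") (auto simp: F_def GS)
    qed simp
    let ?A = "snd ` set qs" and ?qs = "qs @ [(Q, p)]"
    have ins: "snd ` set ?qs = insert p ?A" by simp
    have caus: "\<kappa> p (v(p \<mapsto> f)) t = \<kappa> p (v'(p \<mapsto> f')) t"
      if "v \<in> plays P \<chi> ?A" "v' \<in> plays P \<chi> ?A" "agree_upto_all ?A t v v'" "\<And>s. s < t \<Longrightarrow> f s = f' s"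
      for v v' f f' t
    proof -
      have "agree_before qs (length qs) t v v'"
        using that(3) by (auto simp: agree_before_def agree_upto_all_def)
      then have "agree_before ?qs (length qs) t (v(p \<mapsto> f)) (v'(p \<mapsto> f'))"
        by (intro agree_before_snoc p that(4)) auto
      moreover have "v(p \<mapsto> f) \<in> plays P \<chi> (snd ` set ?qs)" "v'(p \<mapsto> f') \<in> plays P \<chi> (snd ` set ?qs)"
        unfolding ins using that(1,2) p(1) by (auto intro: plays_upd)
      ultimately show ?thesis
        using \<kappa>[unfolded causal_def, rule_format, of "length qs"] QE by simp
    qed
    have Feq: "F v t = \<kappa> p (v(p \<mapsto> F v)) t" if "v \<in> plays P \<chi> ?A" for v t
    proof -
      have "F v t = \<kappa> p (v(p \<mapsto> G v t)) t" by (simp add: F_def GS)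
      also have "\<dots> = \<kappa> p (v(p \<mapsto> F v)) t"
        using that by (intro caus) (auto simp: GF agree_upto_all_def)
      finally show ?thesis .
    qed
    have Fcaus: "F v t = F v' t"
      if "v \<in> plays P \<chi> ?A" "v' \<in> plays P \<chi> ?A" "agree_upto_all ?A t v v'" for v v' t
      using that(3)
    proof (induction t rule: less_induct)
      case (less t)
      have "F v s = F v' s" if "s < t" for s
        using less(1)[OF that] less(2) that by (auto simp: agree_upto_all_def)
      then have "\<kappa> p (v(p \<mapsto> F v)) t = \<kappa> p (v'(p \<mapsto> F v')) t"
        using that(1,2) less(2) by (intro caus) auto
      then show ?case using Feq that(1,2) by simp
    qed
    have win': "causal_wins P \<chi> qs {v. v(p \<mapsto> F v) \<in> W}"
    proof (rule causal_wins_snoc[OF p \<kappa> win Fcaus])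
      fix v assume "v \<in> plays P \<chi> ?A"
      then show "F v = \<kappa> p (v(p \<mapsto> F v))" using Feq by blast
    qed
    \<comment> \<open>\<open>F\<close> is causal only on extensions of \<open>\<chi>\<close>.
      Resetting the \<open>P\<close>-part to \<open>\<chi>\<close> makes it behavioral on all of
      \<open>Asg (P \<union> ?A)\<close> and leaves the plays unaffected.\<close>
    define F' where "F' v = F (\<lambda>q. if q \<in> P then \<chi> q else v q)" for v
    have patch: "(\<lambda>q. if q \<in> P then \<chi> q else v q) \<in> plays P \<chi> ?A" if "v \<in> Asg (P \<union> ?A)" for v
      using that assms(1) unfolding plays_def Asg_def by (auto simp: dom_def split: if_splits)
    have "F' \<in> FncB (P \<union> ?A)" unfolding FncB_def behavioral_def
    proof (clarify)
      fix q v v' k assume q: "q \<in> P \<union> ?A" and v: "v \<in> Asg (P \<union> ?A)" "v' \<in> Asg (P \<union> ?A)"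
        and ag: "agree_upto (P \<union> ?A) q k v v'"
      show "F' v k = F' v' k" unfolding F'_def
      proof (rule Fcaus[OF patch[OF v(1)] patch[OF v(2)]])
        show "agree_upto_all ?A k (\<lambda>q. if q \<in> P then \<chi> q else v q) (\<lambda>q. if q \<in> P then \<chi> q else v' q)"
          unfolding agree_upto_all_def
        proof (intro ballI allI impI)
          fix r s assume "r \<in> ?A" "s \<le> k"
          then show "the (if r \<in> P then \<chi> r else v r) s = the (if r \<in> P then \<chi> r else v' r) s"
            using ag unfolding agree_upto_def by (cases "r = q") auto
        qed
      qed
    qed
    moreover have "causal_wins P \<chi> qs {v. v(p \<mapsto> F' v) \<in> W}"
    proof -
      have "F' v = F v" if "v \<in> plays P \<chi> ?A" for v
      proof -
        have "(\<lambda>q. if q \<in> P then \<chi> q else v q) = v" using that by (auto simp: plays_def)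
        then show ?thesis by (simp add: F'_def)
      qed
      then show ?thesis using win' unfolding causal_wins_def by fastforce
    qed
    ultimately show ?thesis unfolding a QE hsem_snoc_QE[OF hyp] using snoc(1)[OF dist] by blast
  qed
qed

section \<open>The round game over an input word\<close>

definition set_prop :: "'ap \<Rightarrow> bool \<Rightarrow> 'ap set \<Rightarrow> 'ap set" where
  "set_prop p b a = (if b then insert p a else a - {p})"

fun round_q :: "(quant \<times> 'ap) list \<Rightarrow> 'ap set \<Rightarrow> ('ap set \<Rightarrow> bool) \<Rightarrow> bool" where
  "round_q [] a X = X a"
| "round_q ((QE, p) # qs) a X = (\<exists>b. round_q qs (set_prop p b a) X)"
| "round_q ((QA, p) # qs) a X = (\<forall>b. round_q qs (set_prop p b a) X)"

lemma round_q_mono: "round_q qs a X \<Longrightarrow> (\<And>x. X x \<Longrightarrow> Y x) \<Longrightarrow> round_q qs a Y"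
  by (induction qs a X rule: round_q.induct) auto

lemma round_q_const: "round_q qs a (\<lambda>_. b) \<longleftrightarrow> b"
  by (induction qs a "\<lambda>_ :: 'a set. b" rule: round_q.induct) auto

lemma round_q_flip: "round_q (flip qs) a X \<longleftrightarrow> \<not> round_q qs a (\<lambda>x. \<not> X x)"
  by (induction qs a X rule: round_q.induct) auto

definition win_lang :: "(quant \<times> 'ap) list \<Rightarrow> (nat \<Rightarrow> 'ap set) set \<Rightarrow> (nat \<Rightarrow> 'ap set) set" where
  "win_lang qs L = {w. \<exists>\<sigma>. (\<forall>h. round_q qs (w (length h)) (\<sigma> h)) \<and> (\<forall>b. follows \<sigma> b 0 \<longrightarrow> b \<in> L)}"

text \<open>The player \<open>True\<close> of the Muller game has the effectivity of one round on
  the letter \<open>w (length h)\<close>. Its dual is, by \<open>round_q_flip\<close>, a round of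
  the flipped prefix.\<close>

lemma win_lang_determined:
  assumes L: "recognizable L"
  shows "w \<in> win_lang qs L \<or> w \<in> win_lang (flip qs) (- L)"
proof -
  obtain \<tau> :: "'a set list \<Rightarrow> nat" where \<tau>: "congr_type \<tau>" "saturates \<tau> L"
    using L unfolding recognizable_def by blast
  obtain C col and F :: "(nat \<times> (nat \<times> nat) option) set set"
    where C: "finite C" "\<And>w. w \<in> L \<longleftrightarrow> inf_colors C col w \<in> F"
    using saturated_Muller[OF \<tau>] by blast
  let ?E = "\<lambda>h. round_q qs (w (length h))"
  interpret Muller_game ?E col F
    by unfold_locales (auto simp: round_q_const intro: round_q_mono)
  have out: "outcome (\<lambda>_. None) C 0 b \<longleftrightarrow> b \<in> L" for b
    by (simp add: outcome_def C(2))
  have "wins True (\<lambda>_. None) C [] \<or> wins False (\<lambda>_. None) C []" by (rule Muller_determined[OF C(1)])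
  then show ?thesis
  proof
    assume "wins True (\<lambda>_. None) C []"
    then show ?thesis unfolding wins_def win_lang_def legal_def eff_def by (auto simp: out)
  next
    assume "wins False (\<lambda>_. None) C []"
    then show ?thesis unfolding wins_def win_lang_def legal_def eff_def by (auto simp: out round_q_flip)
  qed
qed

text \<open>The strategy only names a set forced in each round. Within a round, each existential
  value is chosen so that the remaining quantifiers still force this set; when all are fixed, the
  letter lies in it.\<close>

lemma win_lang_causal_wins:
  assumes \<chi>: "dom \<chi> = P" and dist: "distinct (map snd qs)" "snd ` set qs \<inter> P = {}"
    and win: "asg_word \<chi> \<in> win_lang qs L"
  shows "causal_wins P \<chi> qs {v. asg_word v \<in> L}"
proof -
  obtain \<sigma> where \<sigma>: "\<And>h. round_q qs (asg_word \<chi> (length h)) (\<sigma> h)" "\<And>b. follows \<sigma> b 0 \<Longrightarrow> b \<in> L"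
    using win unfolding win_lang_def by blast
  define idx where "idx p = (LEAST i. i < length qs \<and> snd (qs ! i) = p)" for p
  have inj: "i = j" if "snd (qs ! i) = snd (qs ! j)" "i < length qs" "j < length qs" for i j
    using dist(1) that by (metis distinct_conv_nth length_map nth_map)
  have idx: "idx (snd (qs ! i)) = i" if "i < length qs" for i
    unfolding idx_def using that inj by (intro Least_equality) auto
  \<comment> \<open>The letter at time \<open>t\<close> as far as the first \<open>i\<close>
    quantifiers have fixed it; the input supplies the propositions in \<open>P\<close>.\<close>
  define part where "part v t i = asg_word v t \<inter> (P \<union> snd ` set (take i qs))" for v t i
  define \<kappa> where "\<kappa> p v t = (SOME b. round_q (drop (Suc (idx p)) qs)
      (set_prop p b (part v t (idx p))) (\<sigma> (sub (asg_word v) 0 t)))" for p v t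
  let ?A = "snd ` set qs"
  have word: "q \<in> asg_word v t \<longleftrightarrow> q \<in> P \<union> ?A \<and> the (v q) t" if "v \<in> plays P \<chi> ?A" for v t q
  proof -
    have "q \<in> P \<union> ?A \<longleftrightarrow> (\<exists>f. v q = Some f)" using that unfolding plays_def by (auto simp: domIff dom_def)
    then show ?thesis unfolding asg_word_def by auto
  qed
  have "causal P \<chi> qs \<kappa>" unfolding causal_def
  proof (intro allI impI ballI)
    fix i v v' t assume i: "i < length qs" and v: "v \<in> plays P \<chi> ?A" "v' \<in> plays P \<chi> ?A"
      and ag: "agree_before qs i t v v'"
    have P: "v q = v' q" if "q \<in> P" for q using v that by (simp add: plays_def)
    have "asg_word v s = asg_word v' s" if "s < t" for s
      using ag that P unfolding agree_before_def set_eq_iff word[OF v(1)] word[OF v(2)] by auto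
    then have 1: "sub (asg_word v) 0 t = sub (asg_word v') 0 t" by (intro sub_cong) auto
    have "the (v q) t = the (v' q) t" if q: "q \<in> snd ` set (take i qs)" for q
    proof -
      obtain j where "j < i" "q = snd (qs ! j)"
        using q i by (auto simp: in_set_conv_nth)
      then show ?thesis using ag unfolding agree_before_def by simp
    qed
    then have 2: "part v t i = part v' t i"
      unfolding part_def set_eq_iff Int_iff word[OF v(1)] word[OF v(2)] using P by auto
    show "\<kappa> (snd (qs ! i)) v t = \<kappa> (snd (qs ! i)) v' t"
      unfolding \<kappa>_def idx[OF i] 1 2 by simp
  qed
  moreover have "asg_word v \<in> L" if v: "v \<in> plays P \<chi> ?A" and con: "consistent qs \<kappa> v" for v
  proof (rule \<sigma>(2))
    have "\<sigma> (sub (asg_word v) 0 t) (asg_word v t)" for t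
    proof -
      let ?X = "\<sigma> (sub (asg_word v) 0 t)"
      have "round_q (drop i qs) (part v t i) ?X" if "i \<le> length qs" for i
        using that
      proof (induction i)
        case 0
        have "part v t 0 = asg_word \<chi> t"
        proof (rule set_eqI)
          fix q
          have "q \<in> P \<Longrightarrow> v q = \<chi> q" using v by (simp add: plays_def)
          then show "q \<in> part v t 0 \<longleftrightarrow> q \<in> asg_word \<chi> t"
            unfolding part_def asg_word_def using \<chi> by (cases "q \<in> P") auto
        qed
        then show ?case using \<sigma>(1)[of "sub (asg_word v) 0 t"] by simp
      next
        case (Suc i)
        let ?p = "snd (qs ! i)"
        have i: "i < length qs" using Suc(2) by simp
        have IH: "round_q ((fst (qs ! i), ?p) # drop (Suc i) qs) (part v t i) ?X"
          using Suc i by (simp add: Cons_nth_drop_Suc)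
        have "?p \<notin> snd ` set (take i qs)"
        proof
          assume "?p \<in> snd ` set (take i qs)"
          then obtain j where "j < i" "snd (qs ! j) = ?p"
            using i by (auto simp: in_set_conv_nth)
          then show False using inj[of j i] i by simp
        qed
        moreover have "?p \<in> ?A" using i by simp
        then have "?p \<notin> P" using dist(2) by blast
        moreover have "snd ` set (take (Suc i) qs) = insert ?p (snd ` set (take i qs))"
          using i by (simp add: take_Suc_conv_app_nth)
        ultimately have part: "part v t (Suc i) = set_prop ?p (the (v ?p) t) (part v t i)"
          using \<open>?p \<in> ?A\<close> unfolding part_def set_prop_def by (auto simp: word[OF v])
        show ?case
        proof (cases "fst (qs ! i)")
          case QA then show ?thesis using IH part by simp
        next
          case QE
          then have "\<exists>b. round_q (drop (Suc i) qs) (set_prop ?p b (part v t i)) ?X" using IH by simp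
          then have "round_q (drop (Suc i) qs) (set_prop ?p (\<kappa> ?p v t) (part v t i)) ?X"
            unfolding \<kappa>_def idx[OF i] by (rule someI_ex)
          moreover have "the (v ?p) = \<kappa> ?p v" using con i QE unfolding consistent_def by blast
          ultimately show ?thesis using part by simp
        qed
      qed
      from this[of "length qs"] have "?X (part v t (length qs))" by simp
      moreover have "part v t (length qs) = asg_word v t"
        unfolding part_def by (auto simp: word[OF v])
      ultimately show ?thesis by simp
    qed
    then show "follows \<sigma> (asg_word v) 0" by (simp add: follows_def)
  qed
  ultimately show ?thesis unfolding causal_wins_def by blast
qed

text \<open>A win of either player decides the formula accordingly; determinacy turns these two
  implications into an equivalence.\<close>

lemma gfg_sem_win_lang:
  assumes "\<chi> \<in> Asg P" "distinct (map snd qs)" "snd ` set qs \<inter> P = {}"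
  shows "gfg_sem fl {{\<chi>}} qs \<psi> \<longleftrightarrow> asg_word \<chi> \<in> win_lang qs {w. ltl_sem w \<psi>}"
proof -
  let ?L = "{w. ltl_sem w \<psi>}" and ?W = "{\<chi>. ltl_models \<chi> \<psi>}"
  have W: "?W = {v. asg_word v \<in> ?L}" "- ?W = {v. asg_word v \<in> - ?L}" by (auto simp: ltl_models_def)
  have d: "dom \<chi> = P" using assms(1) by (simp add: Asg_def)
  have "snd ` set (flip qs) = snd ` set qs" by (metis list.set_map map_snd_flip)
  then have *: "distinct (map snd (flip qs))" "snd ` set (flip qs) \<inter> P = {}" using assms(2,3) by auto
  show ?thesis unfolding gfg_sem_hsem
  proof
    assume "asg_word \<chi> \<in> win_lang qs ?L"
    then show "hsem fl {{\<chi>}} qs ?W"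
      unfolding W(1) by (intro causal_wins_hsem[OF d assms(2,3)] win_lang_causal_wins[OF d assms(2,3)])
  next
    assume h: "hsem fl {{\<chi>}} qs ?W"
    show "asg_word \<chi> \<in> win_lang qs ?L"
    proof (rule ccontr)
      assume "asg_word \<chi> \<notin> win_lang qs ?L"
      then have "asg_word \<chi> \<in> win_lang (flip qs) (- ?L)"
        using win_lang_determined[OF recognizable_ltl] by blast
      then have "hsem (flip_flag fl) {{\<chi>}} (flip qs) (- ?W)"
        unfolding W(2) by (intro causal_wins_hsem[OF d *] win_lang_causal_wins[OF d *])
      then show False using hsem_flip h by blast
    qed
  qed
qed

section \<open>Recognizability of the winning region\<close>

fun force :: "(quant \<times> 'ap) list \<Rightarrow> 'ap set list \<Rightarrow> ('ap set list \<Rightarrow> bool) \<Rightarrow> bool" where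
  "force qs [] \<Phi> = \<Phi> []"
| "force qs (a # u) \<Phi> = round_q qs a (\<lambda>x. force qs u (\<lambda>xs. \<Phi> (x # xs)))"

lemma force_mono: "force qs u \<Phi> \<Longrightarrow> (\<And>xs. \<Phi> xs \<Longrightarrow> \<Psi> xs) \<Longrightarrow> force qs u \<Psi>"
proof (induction u arbitrary: \<Phi> \<Psi>)
  case (Cons a u)
  have "round_q qs a (\<lambda>x. force qs u (\<lambda>xs. \<Phi> (x # xs)))" using Cons(2) by simp
  then have "round_q qs a (\<lambda>x. force qs u (\<lambda>xs. \<Psi> (x # xs)))"
    by (rule round_q_mono) (rule Cons(1), assumption, rule Cons(3))
  then show ?case by simp
qed simp

lemma force_True: "force qs u (\<lambda>_. True)"
  by (induction u) (simp_all add: round_q_const)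

lemma force_append: "force qs (u @ v) \<Phi> \<longleftrightarrow> force qs u (\<lambda>xs. force qs v (\<lambda>ys. \<Phi> (xs @ ys)))"
  by (induction u arbitrary: \<Phi>) simp_all

definition force_type :: "(quant \<times> 'ap) list \<Rightarrow> ('ap set list \<Rightarrow> 'c) \<Rightarrow> 'ap set list \<Rightarrow> 'c set set" where
  "force_type qs \<tau> u = {T \<in> Pow (range \<tau>). force qs u (\<lambda>xs. \<tau> xs \<in> T)}"

text \<open>To force \<open>T\<close> on \<open>u @ v\<close> is to force on \<open>u\<close> a type
  \<open>s\<close> after which \<open>rest s T\<close> can be forced on \<open>v\<close>. This
  expresses the force type of a product by those of its factors.\<close>

lemma congr_force_type:
  assumes \<tau>: "congr_type \<tau>" shows "congr_type (force_type qs \<tau>)"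
proof -
  define cmp where "cmp s r = \<tau> ((SOME x. \<tau> x = s) @ (SOME y. \<tau> y = r))" for s r
  have cmp: "\<tau> (x @ y) = cmp (\<tau> x) (\<tau> y)" for x y
    unfolding cmp_def
    by (rule congr_typeD[OF \<tau>]; rule sym; rule someI[of "\<lambda>z. \<tau> z = \<tau> _"]; rule refl)
  define rest where "rest s T = {r \<in> range \<tau>. cmp s r \<in> T}" for s T
  have "T \<in> force_type qs \<tau> (u @ v) \<longleftrightarrow> T \<subseteq> range \<tau> \<and>
      {s \<in> range \<tau>. rest s T \<in> force_type qs \<tau> v} \<in> force_type qs \<tau> u" for T u v
  proof -
    have "force qs v (\<lambda>ys. \<tau> (xs @ ys) \<in> T) \<longleftrightarrow> rest (\<tau> xs) T \<in> force_type qs \<tau> v" for xs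
      unfolding force_type_def rest_def cmp by auto
    then show ?thesis unfolding force_type_def force_append by auto
  qed
  then have app: "force_type qs \<tau> (u @ v) = {T. T \<subseteq> range \<tau> \<and>
      {s \<in> range \<tau>. rest s T \<in> force_type qs \<tau> v} \<in> force_type qs \<tau> u}" for u v
    by blast
  have "range (force_type qs \<tau>) \<subseteq> Pow (Pow (range \<tau>))" unfolding force_type_def by auto
  then have "finite (range (force_type qs \<tau>))"
    using \<tau> unfolding congr_type_def by (meson finite_Pow_iff finite_subset)
  then show ?thesis unfolding congr_type_def app by auto
qed

lemma force_strategy:
  assumes \<sigma>: "\<And>h. round_q qs (w (length h)) (\<sigma> h)" and "length h = n"
  shows "force qs (sub w n (n + m)) (\<lambda>xs. length xs = m \<and> (\<forall>i<m. \<sigma> (h @ take i xs) (xs ! i)))"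
  using assms(2)
proof (induction m arbitrary: n h)
  case (Suc m)
  have "round_q qs (w n) (\<lambda>x. force qs (sub w (Suc n) (Suc n + m))
      (\<lambda>xs. length (x # xs) = Suc m \<and> (\<forall>i<Suc m. \<sigma> (h @ take i (x # xs)) ((x # xs) ! i))))"
  proof (rule round_q_mono[where X = "\<sigma> h"])
    show "round_q qs (w n) (\<sigma> h)" using \<sigma>[of h] Suc(2) by simp
  next
    fix x assume x: "\<sigma> h x"
    have "length (h @ [x]) = Suc n" using Suc(2) by simp
    from Suc(1)[OF this]
    show "force qs (sub w (Suc n) (Suc n + m))
      (\<lambda>xs. length (x # xs) = Suc m \<and> (\<forall>i<Suc m. \<sigma> (h @ take i (x # xs)) ((x # xs) ! i)))"
    proof (rule force_mono)
      fix xs assume xs: "length xs = m \<and> (\<forall>i<m. \<sigma> ((h @ [x]) @ take i xs) (xs ! i))"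
      have "\<sigma> (h @ take i (x # xs)) ((x # xs) ! i)" if "i < Suc m" for i
        using xs x that by (cases i) auto
      then show "length (x # xs) = Suc m \<and> (\<forall>i<Suc m. \<sigma> (h @ take i (x # xs)) ((x # xs) ! i))"
        using xs by simp
    qed
  qed
  moreover have "sub w n (n + Suc m) = w n # sub w (Suc n) (Suc n + m)" by (simp add: sub_Cons)
  ultimately show ?case by (simp only: force.simps)
qed simp

lemma force_type_strategy:
  assumes \<sigma>: "\<And>h. round_q qs (w (length h)) (\<sigma> h)" and "length h = n" "n \<le> m"
  shows "{\<tau> xs |xs. length xs = m - n \<and> (\<forall>i<m - n. \<sigma> (h @ take i xs) (xs ! i))}
    \<in> force_type qs \<tau> (sub w n m)"
proof -
  have "force qs (sub w n (n + (m - n)))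
    (\<lambda>xs. \<tau> xs \<in> {\<tau> xs |xs. length xs = m - n \<and> (\<forall>i<m - n. \<sigma> (h @ take i xs) (xs ! i))})"
    by (rule force_mono[OF force_strategy[where \<sigma> = \<sigma> and h = h]]) (use assms in auto)
  then show ?thesis using assms(3) unfolding force_type_def by auto
qed

text \<open>Playing segment by segment: the player picks a forceable set of segment types, his
  opponent a type in it. Only the force types of the segments of \<open>w\<close> matter.\<close>

definition segment_wins :: "('ap set list \<Rightarrow> 'c) \<Rightarrow> (nat \<Rightarrow> 'ap set) set \<Rightarrow> (nat \<Rightarrow> 'c set set) \<Rightarrow> bool" where
  "segment_wins \<tau> L e \<longleftrightarrow> (\<exists>\<rho>. (\<forall>h. \<rho> h \<in> e (length h)) \<and>
     (\<forall>s. (\<forall>k. s k \<in> \<rho> (sub s 0 k)) \<longrightarrow>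
        (\<forall>y g. factoring g \<longrightarrow> (\<forall>i. \<tau> (seg y g i) = s i) \<longrightarrow> y \<in> L)))"

text \<open>Each type announced by the opponent is realised by a segment consistent with
  \<open>\<sigma>\<close>. These segments form a play in \<open>L\<close>, and saturation carries
  membership over to any \<open>y\<close> with the same types.\<close>

lemma win_lang_segment_wins:
  assumes sat: "saturates \<tau> L" and f: "factoring f" and w: "w \<in> win_lang qs L"
  shows "segment_wins \<tau> L (\<lambda>k. force_type qs \<tau> (seg w f k))"
proof -
  obtain \<sigma> where \<sigma>: "\<And>h. round_q qs (w (length h)) (\<sigma> h)" "\<And>b. follows \<sigma> b 0 \<Longrightarrow> b \<in> L"
    using w unfolding win_lang_def by blast
  define ok where "ok k h xs \<longleftrightarrow> length xs = f (Suc k) - f k \<and>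
    (\<forall>i<f (Suc k) - f k. \<sigma> (h @ take i xs) (xs ! i))" for k h xs
  define pick where "pick k h c = (SOME xs. ok k h xs \<and> \<tau> xs = c)" for k h c
  \<comment> \<open>The concrete history rebuilt from the announced types.\<close>
  define R where "R s = rec_nat [] (\<lambda>k h. h @ pick k h (s k))" for s :: "nat \<Rightarrow> 'b"
  have R0: "R s 0 = []" and RS: "R s (Suc k) = R s k @ pick k (R s k) (s k)" for s k
    by (simp_all add: R_def)
  have R_cong: "R s k = R s' k" if "\<And>i. i < k \<Longrightarrow> s i = s' i" for s s' k
    using that by (induction k) (simp_all add: R0 RS)
  \<comment> \<open>\<open>\<rho>\<close> must be legal on all histories;
    \<open>range \<tau>\<close>, always forceable, covers those whose reconstruction has the wrong
    length.\<close>
  define \<rho> where "\<rho> h = (let r = R ((!) h) (length h) in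
    if length r = f (length h) then {\<tau> xs |xs. ok (length h) r xs} else range \<tau>)" for h
  have "\<rho> h \<in> force_type qs \<tau> (seg w f (length h))" for h
  proof -
    let ?k = "length h" and ?r = "R ((!) h) (length h)"
    have "range \<tau> \<in> force_type qs \<tau> (seg w f ?k)"
      by (simp add: force_type_def force_True)
    moreover have "{\<tau> xs |xs. ok ?k ?r xs} \<in> force_type qs \<tau> (seg w f ?k)" if "length ?r = f ?k"
      unfolding ok_def using factoring_less[OF f, of ?k] by (intro force_type_strategy \<sigma>(1) that) simp
    ultimately show ?thesis by (simp add: \<rho>_def Let_def)
  qed
  moreover have "y \<in> L" if s: "\<forall>k. s k \<in> \<rho> (sub s 0 k)" and g: "factoring g" "\<forall>i. \<tau> (seg y g i) = s i" for s y g
  proof -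
    have "R ((!) (sub s 0 k)) k = R s k" for k by (rule R_cong) simp
    then have \<rho>s: "\<rho> (sub s 0 k) = {\<tau> xs |xs. ok k (R s k) xs}" if "length (R s k) = f k" for k
      using that by (simp add: \<rho>_def)
    define v where "v k = pick k (R s k) (s k)" for k
    have v: "ok k (R s k) (v k) \<and> \<tau> (v k) = s k" if "length (R s k) = f k" for k
    proof -
      have "s k \<in> {\<tau> xs |xs. ok k (R s k) xs}" using s \<rho>s[OF that] by metis
      then have "\<exists>xs. ok k (R s k) xs \<and> \<tau> xs = s k" by auto
      then show ?thesis unfolding v_def pick_def by (rule someI_ex)
    qed
    have len: "length (R s k) = f k" for k
    proof (induction k)
      case 0 then show ?case using f by (simp add: R0 factoring_def)
    next
      case (Suc k)
      then show ?case using v[OF Suc] factoring_less[OF f, of k]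
        by (simp add: RS v_def[symmetric] ok_def)
    qed
    note v = v[OF len]
    obtain b where b: "\<And>k. seg b f k = v k"
      using word_of_segments[OF f, of v] v unfolding ok_def by metis
    have bR: "sub b 0 (f k) = R s k" for k
    proof (induction k)
      case 0 then show ?case using f by (simp add: R0 factoring_def)
    next
      case (Suc k)
      have "sub b 0 (f (Suc k)) = sub b 0 (f k) @ seg b f k"
        using factoring_less[OF f, of k] by (simp add: sub_append)
      then show ?case using Suc b by (simp add: RS v_def)
    qed
    have "\<sigma> (sub b 0 t) (b t)" for t
    proof -
      obtain k where k: "f k \<le> t" "t < f (Suc k)" using factoring_locate[OF f] .
      then have "\<sigma> (R s k @ take (t - f k) (v k)) (v k ! (t - f k))"
        using v[of k] unfolding ok_def by simp
      moreover have "R s k @ take (t - f k) (v k) = sub b 0 t"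
        using k by (simp add: bR[symmetric] b[symmetric] take_sub sub_append)
      moreover have "v k ! (t - f k) = b t" using k by (simp add: b[symmetric])
      ultimately show ?thesis by simp
    qed
    then have "b \<in> L" using \<sigma>(2) by (simp add: follows_def)
    then show "y \<in> L" using saturatesD[OF sat f g(1), of b y] b v g(2) by simp
  qed
  ultimately show ?thesis unfolding segment_wins_def by blast
qed

text \<open>Within a segment the strategy maintains that the set chosen by \<open>\<rho>\<close> at
  its start can still be forced by completing the segment. At its end, the type actually played lies
  in that set.\<close>

lemma segment_wins_win_lang:
  assumes f: "factoring f" and win: "segment_wins \<tau> L (\<lambda>k. force_type qs \<tau> (seg w f k))"
  shows "w \<in> win_lang qs L"
proof -
  obtain \<rho> where \<rho>: "\<And>h. \<rho> h \<in> force_type qs \<tau> (seg w f (length h))"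
    "\<And>s y g. \<forall>k. s k \<in> \<rho> (sub s 0 k) \<Longrightarrow> factoring g \<Longrightarrow> \<forall>i. \<tau> (seg y g i) = s i \<Longrightarrow> y \<in> L"
    using win unfolding segment_wins_def by blast
  define idx where "idx n = (THE k. f k \<le> n \<and> n < f (Suc k))" for n
  have idx: "idx n = k" if "f k \<le> n" "n < f (Suc k)" for n k
    unfolding idx_def using that factoring_unique[OF f] by (intro the_equality) blast+
  define types where "types b k = \<tau> (seg b f k)" for b k
  define goal where "goal b k n ys \<longleftrightarrow> \<tau> (sub b (f k) n @ ys) \<in> \<rho> (sub (types b) 0 k)" for b k n ys
  define good where "good b n x \<longleftrightarrow>
    force qs (sub w (Suc n) (f (Suc (idx n)))) (\<lambda>ys. goal b (idx n) n (x # ys))" for b n x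
  define \<sigma> where "\<sigma> h = (if round_q qs (w (length h)) (good ((!) h) (length h))
    then good ((!) h) (length h) else (\<lambda>_. True))" for h
  have "round_q qs (w (length h)) (\<sigma> h)" for h by (simp add: \<sigma>_def round_q_const)
  moreover have "b \<in> L" if b: "follows \<sigma> b 0" for b
  proof -
    \<comment> \<open>The strategy evaluates \<open>goal\<close> on a finite history read as a word;
      the goal looks only at letters before \<open>n\<close>.\<close>
    have goal_prefix: "goal ((!) (sub b 0 n)) k n = goal b k n" if "f k \<le> n" for k n
    proof -
      have "sub (types ((!) (sub b 0 n))) 0 k = sub (types b) 0 k"
      proof (rule sub_cong)
        fix i assume "i < k"
        then have "f (Suc i) \<le> n" using factoring_le[OF f, of "Suc i" k] that by simp
        then show "types ((!) (sub b 0 n)) i = types b i" by (simp add: types_def sub_nth_sub)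
      qed
      then show ?thesis by (simp add: goal_def fun_eq_iff sub_nth_sub)
    qed
    have track: "f k + d \<le> f (Suc k) \<Longrightarrow> force qs (sub w (f k + d) (f (Suc k))) (goal b k (f k + d))" for k d
    proof (induction d)
      case 0
      have "\<rho> (sub (types b) 0 k) \<in> force_type qs \<tau> (seg w f k)"
        using \<rho>(1)[of "sub (types b) 0 k"] by simp
      then show ?case by (simp add: force_type_def goal_def[abs_def])
    next
      case (Suc d)
      let ?n = "f k + d"
      have n: "f k \<le> ?n" "?n < f (Suc k)" using Suc(2) by auto
      have "good ((!) (sub b 0 ?n)) ?n = good b ?n"
        unfolding good_def[abs_def] idx[OF n] goal_prefix[OF n(1)] ..
      moreover have "round_q qs (w ?n) (good b ?n)"
        using Suc(1) n unfolding good_def[abs_def] idx[OF n] by (simp add: sub_Cons)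
      moreover have "\<sigma> (sub b 0 ?n) (b ?n)" using b by (simp add: follows_def)
      ultimately have "good b ?n (b ?n)" by (simp add: \<sigma>_def)
      then have "force qs (sub w (Suc ?n) (f (Suc k))) (\<lambda>ys. goal b k ?n (b ?n # ys))"
        by (simp add: good_def idx[OF n])
      then show ?case by (simp add: goal_def[abs_def] sub_Suc)
    qed
    have "types b k \<in> \<rho> (sub (types b) 0 k)" for k
      using track[of k "f (Suc k) - f k"] factoring_less[OF f, of k]
      by (simp add: goal_def types_def)
    then show "b \<in> L" by (intro \<rho>(2)[OF _ f, of "types b"]) (simp_all add: types_def)
  qed
  ultimately show ?thesis unfolding win_lang_def by blast
qed

lemma recognizable_win_lang:
  assumes "recognizable L" shows "recognizable (win_lang qs L)"
proof -
  obtain \<tau> :: "'a set list \<Rightarrow> nat" where \<tau>: "congr_type \<tau>" "saturates \<tau> L"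
    using assms unfolding recognizable_def by blast
  have "saturates (force_type qs \<tau>) (win_lang qs L)" unfolding saturates_def
  proof (intro allI impI)
    fix w w' f f'
    assume "factoring f" "factoring f'" "\<forall>i. force_type qs \<tau> (seg w f i) = force_type qs \<tau> (seg w' f' i)"
      "w \<in> win_lang qs L"
    then show "w' \<in> win_lang qs L"
      using win_lang_segment_wins[OF \<tau>(2), of f w qs] segment_wins_win_lang[of f' \<tau> L qs w'] by simp
  qed
  then show ?thesis using recognizableI[OF congr_force_type[OF \<tau>(1)]] by blast
qed

section \<open>Both translations combined\<close>

theorem mainTheorem20:
  assumes "infinite (UNIV :: 'ap set)"
  shows "(\<forall>\<phi> :: 'ap qptl. \<exists>\<phi>'. gfg_wf \<phi>' \<and> gfg_free \<phi>' = qfree \<phi> \<and>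
            (\<forall>\<chi> \<in> Asg (qfree \<phi>). qsat \<chi> \<phi> \<longleftrightarrow> gfg_models EA {{\<chi>}} \<phi>'))
       \<and> (\<forall>\<phi>' :: 'ap gfg. gfg_wf \<phi>' \<longrightarrow> (\<exists>\<phi>. qfree \<phi> = gfg_free \<phi>' \<and>
            (\<forall>\<chi> \<in> Asg (gfg_free \<phi>'). qsat \<chi> \<phi> \<longleftrightarrow> gfg_models EA {{\<chi>}} \<phi>')))"
proof (intro conjI allI impI)
  fix \<phi> :: "'ap qptl"
  obtain L where L: "recognizable L" "\<And>\<chi>. qsat \<chi> \<phi> \<longleftrightarrow> asg_word \<chi> \<in> L"
    using recognizable_qptl by blast
  obtain ps \<psi> where ps: "distinct ps" "ltl_props \<psi> - set ps = qfree \<phi>"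
    "\<And>\<chi>. \<chi> \<in> Asg (qfree \<phi>) \<Longrightarrow> qsat \<chi> (foldr QEx ps (QLtl \<psi>)) \<longleftrightarrow> asg_word \<chi> \<in> L"
    by (rule recognizable_ex_ltl_asg[OF assms L(1) finite_qfree]) blast
  have "map snd (map (Pair QE) ps) = ps" by (simp add: comp_def)
  moreover have "gfg_sem EA {{\<chi>}} (map (Pair QE) ps) \<psi> \<longleftrightarrow> qsat \<chi> (foldr QEx ps (QLtl \<psi>))" for \<chi>
    by (subst gfg_sem_exs) auto
  ultimately show "\<exists>\<phi>'. gfg_wf \<phi>' \<and> gfg_free \<phi>' = qfree \<phi> \<and>
      (\<forall>\<chi> \<in> Asg (qfree \<phi>). qsat \<chi> \<phi> \<longleftrightarrow> gfg_models EA {{\<chi>}} \<phi>')"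
    using ps L(2) by (intro exI[of _ "(map (Pair QE) ps, \<psi>)"])
      (simp add: gfg_wf_def gfg_free_def gfg_models_def del: map_map)
next
  fix \<phi>' :: "'ap gfg"
  assume wf: "gfg_wf \<phi>'"
  obtain qs \<psi> where \<phi>': "\<phi>' = (qs, \<psi>)" by (cases \<phi>')
  let ?P = "gfg_free \<phi>'"
  have P: "finite ?P" "snd ` set qs \<inter> ?P = {}" "distinct (map snd qs)"
    using wf by (auto simp: gfg_free_def gfg_wf_def \<phi>' finite_ltl_props)
  obtain ps \<psi>' where ps: "ltl_props \<psi>' - set ps = ?P"
    "\<And>\<chi>. \<chi> \<in> Asg ?P \<Longrightarrow> qsat \<chi> (foldr QEx ps (QLtl \<psi>')) \<longleftrightarrow> asg_word \<chi> \<in> win_lang qs {w. ltl_sem w \<psi>}"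
    by (rule recognizable_ex_ltl_asg[OF assms recognizable_win_lang[OF recognizable_ltl] P(1)]) blast
  have "gfg_models EA {{\<chi>}} \<phi>' \<longleftrightarrow> asg_word \<chi> \<in> win_lang qs {w. ltl_sem w \<psi>}" if "\<chi> \<in> Asg ?P" for \<chi>
    unfolding gfg_models_def \<phi>' using gfg_sem_win_lang[OF that P(3,2)] by simp
  then show "\<exists>\<phi>. qfree \<phi> = ?P \<and> (\<forall>\<chi> \<in> Asg ?P. qsat \<chi> \<phi> \<longleftrightarrow> gfg_models EA {{\<chi>}} \<phi>')"
    using ps by (intro exI[of _ "foldr QEx ps (QLtl \<psi>')"]) (simp add: qfree_exs)
qed

end
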